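(* Let $m$ be a positive even integer, let $f\colon\mathbb{R}^m\to\mathbb{R}^{2m-1}$ be smooth, and let $r>0$ be such that there are no singular points of $f$ belonging to $S^{m-1}(r)$. If $f$ has only cross-caps as singular points, then $$\Lambda\big((df)|S^{m-1}(r)\big)=\text{ number of cross-caps of } f \text{ in } \overline{B}^m(r)\mod 2.$$
   Context: $S^{m-1}(r)$ and $\overline{B}^m(r)$ are the sphere and the closed ball of radius $r$ centered at $0$ in $\mathbb{R}^m$. A point $p$ is a singular point of $f$ if $\operatorname{rank} df(p)<m$. A point $p$ is a cross-cap of a smooth mapping $f$ into $\mathbb{R}^{2m-1}$ if there are local coordinate systems near $p$ and $f(p)$ in which $f$ has the form $(x_1,\ldots,x_m)\mapsto(x_1^2,x_2,\ldots,x_m,x_1x_2,\ldots,x_1x_m)$. $M_k(\mathbb{R}^n)$ is the space of $k$-tuples of vectors in $\mathbb{R}^n$ (real $n\times k$ matrices), and $\widetilde{V}_k(\mathbb{R}^n)\subset M_k(\mathbb{R}^n)$ is the set of all linearly independent $k$-tuples. The derivative $df$ is regarded as a map $\mathbb{R}^m\to M_m(\mathbb{R}^{2m-1})$; since $f$ has no singular points on $S^{m-1}(r)$, $(df)|S^{m-1}(r)$ maps into $\widetilde{V}_m(\mathbb{R}^{2m-1})$. Definition of $\Lambda$: let $n>k>1$ with $n-k$ odd (here $k=m$, $n=2m-1$). For smooth $a=(a_1,\ldots,a_k)\colon\overline{B}^{n-k+1}(r)\to M_k(\mathbb{R}^n)$ define $\widetilde{a}\colon S^{k-1}\times\overline{B}^{n-k+1}(r)\to\mathbb{R}^n$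 by $\widetilde{a}(\beta,x)=\beta_1a_1(x)+\ldots+\beta_ka_k(x)$, where $S^{k-1}$ is the unit sphere in $\mathbb{R}^k$. For smooth $\alpha\colon S^{n-k}(r)\to\widetilde{V}_k(\mathbb{R}^n)$, $$\Lambda(\alpha)=\sum_{(\beta,x)}\deg_{(\beta,x)}\widetilde{a}\mod 2,$$ where $a$ is any smooth mapping with $a|S^{n-k}(r)=\alpha$ and $\widetilde{a}^{-1}(0)$ finite (such $a$ exists), and the sum is over half of the zeros of $\widetilde{a}$: exactly one point is chosen from each pair $(\beta,x),(-\beta,x)\in\widetilde{a}^{-1}(0)$. The value does not depend on the choices. Here $\deg_p$ is the local topological degree at an isolated zero $p$. *)

theory Defs
  imports "HOL-Analysis.Analysis" "HOL-Homology.Homology"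
begin

primrec Ck_on :: "nat \<Rightarrow> 'a::euclidean_space set \<Rightarrow> ('a \<Rightarrow> 'b::real_normed_vector) \<Rightarrow> bool" where
  "Ck_on 0 U f \<longleftrightarrow> continuous_on U f"
| "Ck_on (Suc k) U f \<longleftrightarrow>
     (\<forall>x\<in>U. f differentiable (at x)) \<and> (\<forall>v. Ck_on k U (\<lambda>x. frechet_derivative f (at x) v))"

text \<open>On a set that need not be open (a closed ball, a piece of \<open>S\<^sup>k\<^sup>-\<^sup>1 \<times> \<real>\<^sup>p\<close>), smooth means
  locally extendable to a \<open>C\<^sup>\<infinity>\<close> mapping of an open subset of the ambient space.\<close>

definition smooth_on :: "'a::euclidean_space set \<Rightarrow> ('a \<Rightarrow> 'b::real_normed_vector) \<Rightarrow> bool" where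
  "smooth_on S f \<longleftrightarrow>
     (\<forall>x\<in>S. \<exists>U g. open U \<and> x \<in> U \<and> (\<forall>k. Ck_on k U g) \<and> (\<forall>y\<in>S \<inter> U. g y = f y))"

definition diffeo_onto_image :: "'a::euclidean_space set \<Rightarrow> ('a \<Rightarrow> 'b::euclidean_space) \<Rightarrow> bool" where
  "diffeo_onto_image U \<phi> \<longleftrightarrow>
     inj_on \<phi> U \<and> smooth_on U \<phi> \<and> smooth_on (\<phi> ` U) (inv_into U \<phi>)"

definition singular_point :: "(real^'m \<Rightarrow> real^'n) \<Rightarrow> real^'m \<Rightarrow> bool" where
  "singular_point f p \<longleftrightarrow> rank (jacobian f (at p)) < CARD('m)"

text \<open>The normal form
  \<open>(x\<^sub>1, \<dots>, x\<^sub>m) \<mapsto> (x\<^sub>1\<^sup>2, x\<^sub>2, \<dots>, x\<^sub>m, x\<^sub>1 x\<^sub>2, \<dots>, x\<^sub>1 x\<^sub>m)\<close>. The index \<open>o1\<close> plays the role of \<open>1\<close>, and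
  \<open>\<sigma>\<close> labels the \<open>2m - 1\<close> target coordinates: \<open>Inl i\<close> labels the coordinate \<open>x\<^sub>i\<close>
  (\<open>x\<^sub>1\<^sup>2\<close> if \<open>i = o1\<close>), and \<open>Inr i\<close> with \<open>i \<noteq> o1\<close> labels \<open>x\<^sub>1 x\<^sub>i\<close>.\<close>

definition cross_cap_form :: "'m \<Rightarrow> ('n \<Rightarrow> 'm + 'm) \<Rightarrow> real^'m \<Rightarrow> real^'n" where
  "cross_cap_form o1 \<sigma> x =
     (\<chi> j. case \<sigma> j of Inl i \<Rightarrow> if i = o1 then (x $ o1)\<^sup>2 else x $ i | Inr i \<Rightarrow> x $ o1 * x $ i)"

text \<open>The local coordinates are centred: \<open>p\<close> and \<open>f p\<close> have coordinates \<open>0\<close>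
  (for \<open>f p\<close> this follows from the other conditions).\<close>

definition cross_cap :: "(real^'m \<Rightarrow> real^'n) \<Rightarrow> real^'m \<Rightarrow> bool" where
  "cross_cap f p \<longleftrightarrow>
     (\<exists>o1 \<sigma> U V \<phi> \<psi>.
        bij_betw \<sigma> UNIV (Inl ` UNIV \<union> Inr ` (UNIV - {o1})) \<and>
        open U \<and> p \<in> U \<and> diffeo_onto_image U (\<phi> :: real^'m \<Rightarrow> real^'m) \<and> open (\<phi> ` U) \<and> \<phi> p = 0 \<and>
        open V \<and> f ` U \<subseteq> V \<and> diffeo_onto_image V (\<psi> :: real^'n \<Rightarrow> real^'n) \<and> open (\<psi> ` V) \<and>
        \<psi> (f p) = 0 \<and>
        (\<forall>x\<in>U. \<psi> (f x) = cross_cap_form o1 \<sigma> (\<phi> x)))"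

text \<open>The degree of a self-map of the unit sphere of \<open>real^'n\<close>. Both copies of the sphere are
  identified with \<open>nsphere\<close> through the same enumeration of the coordinates, so the degree does not
  depend on the enumeration.\<close>

definition coord_enum :: "nat \<Rightarrow> 'n::finite" where
  "coord_enum = (SOME e. bij_betw e {..<CARD('n)} UNIV)"

definition vec_to_seq :: "real^'n \<Rightarrow> nat \<Rightarrow> real" where
  "vec_to_seq u = (\<lambda>i. if i < CARD('n) then u $ coord_enum i else 0)"

definition seq_to_vec :: "(nat \<Rightarrow> real) \<Rightarrow> real^'n" where
  "seq_to_vec y = (\<chi> j. y (inv_into {..<CARD('n)} coord_enum j))"

definition sphere_degree :: "(real^'n \<Rightarrow> real^'n) \<Rightarrow> int" where
  "sphere_degree h = Brouwer_degree2 (CARD('n) - 1) (vec_to_seq \<circ> h \<circ> seq_to_vec)"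

text \<open>For a continuous mapping with an isolated zero at \<open>p\<close>, the degree of
  \<open>g / |g|\<close> on all sufficiently small spheres centred at \<open>p\<close>.\<close>

definition local_degree :: "(real^'n \<Rightarrow> real^'n) \<Rightarrow> real^'n \<Rightarrow> int" where
  "local_degree g p =
     (THE d. \<forall>\<^sub>F \<epsilon> in at_right 0. sphere_degree (\<lambda>u. sgn (g (p + \<epsilon> *\<^sub>R u))) = d)"

text \<open>Smooth local parametrizations of the manifold \<open>S\<^sup>k\<^sup>-\<^sup>1 \<times> \<real>\<^sup>p\<close>,
  whose dimension \<open>k - 1 + p\<close> is \<open>n\<close> in all uses, sending \<open>0\<close> to a given point \<open>z\<close>.\<close>

definition local_param :: "(real^'n \<Rightarrow> (real^'k) \<times> (real^'p)) \<Rightarrow> (real^'k) \<times> (real^'p) \<Rightarrow> bool" where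
  "local_param \<phi> z \<longleftrightarrow>
     (\<exists>U. open U \<and> 0 \<in> U \<and> \<phi> 0 = z \<and> diffeo_onto_image U \<phi> \<and>
          openin (top_of_set (sphere 0 1 \<times> UNIV)) (\<phi> ` U))"

text \<open>The local degree at a zero \<open>z\<close> of a mapping from \<open>S\<^sup>k\<^sup>-\<^sup>1 \<times> \<real>\<^sup>p\<close>
  (defined near \<open>z\<close>) to \<open>\<real>\<^sup>n\<close>. No orientation of the parametrization is fixed, so it
  is determined only up to sign; it is used only modulo 2.\<close>

definition manifold_degree :: "((real^'k) \<times> (real^'p) \<Rightarrow> real^'n) \<Rightarrow> (real^'k) \<times> (real^'p) \<Rightarrow> int" where
  "manifold_degree g z =
     (SOME d. \<exists>\<phi> :: real^'n \<Rightarrow> (real^'k) \<times> (real^'p). local_param \<phi> z \<and> d = local_degree (g \<circ> \<phi>) 0)"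

text \<open>A \<open>k\<close>-tuple of vectors in \<open>\<real>\<^sup>n\<close> is the \<open>n \<times> k\<close> matrix of type
  \<open>real^'k^'n\<close> having these vectors as columns. The type \<open>'p\<close> has \<open>n - k + 1\<close> elements, so that
  \<open>sphere 0 r\<close> and \<open>cball 0 r\<close> in \<open>real^'p\<close> are \<open>S\<^sup>n\<^sup>-\<^sup>k(r)\<close> and the closed ball it bounds.\<close>

definition tilde :: "(real^'p \<Rightarrow> real^'k^'n) \<Rightarrow> (real^'k) \<times> (real^'p) \<Rightarrow> real^'n" where
  "tilde a = (\<lambda>(\<beta>, x). \<Sum>i\<in>UNIV. \<beta> $ i *\<^sub>R column i (a x))"

definition tilde_zeros :: "real \<Rightarrow> (real^'p \<Rightarrow> real^'k^'n) \<Rightarrow> ((real^'k) \<times> (real^'p)) set" where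
  "tilde_zeros r a = {z \<in> sphere 0 1 \<times> cball 0 r. tilde a z = 0}"

definition half_of_zeros :: "((real^'k) \<times> (real^'p)) set \<Rightarrow> ((real^'k) \<times> (real^'p)) set \<Rightarrow> bool" where
  "half_of_zeros Z H \<longleftrightarrow> H \<subseteq> Z \<and> (\<forall>(\<beta>, x)\<in>Z. (\<beta>, x) \<in> H \<longleftrightarrow> (- \<beta>, x) \<notin> H)"

text \<open>\<open>\<alpha>\<close> is a mapping of \<open>sphere 0 r\<close> into the linearly independent \<open>k\<close>-tuples;
  its values off the sphere are not used.\<close>

definition Lambda :: "real \<Rightarrow> (real^'p \<Rightarrow> real^'k^'n) \<Rightarrow> int" where
  "Lambda r \<alpha> =
     (THE v. \<exists>a H. smooth_on (cball 0 r) a \<and> (\<forall>x\<in>sphere 0 r. a x = \<alpha> x) \<and>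
                   finite (tilde_zeros r a) \<and> half_of_zeros (tilde_zeros r a) H \<and>
                   v = (\<Sum>z\<in>H. manifold_degree (tilde a) z) mod 2)"

end

theory Submission
  imports Defs
begin

text \<open>For a continuous self-map \<open>F\<close> of \<open>\<real>\<^sup>n\<close> without zeros outside a ball, the degree of \<open>F / |F|\<close> on
  a large sphere (its degree at infinity) is additive when \<open>\<real>\<^sup>n\<close> is cut along a hyperplane free of
  zeros, hence it is the sum of the local degrees of \<open>F\<close>. If the unit vector \<open>v\<close> is not orthogonal
  to any \<open>\<beta>\<close> with \<open>(\<beta>, x)\<close> a zero of \<open>tilde a\<close>, then half of the zeros lie over the open hemisphere
  around \<open>v\<close>, in whose central chart \<open>tilde a\<close> becomes a positive multiple of
  \<open>(y, x) \<mapsto> a x *v (v + y)\<close> with \<open>y\<close> orthogonal to \<open>v\<close>. So modulo 2 the sum in the definition of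
  \<open>Lambda\<close> is the degree at infinity of this map. Any two extensions \<open>a\<close> of \<open>\<alpha>\<close> are joined by a
  path of mappings that, after a generic perturbation, stays injective on a fixed subspace of
  codimension two; along it zeros leave or enter the hemisphere only at antipodal pairs of points of
  its boundary, which does not change the parity of the degree. Finally, for \<open>a = df\<close> the zeros over
  a cross-cap are two antipodal nondegenerate ones, so that each cross-cap contributes an odd
  number.\<close>

section \<open>Additivity of the Brouwer degree over hemispheres\<close>

text \<open>\<open>Lambda\<close> is a definite description, so its value is available only after
  the parity has been shown to be the same for all extensions and all halves of the zeros:
  independence is part of the proof. The obstacle there is a dimension count. Along a path of
  extensions, a kernel vector orthogonal to \<open>v\<close>, taken up to scale, has
  \<open>1 + p + (k - 2) = n\<close> parameters against \<open>n\<close> equations, so no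
  perturbation can be expected to remove all of them. At such a vector a zero runs off to infinity
  in the chart, and the degree at infinity may change. One dimension less leaves
  \<open>n - 1\<close> parameters, whence the codimension two. To catch the zeros that do reach the
  boundary, a direction \<open>v'\<close> orthogonal to \<open>v\<close> is singled out, and the
  line \<open>v + t v'\<close> is replaced by a polygonal path from \<open>- v'\<close> over
  \<open>v\<close> to \<open>v'\<close>, which meets the boundary at finite \<open>t\<close>. The
  path parameter \<open>s\<close> is made a function of the same \<open>t\<close>; the two
  extensions then appear as opposite sides of one closed loop, and the parities are compared by
  cutting that loop at its corners.\<close>

lemma Brouwer_degree2_int_pow:
  "hom_induced (int p) (nsphere p) {} (nsphere p) {} f x
     = x [^]\<^bsub>homology_group (int p) (nsphere p)\<^esub> Brouwer_degree2 p f"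
  if "x \<in> carrier (homology_group (int p) (nsphere p))" "p > 0"
  using Brouwer_degree2[of x p f] that by (simp add: un_reduced_homology_group)

text \<open>The map of pairs factors through \<open>(P, P)\<close>, whose relative homology
  vanishes.\<close>

lemma hom_induced_into_subspace_trivial:
  assumes "continuous_map X Y f" "\<And>x. x \<in> topspace X \<Longrightarrow> f x \<in> P" "S \<subseteq> topspace X"
  shows "hom_induced p X S Y P f c = \<one>\<^bsub>relative_homology_group p Y P\<^esub>"
proof -
  have 1: "continuous_map X (subtopology Y P) f"
    using assms by (simp add: continuous_map_into_subtopology Pi_iff)
  have "hom_induced p X S Y P (id \<circ> f)
      = hom_induced p (subtopology Y P) P Y P id \<circ> hom_induced p X S (subtopology Y P) P f"
    by (rule hom_induced_compose) (use 1 assms in auto)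
  moreover have "trivial_group (relative_homology_group p (subtopology Y P) P)"
    using trivial_relative_homology_group_topspace[of p "subtopology Y P"]
      relative_homology_group_restrict[of p "subtopology Y P" P]
    by (simp add: Int_absorb2 inf.absorb_iff2 Int_assoc)
  then have "hom_induced p X S (subtopology Y P) P f c = \<one>\<^bsub>relative_homology_group p (subtopology Y P) P\<^esub>"
    using hom_induced_carrier[of p X S "subtopology Y P" P f c] by (auto simp: trivial_group_def)
  moreover have "hom_induced p (subtopology Y P) P Y P id \<one>\<^bsub>relative_homology_group p (subtopology Y P) P\<^esub>
     = \<one>\<^bsub>relative_homology_group p Y P\<^esub>"
    by (meson group_relative_homology_group hom_induced_hom hom_one)
  ultimately show ?thesis by simp
qed

text \<open>Since \<open>P\<close> is contractible, the homology of \<open>Y\<close> may be replaced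
  by that of \<open>Y\<close> relative to \<open>P\<close>, and a relative class of the sphere
  splits into one part on each closed hemisphere. On its own hemisphere \<open>ip\<close> or
  \<open>im\<close> agrees with \<open>i\<close>; on the other it maps into \<open>P\<close> and
  contributes nothing.\<close>

lemma hom_induced_hemispheres:
  assumes "N > 0"
    and i: "continuous_map (nsphere N) Y i"
    and ip: "continuous_map (nsphere N) Y ip"
    and im: "continuous_map (nsphere N) Y im"
    and ip_up: "\<And>x. x \<in> topspace (nsphere N) \<Longrightarrow> x k \<ge> 0 \<Longrightarrow> ip x = i x"
    and ip_dn: "\<And>x. x \<in> topspace (nsphere N) \<Longrightarrow> x k \<le> 0 \<Longrightarrow> ip x \<in> P"
    and im_dn: "\<And>x. x \<in> topspace (nsphere N) \<Longrightarrow> x k \<le> 0 \<Longrightarrow> im x = i x"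
    and im_up: "\<And>x. x \<in> topspace (nsphere N) \<Longrightarrow> x k \<ge> 0 \<Longrightarrow> im x \<in> P"
    and P: "contractible_space (subtopology Y P)" "topspace Y \<inter> P \<noteq> {}"
    and c: "c \<in> carrier (homology_group (int N) (nsphere N))"
  shows "hom_induced (int N) (nsphere N) {} Y {} i c =
    hom_induced (int N) (nsphere N) {} Y {} im c
      \<otimes>\<^bsub>homology_group (int N) Y\<^esub> hom_induced (int N) (nsphere N) {} Y {} ip c"
proof -
  let ?S = "nsphere N" and ?p = "int N"
  define Eq where "Eq = topspace ?S \<inter> {x. x k = 0}"
  let ?Ap = "{x::nat\<Rightarrow>real. x k \<ge> 0}" and ?Am = "{x::nat\<Rightarrow>real. x k \<le> 0}"
  let ?G = "relative_homology_group ?p ?S Eq"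
  let ?K = "relative_homology_group ?p Y P"
  let ?I = "\<lambda>f. hom_induced ?p ?S Eq Y P f"
  let ?up = "subtopology ?S ?Ap" and ?dn = "subtopology ?S ?Am"
  have eqP: "i x \<in> P" "ip x \<in> P" "im x \<in> P" if "x \<in> Eq" for x
    using that ip_up[of x] ip_dn[of x] im_up[of x] by (auto simp: Eq_def)
  interpret G: group ?G by simp
  interpret K: group ?K by simp
  have homI: "group_hom ?G ?K (?I f)" for f
    by (simp add: group_hom_def group_hom_axioms_def hom_induced_hom)
  \<comment> \<open>Excision provides \<open>w1\<close> with the same image as \<open>z\<close>
    relative to the lower hemisphere; by exactness of the triple the difference comes from the lower
    hemisphere.\<close>
  have gen: "\<exists>w1 w2. w1 \<in> carrier (relative_homology_group ?p ?up Eq) \<and>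
      w2 \<in> carrier (relative_homology_group ?p ?dn Eq) \<and>
      z = hom_induced ?p ?dn Eq ?S Eq id w2 \<otimes>\<^bsub>?G\<^esub> hom_induced ?p ?up Eq ?S Eq id w1"
    if z: "z \<in> carrier ?G" for z
  proof -
    have tEq: "topspace ?up \<inter> {x. x k = 0} = topspace ?up \<inter> Eq"
      by (auto simp: Eq_def)
    have Eq1: "relative_homology_group ?p ?up {x. x k = 0} = relative_homology_group ?p ?up Eq"
      using arg_cong[OF tEq, of "relative_homology_group ?p ?up"]
      by (simp only: relative_homology_group_restrict)
    have Eq2: "hom_induced ?p ?up {x. x k = 0} ?S ?Am id = hom_induced ?p ?up Eq ?S ?Am id"
      using arg_cong[OF tEq, of "\<lambda>E. hom_induced ?p ?up E ?S (topspace ?S \<inter> ?Am) id"]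
      by (simp only: hom_induced_restrict)
    have iso: "hom_induced ?p ?up Eq ?S ?Am id
        \<in> iso (relative_homology_group ?p ?up Eq) (relative_homology_group ?p ?S ?Am)"
      using iso_relative_homology_group_upper_hemisphere[of ?p N k] by (simp add: Eq1 Eq2)
    let ?j = "hom_induced ?p ?S Eq ?S ?Am id"
    have "?j z \<in> carrier (relative_homology_group ?p ?S ?Am)"
      by (simp add: hom_induced_carrier)
    then have "?j z \<in> hom_induced ?p ?up Eq ?S ?Am id ` carrier (relative_homology_group ?p ?up Eq)"
      using iso by (simp only: iso_iff)
    then obtain w1 where w1: "w1 \<in> carrier (relative_homology_group ?p ?up Eq)"
      and w1z: "hom_induced ?p ?up Eq ?S ?Am id w1 = ?j z"
      by (rule imageE) simp
    let ?e1 = "hom_induced ?p ?up Eq ?S Eq id w1"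
    have e1c: "?e1 \<in> carrier ?G" by (simp add: hom_induced_carrier)
    have je1: "?j ?e1 = ?j z"
    proof -
      have "?j ?e1 = hom_induced ?p ?up Eq ?S ?Am (id \<circ> id) w1"
        by (rule hom_induced_compose') (auto simp: Eq_def)
      then show ?thesis using w1z by simp
    qed
    interpret j: group_hom ?G "relative_homology_group ?p ?S ?Am" ?j
      by (simp add: group_hom_def group_hom_axioms_def hom_induced_hom)
    have "?j (z \<otimes>\<^bsub>?G\<^esub> inv\<^bsub>?G\<^esub> ?e1) = \<one>\<^bsub>relative_homology_group ?p ?S ?Am\<^esub>"
      using z e1c je1 by (simp add: j.hom_mult j.hom_inv hom_induced_carrier del: one_relative_homology_group)
    moreover have "exact_seq ([relative_homology_group ?p ?S ?Am, ?G, relative_homology_group ?p ?dn Eq],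
                    [?j, hom_induced ?p ?dn Eq ?S Eq id])"
      by (rule homology_exactness_triple_3) (auto simp: Eq_def)
    then have "hom_induced ?p ?dn Eq ?S Eq id ` carrier (relative_homology_group ?p ?dn Eq)
        = kernel ?G (relative_homology_group ?p ?S ?Am) ?j" by simp
    ultimately have "z \<otimes>\<^bsub>?G\<^esub> inv\<^bsub>?G\<^esub> ?e1 \<in> hom_induced ?p ?dn Eq ?S Eq id ` carrier (relative_homology_group ?p ?dn Eq)"
      using z e1c by (simp add: kernel_def)
    then obtain w2 where w2: "w2 \<in> carrier (relative_homology_group ?p ?dn Eq)"
      "hom_induced ?p ?dn Eq ?S Eq id w2 = z \<otimes>\<^bsub>?G\<^esub> inv\<^bsub>?G\<^esub> ?e1" by auto
    have "z = hom_induced ?p ?dn Eq ?S Eq id w2 \<otimes>\<^bsub>?G\<^esub> ?e1"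
      unfolding w2(2) using z e1c by (simp add: G.m_assoc del: one_relative_homology_group)
    then show ?thesis using w1 w2 by blast
  qed
  have Iup: "?I f (hom_induced ?p ?up Eq ?S Eq id w) = hom_induced ?p ?up Eq Y P f w"
    if "continuous_map ?S Y f" "f \<in> Eq \<rightarrow> P" for f w
    using that by (subst hom_induced_compose') (auto simp: continuous_map_from_subtopology)
  have Idn: "?I f (hom_induced ?p ?dn Eq ?S Eq id w) = hom_induced ?p ?dn Eq Y P f w"
    if "continuous_map ?S Y f" "f \<in> Eq \<rightarrow> P" for f w
    using that by (subst hom_induced_compose') (auto simp: continuous_map_from_subtopology)
  have rel: "?I i z = ?I im z \<otimes>\<^bsub>?K\<^esub> ?I ip z" if z: "z \<in> carrier ?G" for z
  proof -
    obtain w1 w2 where w: "w1 \<in> carrier (relative_homology_group ?p ?up Eq)"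
      "w2 \<in> carrier (relative_homology_group ?p ?dn Eq)"
      and zeq: "z = hom_induced ?p ?dn Eq ?S Eq id w2 \<otimes>\<^bsub>?G\<^esub> hom_induced ?p ?up Eq ?S Eq id w1"
      using gen[OF z] by blast
    have split: "?I f z = hom_induced ?p ?dn Eq Y P f w2 \<otimes>\<^bsub>?K\<^esub> hom_induced ?p ?up Eq Y P f w1"
      if "continuous_map ?S Y f" "f \<in> Eq \<rightarrow> P" for f
    proof -
      interpret f: group_hom ?G ?K "?I f" by (rule homI)
      show ?thesis unfolding zeq
        by (subst f.hom_mult) (use that in \<open>simp_all add: hom_induced_carrier Iup Idn\<close>)
    qed
    have 1: "hom_induced ?p ?up Eq Y P i = hom_induced ?p ?up Eq Y P ip"
      by (rule hom_induced_eq) (use ip_up in auto)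
    have 2: "hom_induced ?p ?dn Eq Y P i = hom_induced ?p ?dn Eq Y P im"
      by (rule hom_induced_eq) (use im_dn in auto)
    have 3: "hom_induced ?p ?up Eq Y P im w1 = \<one>\<^bsub>?K\<^esub>"
      by (rule hom_induced_into_subspace_trivial)
        (use im im_up in \<open>auto simp: continuous_map_from_subtopology Eq_def\<close>)
    have 4: "hom_induced ?p ?dn Eq Y P ip w2 = \<one>\<^bsub>?K\<^esub>"
      by (rule hom_induced_into_subspace_trivial)
        (use ip ip_dn in \<open>auto simp: continuous_map_from_subtopology Eq_def\<close>)
    show ?thesis
      using split[OF i] split[OF ip] split[OF im] eqP
      by (simp add: 1 2 3 4 Pi_iff hom_induced_carrier del: one_relative_homology_group)
  qed
  let ?j = "hom_induced ?p Y {} Y P id"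
  have isoj: "?j \<in> iso (homology_group ?p Y) ?K"
    using iso_reduced_homology_by_contractible[OF P, of ?p] \<open>N > 0\<close>
    by (simp add: un_reduced_homology_group)
  interpret j: group_hom "homology_group ?p Y" ?K ?j
    by (simp add: group_hom_def group_hom_axioms_def hom_induced_hom)
  let ?q = "hom_induced ?p ?S {} ?S Eq id c"
  have qc: "?q \<in> carrier ?G" by (simp add: hom_induced_carrier)
  have jf: "?j (hom_induced ?p ?S {} Y {} f c) = ?I f ?q"
    if "continuous_map ?S Y f" "f \<in> Eq \<rightarrow> P" for f
    using that by (subst (1 2) hom_induced_compose') auto
  have "?j (hom_induced ?p ?S {} Y {} i c) =
    ?j (hom_induced ?p ?S {} Y {} im c \<otimes>\<^bsub>homology_group ?p Y\<^esub> hom_induced ?p ?S {} Y {} ip c)"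
    using rel[OF qc] jf[OF i] jf[OF ip] jf[OF im] eqP
    by (subst j.hom_mult) (auto simp: hom_induced_carrier Pi_iff)
  moreover have "inj_on ?j (carrier (homology_group ?p Y))" using isoj by (simp only: iso_iff)
  moreover have "hom_induced ?p ?S {} Y {} im c \<otimes>\<^bsub>homology_group ?p Y\<^esub> hom_induced ?p ?S {} Y {} ip c
      \<in> carrier (homology_group ?p Y)"
    by (intro monoid.m_closed group.is_monoid group_relative_homology_group hom_induced_carrier)
  ultimately show ?thesis
    using hom_induced_carrier[of ?p ?S "{}" Y "{}" i c] by (metis inj_onD)
qed

text \<open>\<open>Y\<close> leaves room for the two modified spheres: it will be the unit sphere
  together with the hyperplane of its equator, and \<open>P\<close> will be that hyperplane.
  Applying \<open>F\<close> to the preceding decomposition adds the exponents.\<close>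

lemma Brouwer_degree2_hemispheres:
  assumes "N > 0"
    and i: "continuous_map (nsphere N) Y i"
    and ip: "continuous_map (nsphere N) Y ip"
    and im: "continuous_map (nsphere N) Y im"
    and F: "continuous_map Y (nsphere N) F"
    and "\<And>x. x \<in> topspace (nsphere N) \<Longrightarrow> x k \<ge> 0 \<Longrightarrow> ip x = i x"
    and "\<And>x. x \<in> topspace (nsphere N) \<Longrightarrow> x k \<le> 0 \<Longrightarrow> ip x \<in> P"
    and "\<And>x. x \<in> topspace (nsphere N) \<Longrightarrow> x k \<le> 0 \<Longrightarrow> im x = i x"
    and "\<And>x. x \<in> topspace (nsphere N) \<Longrightarrow> x k \<ge> 0 \<Longrightarrow> im x \<in> P"
    and "contractible_space (subtopology Y P)" "topspace Y \<inter> P \<noteq> {}"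
  shows "Brouwer_degree2 N (F \<circ> i) = Brouwer_degree2 N (F \<circ> im) + Brouwer_degree2 N (F \<circ> ip)"
proof (rule Brouwer_degree2_unique)
  show "continuous_map (nsphere N) (nsphere N) (F \<circ> i)"
    using i F by (rule continuous_map_compose)
  let ?p = "int N" and ?S = "nsphere N"
  let ?G = "homology_group ?p ?S"
  fix x assume "x \<in> carrier (reduced_homology_group ?p ?S)"
  then have x: "x \<in> carrier ?G" using \<open>N > 0\<close> by (simp add: un_reduced_homology_group)
  interpret G: group ?G by simp
  interpret F: group_hom "homology_group ?p Y" ?G "hom_induced ?p Y {} ?S {} F"
    by (simp add: group_hom_def group_hom_axioms_def hom_induced_hom)
  have comp: "hom_induced ?p Y {} ?S {} F (hom_induced ?p ?S {} Y {} f x)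
      = x [^]\<^bsub>?G\<^esub> Brouwer_degree2 N (F \<circ> f)" if "continuous_map ?S Y f" for f
    using that F x \<open>N > 0\<close>
    by (subst hom_induced_compose') (auto simp: Brouwer_degree2_int_pow)
  have "hom_induced ?p ?S {} ?S {} (F \<circ> i) x
      = hom_induced ?p Y {} ?S {} F (hom_induced ?p ?S {} Y {} i x)"
    using i F by (subst hom_induced_compose') auto
  also have "\<dots> = x [^]\<^bsub>?G\<^esub> (Brouwer_degree2 N (F \<circ> im) + Brouwer_degree2 N (F \<circ> ip))"
    by (subst hom_induced_hemispheres[OF \<open>N > 0\<close> i ip im assms(6-11) x], assumption+, subst F.hom_mult)
      (use x in \<open>auto simp: hom_induced_carrier comp[OF im] comp[OF ip] G.int_pow_mult\<close>)
  finally show "hom_induced ?p ?S {} ?S {} (F \<circ> i) x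
     = x [^]\<^bsub>reduced_homology_group ?p ?S\<^esub> (Brouwer_degree2 N (F \<circ> im) + Brouwer_degree2 N (F \<circ> ip))"
    using \<open>N > 0\<close> by (simp add: un_reduced_homology_group)
qed

section \<open>Degrees of maps into punctured Euclidean space\<close>

lemma bij_coord_enum: "bij_betw (coord_enum :: nat \<Rightarrow> 'n::finite) {..<CARD('n)} UNIV"
proof -
  obtain e :: "nat \<Rightarrow> 'n" where "bij_betw e {0..<card (UNIV :: 'n set)} UNIV"
    using ex_bij_betw_nat_finite[of "UNIV :: 'n set"] by auto
  then have "bij_betw e {..<CARD('n)} UNIV" by (simp add: lessThan_atLeast0)
  then show ?thesis
    unfolding coord_enum_def by (rule someI[of "\<lambda>e. bij_betw e {..<CARD('n)} UNIV"])
qed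

lemma coord_enum_inv:
  "inv_into {..<CARD('n)} coord_enum (j::'n::finite) < CARD('n)"
  "coord_enum (inv_into {..<CARD('n)} coord_enum j) = j"
  using bij_coord_enum[where 'n='n]
    inv_into_into[of j coord_enum "{..<CARD('n)}"] f_inv_into_f[of j coord_enum "{..<CARD('n)}"]
  by (auto simp: bij_betw_def)

lemma seq_to_vec_vec_to_seq [simp]: "seq_to_vec (vec_to_seq u) = (u :: real^'n)"
  by (simp add: seq_to_vec_def vec_to_seq_def vec_eq_iff coord_enum_inv)

lemma vec_to_seq_seq_to_vec:
  assumes "\<And>i. i \<ge> CARD('n) \<Longrightarrow> y i = 0"
  shows "vec_to_seq (seq_to_vec y :: real^'n) = y"
proof
  fix i
  show "vec_to_seq (seq_to_vec y :: real^'n) i = y i"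
    using assms[of i] bij_betw_inv_into_left[OF bij_coord_enum[where 'n='n], of i]
    by (auto simp: seq_to_vec_def vec_to_seq_def not_less)
qed

lemma seq_to_vec_coord:
  "i < CARD('n) \<Longrightarrow> (seq_to_vec y :: real^'n) $ coord_enum i = y i"
  using bij_betw_inv_into_left[OF bij_coord_enum[where 'n='n], of i]
  by (simp add: seq_to_vec_def)

lemma sum_vec_to_seq: "(\<Sum>i<CARD('n). (vec_to_seq (u::real^'n) i)\<^sup>2) = (norm u)\<^sup>2"
proof -
  have "(norm u)\<^sup>2 = (\<Sum>j\<in>UNIV. (u $ j)\<^sup>2)"
    by (simp add: norm_vec_def L2_set_def sum_nonneg)
  also have "\<dots> = (\<Sum>i<CARD('n). (u $ coord_enum i)\<^sup>2)"
    by (rule sum.reindex_bij_betw[OF bij_coord_enum, symmetric])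
  finally show ?thesis by (simp add: vec_to_seq_def)
qed

lemma nsphere_top_of_set:
  "nsphere n = top_of_set {x. (\<Sum>i\<le>n. (x i)\<^sup>2) = 1 \<and> (\<forall>i>n. x i = 0)}"
  by (simp add: nsphere euclidean_product_topology)

lemma topspace_nsphere_card:
  "topspace (nsphere (CARD('n::finite) - 1)) =
     {x. (\<Sum>i<CARD('n). (x i)\<^sup>2) = 1 \<and> (\<forall>i\<ge>CARD('n). x i = 0)}"
proof -
  have "{..CARD('n) - 1} = {..<CARD('n)}" "\<And>i. i > CARD('n) - 1 \<longleftrightarrow> i \<ge> CARD('n)"
    using zero_less_card_finite[where 'a='n] by (auto simp del: zero_less_card_finite)
  then show ?thesis by (simp add: nsphere_top_of_set)
qed

lemma seq_to_vec_sphere: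
  assumes "y \<in> topspace (nsphere (CARD('n) - 1))"
  shows "(seq_to_vec y :: real^'n) \<in> sphere 0 1" "vec_to_seq (seq_to_vec y :: real^'n) = y"
proof -
  show *: "vec_to_seq (seq_to_vec y :: real^'n) = y"
    using assms unfolding topspace_nsphere_card by (intro vec_to_seq_seq_to_vec) auto
  have "(norm (seq_to_vec y :: real^'n))\<^sup>2 = 1"
    using assms unfolding sum_vec_to_seq[symmetric] * topspace_nsphere_card by auto
  then show "(seq_to_vec y :: real^'n) \<in> sphere 0 1"
    using norm_ge_zero[of "seq_to_vec y :: real^'n"] by (auto simp: power2_eq_1_iff)
qed

lemma vec_to_seq_nsphere:
  "(u :: real^'n) \<in> sphere 0 1 \<Longrightarrow> vec_to_seq u \<in> topspace (nsphere (CARD('n) - 1))"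
  unfolding topspace_nsphere_card by (simp add: sum_vec_to_seq) (simp add: vec_to_seq_def)

lemma continuous_map_vec_to_seq:
  "continuous_map (top_of_set (sphere 0 1)) (nsphere (CARD('n) - 1)) (vec_to_seq :: real^'n \<Rightarrow> _)"
proof -
  have "continuous_on (sphere 0 1) (\<lambda>u::real^'n. vec_to_seq u i)" for i
    unfolding vec_to_seq_def by (cases "i < CARD('n)") (auto intro!: continuous_intros)
  then have "continuous_on (sphere 0 1) (vec_to_seq :: real^'n \<Rightarrow> _)"
    by (rule continuous_on_coordinatewise_then_product)
  then show ?thesis
    using vec_to_seq_nsphere[where 'n='n] unfolding nsphere_top_of_set by auto
qed

lemma continuous_map_seq_to_vec:
  "continuous_map (nsphere (CARD('n) - 1)) (top_of_set (sphere 0 1)) (seq_to_vec :: _ \<Rightarrow> real^'n)"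
proof -
  have "continuous_on A (seq_to_vec :: _ \<Rightarrow> real^'n)" for A
    unfolding seq_to_vec_def
    by (intro continuous_on_vec_lambda continuous_on_product_coordinates[THEN continuous_on_subset]) auto
  then show ?thesis
    using seq_to_vec_sphere(1)[where 'n='n] unfolding nsphere_top_of_set by auto
qed

lemma continuous_map_sphere_conj:
  fixes h :: "real^'n \<Rightarrow> real^'n"
  assumes "continuous_on (sphere 0 1) h" "\<And>u. norm u = 1 \<Longrightarrow> norm (h u) = 1"
  shows "continuous_map (nsphere (CARD('n) - 1)) (nsphere (CARD('n) - 1)) (vec_to_seq \<circ> h \<circ> seq_to_vec)"
  by (intro continuous_map_compose[OF continuous_map_seq_to_vec] continuous_map_compose[OF _ continuous_map_vec_to_seq])
    (use assms in auto)

lemma sphere_degree_cong: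
  fixes h :: "real^'n \<Rightarrow> real^'n"
  assumes "\<And>u. norm u = 1 \<Longrightarrow> h u = h' u"
  shows "sphere_degree h = sphere_degree h'"
  unfolding sphere_degree_def
  by (rule Brouwer_degree2_eq) (use assms seq_to_vec_sphere(1)[where 'n='n] in auto)

lemma sphere_degree_id: "sphere_degree (\<lambda>u::real^'n. u) = 1"
proof -
  have "sphere_degree (\<lambda>u::real^'n. u) = Brouwer_degree2 (CARD('n) - 1) id"
    unfolding sphere_degree_def
    by (rule Brouwer_degree2_eq) (use seq_to_vec_sphere(2)[where 'n='n] in auto)
  then show ?thesis by simp
qed

lemma sphere_degree_const: "sphere_degree (\<lambda>u::real^'n. c) = 0"
  unfolding sphere_degree_def by (simp add: o_def Brouwer_degree2_const)

lemma sphere_degree_compose: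
  fixes g h :: "real^'n \<Rightarrow> real^'n"
  assumes "continuous_on (sphere 0 1) g" "\<And>u. norm u = 1 \<Longrightarrow> norm (g u) = 1"
    and "continuous_on (sphere 0 1) h" "\<And>u. norm u = 1 \<Longrightarrow> norm (h u) = 1"
  shows "sphere_degree (\<lambda>u. g (h u)) = sphere_degree g * sphere_degree h"
proof -
  have "sphere_degree (\<lambda>u. g (h u)) = Brouwer_degree2 (CARD('n) - 1)
      ((vec_to_seq \<circ> g \<circ> seq_to_vec) \<circ> (vec_to_seq \<circ> h \<circ> seq_to_vec))"
    unfolding sphere_degree_def by (rule Brouwer_degree2_eq) simp
  also have "\<dots> = sphere_degree g * sphere_degree h"
    unfolding sphere_degree_def
    by (intro Brouwer_degree2_compose continuous_map_sphere_conj assms)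
  finally show ?thesis .
qed

abbreviation sgn_degree :: "(real^'n \<Rightarrow> real^'n) \<Rightarrow> int" where
  "sgn_degree g \<equiv> sphere_degree (\<lambda>u. sgn (g u))"

lemma sphere_degree_homotopy:
  fixes H :: "real \<Rightarrow> real^'n \<Rightarrow> real^'n"
  assumes H: "continuous_on ({0..1} \<times> sphere 0 1) (\<lambda>(t,u). H t u)"
    and nz: "\<And>t u. 0 \<le> t \<Longrightarrow> t \<le> 1 \<Longrightarrow> norm u = 1 \<Longrightarrow> H t u \<noteq> 0"
  shows "sgn_degree (\<lambda>u. H 0 u) = sgn_degree (\<lambda>u. H 1 u)"
proof -
  have "homotopic_with (\<lambda>x. True) (top_of_set (sphere 0 1)) (top_of_set (sphere 0 1))
     (\<lambda>u. sgn (H 0 u)) (\<lambda>u. sgn (H 1 u))"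
    unfolding homotopic_with_def
  proof (intro exI[of _ "\<lambda>(t,u). sgn (H t u)"] conjI)
    have "continuous_on ({0..1} \<times> sphere 0 1) (\<lambda>x. sgn ((\<lambda>(t,u). H t u) x))"
      unfolding sgn_div_norm using H nz by (intro continuous_intros) auto
    then show "continuous_map (prod_topology (top_of_set {0..1}) (top_of_set (sphere 0 1)))
       (top_of_set (sphere 0 1)) (\<lambda>(t, u). sgn (H t u))"
      using nz by (auto simp: case_prod_unfold norm_sgn)
  qed auto
  then have "homotopic_with (\<lambda>x. True) (nsphere (CARD('n) - 1)) (nsphere (CARD('n) - 1))
     (vec_to_seq \<circ> (\<lambda>u. sgn (H 0 u)) \<circ> seq_to_vec) (vec_to_seq \<circ> (\<lambda>u. sgn (H 1 u)) \<circ> seq_to_vec)"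
    by (intro homotopic_with_compose_continuous_map_right[OF _ continuous_map_seq_to_vec]
        homotopic_with_compose_continuous_map_left[OF _ continuous_map_vec_to_seq]) auto
  then show ?thesis
    unfolding sphere_degree_def by (rule Brouwer_degree2_homotopic)
qed

text \<open>Degrees multiply under composition, and the only units among the integers are 1 and
  -1.\<close>

lemma abs_sphere_degree_inverse:
  fixes g h :: "real^'n \<Rightarrow> real^'n"
  assumes "continuous_on (sphere 0 1) g" "\<And>u. norm u = 1 \<Longrightarrow> norm (g u) = 1"
    and "continuous_on (sphere 0 1) h" "\<And>u. norm u = 1 \<Longrightarrow> norm (h u) = 1"
    and "\<And>u. norm u = 1 \<Longrightarrow> g (h u) = u"
  shows "\<bar>sphere_degree g\<bar> = 1" "\<bar>sphere_degree h\<bar> = 1"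
proof -
  have "sphere_degree g * sphere_degree h = sphere_degree (\<lambda>u::real^'n. u)"
    using sphere_degree_compose[OF assms(1-4)] sphere_degree_cong[OF assms(5)] by simp
  then have "sphere_degree g * sphere_degree h = 1"
    by (simp add: sphere_degree_id)
  then show "\<bar>sphere_degree g\<bar> = 1" "\<bar>sphere_degree h\<bar> = 1"
    by (auto simp: zmult_eq_1_iff)
qed

lemma abs_sphere_degree_linear:
  fixes A :: "real^'n \<Rightarrow> real^'n"
  assumes "linear A" "inj A"
  shows "\<bar>sgn_degree A\<bar> = 1"
proof -
  obtain B where B: "linear B" "\<And>x. B (A x) = x" "\<And>x. A (B x) = x"
    using linear_injective_isomorphism[OF assms] by auto
  have A0: "A u \<noteq> 0" "B u \<noteq> 0" if "norm u = 1" for u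
    using that B(2)[of u] B(3)[of u] linear_0[OF assms(1)] linear_0[OF B(1)] by force+
  have cont: "continuous_on (sphere 0 1) (\<lambda>u. sgn (L u))"
    if "linear L" "\<And>u. norm u = 1 \<Longrightarrow> L u \<noteq> 0" for L :: "real^'n \<Rightarrow> real^'n"
    unfolding sgn_div_norm using that
    by (intro continuous_intros linear_continuous_on linear_conv_bounded_linear[THEN iffD1]) auto
  have inv: "sgn (A (sgn (B u))) = u" if "norm u = 1" for u
    using that A0(2)[OF that]
    by (simp add: sgn_div_norm linear_cmul[OF assms(1)] B(3))
  show ?thesis
    by (rule abs_sphere_degree_inverse(1)[of _ "\<lambda>u. sgn (B u)"])
      (use cont[OF assms(1)] cont[OF B(1)] A0 inv in \<open>auto simp: norm_sgn\<close>)
qed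

text \<open>For a unit vector \<open>a\<close> this is the nearest-point retraction onto the
  half-space \<open>a \<bullet> z \<ge> c\<close>. If \<open>F\<close> has no zero on the bounding
  hyperplane, composing with it keeps exactly the zeros of \<open>F\<close> in that half-space, so
  that cutting space produces maps that are still defined everywhere.\<close>

definition clamp_above :: "'a::real_inner \<Rightarrow> real \<Rightarrow> 'a \<Rightarrow> 'a" where
  "clamp_above a c z = z + max 0 (c - a \<bullet> z) *\<^sub>R a"

definition clamp_below :: "'a::real_inner \<Rightarrow> real \<Rightarrow> 'a \<Rightarrow> 'a" where
  "clamp_below a c z = z - max 0 (a \<bullet> z - c) *\<^sub>R a"

lemma continuous_on_clamp [continuous_intros]:
  "continuous_on A (clamp_above a c)" "continuous_on A (clamp_below a c)"
  unfolding clamp_above_def clamp_below_def by (intro continuous_intros)+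

text \<open>Each clamp fixes one closed hemisphere and flattens the other into the hyperplane
  \<open>P\<close>, which is convex and hence contractible. The axis of \<open>coord_enum 0\<close>
  is chosen because \<open>a \<bullet> z\<close> is then coordinate 0 in the sequence model.\<close>

lemma sphere_degree_hemispheres_axis:
  fixes F :: "real^'n \<Rightarrow> real^'n"
  assumes card: "CARD('n) > 1"
    and F: "continuous_on UNIV F"
    and a: "a = axis (coord_enum 0) 1"
    and nz: "\<And>z. norm z = 1 \<or> a \<bullet> z = 0 \<Longrightarrow> F z \<noteq> 0"
  shows "sgn_degree F =
    sgn_degree (\<lambda>u. F (clamp_below a 0 u)) + sgn_degree (\<lambda>u. F (clamp_above a 0 u))"
proof -
  define P where "P = {z::real^'n. a \<bullet> z = 0}"
  let ?Y = "top_of_set (sphere 0 1 \<union> P)"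
  have na: "norm a = 1" by (simp add: a norm_axis_1)
  then have aa: "a \<bullet> a = 1" by (simp add: dot_square_norm)
  have coord: "a \<bullet> seq_to_vec x = x 0" for x
    by (simp add: a inner_axis' seq_to_vec_coord)
  have up: "clamp_above a 0 z \<in> P" if "a \<bullet> z \<le> 0" for z
    using that by (simp add: clamp_above_def P_def inner_add_right inner_diff_right aa)
  have dn: "clamp_below a 0 z \<in> P" if "a \<bullet> z \<ge> 0" for z
    using that by (simp add: clamp_below_def P_def inner_diff_right aa)
  have up': "clamp_above a 0 z = z" if "a \<bullet> z \<ge> 0" for z
    using that by (simp add: clamp_above_def)
  have dn': "clamp_below a 0 z = z" if "a \<bullet> z \<le> 0" for z
    using that by (simp add: clamp_below_def)
  have sY: "f u \<in> sphere 0 1 \<union> P" if "norm u = 1" "f = clamp_above a 0 \<or> f = clamp_below a 0" for f u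
    using that up[of u] dn[of u] up'[of u] dn'[of u] by (cases "a \<bullet> u \<le> 0") auto
  have cont: "continuous_map (nsphere (CARD('n) - 1)) ?Y (f \<circ> seq_to_vec)"
    if f: "f = clamp_above a 0 \<or> f = clamp_below a 0 \<or> f = id" for f
  proof (intro continuous_map_compose[OF continuous_map_seq_to_vec])
    have "continuous_on (sphere 0 1) f" using f by (auto intro: continuous_intros)
    moreover have "f u \<in> sphere 0 1 \<union> P" if "norm u = 1" for u
      using f sY[OF that, of f] that by auto
    ultimately show "continuous_map (top_of_set (sphere 0 1)) ?Y f" by auto
  qed
  have contF: "continuous_map ?Y (nsphere (CARD('n) - 1)) (vec_to_seq \<circ> (\<lambda>z. sgn (F z)))"
  proof (intro continuous_map_compose[OF _ continuous_map_vec_to_seq])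
    have "continuous_on (sphere 0 1 \<union> P) (\<lambda>z. sgn (F z))"
      unfolding sgn_div_norm using nz
      by (intro continuous_intros continuous_on_subset[OF F]) (auto simp: P_def)
    then show "continuous_map ?Y (top_of_set (sphere 0 1)) (\<lambda>z. sgn (F z))"
      using nz by (auto simp: P_def norm_sgn)
  qed
  have "contractible P"
    unfolding P_def by (intro convex_imp_contractible convex_hyperplane)
  then have P: "contractible_space (subtopology ?Y P)"
    by (simp add: subtopology_subtopology Int_absorb1 contractible_space_top_of_set)
  have "0 \<in> P" by (simp add: P_def)
  then have ne: "topspace ?Y \<inter> P \<noteq> {}" by auto
  have "Brouwer_degree2 (CARD('n) - 1) ((vec_to_seq \<circ> (\<lambda>z. sgn (F z))) \<circ> (id \<circ> seq_to_vec))
    = Brouwer_degree2 (CARD('n) - 1) ((vec_to_seq \<circ> (\<lambda>z. sgn (F z))) \<circ> (clamp_below a 0 \<circ> seq_to_vec))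
    + Brouwer_degree2 (CARD('n) - 1) ((vec_to_seq \<circ> (\<lambda>z. sgn (F z))) \<circ> (clamp_above a 0 \<circ> seq_to_vec))"
    by (rule Brouwer_degree2_hemispheres[OF _ cont cont cont contF, where k=0, OF _ _ _ _ _ _ _ _ P ne])
      (use card up up' dn dn' in \<open>auto simp: coord\<close>)
  then show ?thesis
    by (simp add: sphere_degree_def o_def)
qed

text \<open>An orthogonal map \<open>Q\<close> carries the axis to \<open>a\<close> and intertwines
  the clamps; its degree, 1 or -1, is a common factor of all three terms and cancels.\<close>

lemma sphere_degree_hemispheres:
  fixes F :: "real^'n \<Rightarrow> real^'n"
  assumes card: "CARD('n) > 1"
    and F: "continuous_on UNIV F"
    and a: "norm a = 1"
    and nz: "\<And>z. norm z = 1 \<or> a \<bullet> z = 0 \<Longrightarrow> F z \<noteq> 0"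
  shows "sgn_degree F =
    sgn_degree (\<lambda>u. F (clamp_below a 0 u)) + sgn_degree (\<lambda>u. F (clamp_above a 0 u))"
proof -
  define e :: "real^'n" where "e = axis (coord_enum 0) 1"
  have "norm e = 1" by (simp add: e_def norm_axis_1)
  then obtain Q where Q: "orthogonal_transformation Q" "Q e = a"
    using orthogonal_transformation_exists[of e a] a by metis
  have lin: "linear Q" and nQ: "\<And>x. norm (Q x) = norm x"
    using Q by (auto simp: orthogonal_transformation)
  have iQ: "a \<bullet> Q x = e \<bullet> x" for x
    using Q unfolding orthogonal_transformation_def by metis
  have cQ: "continuous_on A Q" for A
    using lin by (simp add: linear_continuous_on linear_conv_bounded_linear)
  have "inj Q" using Q(1) by (rule orthogonal_transformation_inj)
  then have "\<bar>sgn_degree Q\<bar> = 1"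
    using lin by (intro abs_sphere_degree_linear)
  moreover have "sgn_degree Q = sphere_degree Q"
    by (rule sphere_degree_cong) (simp add: sgn_div_norm nQ)
  ultimately have dQ: "sphere_degree Q \<noteq> 0" by auto
  have below: "clamp_below a 0 (Q z) = Q (clamp_below e 0 z)" for z
    unfolding clamp_below_def iQ by (simp add: linear_diff[OF lin] linear_cmul[OF lin] Q(2))
  have above: "clamp_above a 0 (Q z) = Q (clamp_above e 0 z)" for z
    unfolding clamp_above_def iQ by (simp add: linear_add[OF lin] linear_cmul[OF lin] Q(2))
  have comp: "sgn_degree (\<lambda>u. F (f (Q u))) = sgn_degree (\<lambda>u. F (f u)) * sphere_degree Q"
    if "continuous_on UNIV f" "\<And>u. norm u = 1 \<Longrightarrow> F (f u) \<noteq> 0" for f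
  proof (rule sphere_degree_compose)
    show "continuous_on (sphere 0 1) (\<lambda>u. sgn (F (f u)))"
      unfolding sgn_div_norm using that
      by (intro continuous_intros continuous_on_compose2[OF F] continuous_on_subset[OF that(1)]) auto
  qed (use that cQ nQ in \<open>auto simp: norm_sgn\<close>)
  have nzc: "F (clamp_below a 0 u) \<noteq> 0" "F (clamp_above a 0 u) \<noteq> 0" if "norm u = 1" for u
    using that nz[of u] nz[of "clamp_below a 0 u"] nz[of "clamp_above a 0 u"] a
    by (cases "a \<bullet> u \<ge> 0"; force simp: clamp_below_def clamp_above_def inner_diff_right inner_add_right dot_square_norm)+
  have "sgn_degree (\<lambda>u. F (Q u)) =
    sgn_degree (\<lambda>u. F (Q (clamp_below e 0 u))) + sgn_degree (\<lambda>u. F (Q (clamp_above e 0 u)))"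
    by (rule sphere_degree_hemispheres_axis[OF card _ e_def, of "\<lambda>z. F (Q z)"])
      (use nz nQ iQ in \<open>auto intro!: continuous_on_compose2[OF F] cQ\<close>)
  then have "sgn_degree F * sphere_degree Q =
    (sgn_degree (\<lambda>u. F (clamp_below a 0 u)) + sgn_degree (\<lambda>u. F (clamp_above a 0 u))) * sphere_degree Q"
    using comp[of id] comp[of "clamp_below a 0"] comp[of "clamp_above a 0"] nz nzc
    by (simp add: below above algebra_simps continuous_on_clamp)
  then show ?thesis using dQ by simp
qed

section \<open>The degree at infinity and the local degree\<close>

lemma sphere_degree_sgn_minus:
  fixes g :: "real^'n \<Rightarrow> real^'n"
  assumes "continuous_on (sphere 0 1) g" "\<And>u. norm u = 1 \<Longrightarrow> g u \<noteq> 0"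
  shows "even (sgn_degree (\<lambda>u. - g u)) \<longleftrightarrow> even (sgn_degree g)"
proof -
  have m: "\<bar>sphere_degree (\<lambda>u::real^'n. - u)\<bar> = 1"
    by (rule abs_sphere_degree_inverse(1)[where h="\<lambda>u. - u"]) (auto intro: continuous_intros)
  have "sphere_degree (\<lambda>u. - sgn (g u)) = sphere_degree (\<lambda>u::real^'n. - u) * sgn_degree g"
    using assms
    by (intro sphere_degree_compose) (auto intro!: continuous_intros simp: norm_sgn sgn_div_norm)
  moreover have "odd (sphere_degree (\<lambda>u::real^'n. - u))"
    using m by (metis dvd_abs_iff odd_one)
  ultimately show ?thesis by (simp add: sgn_minus)
qed

lemma linear_inj_norm_bounds:
  fixes A :: "real^'n \<Rightarrow> real^'n"
  assumes "linear A" "inj A"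
  obtains m M where "0 < m" "m \<le> M" "\<And>x. m * norm x \<le> norm (A x)" "\<And>x. norm (A x) \<le> M * norm x"
proof -
  obtain m where m: "m > 0" "\<And>x. m * norm x \<le> norm (A x)"
    using linear_inj_bounded_below_pos[OF assms] by blast
  obtain K where K: "\<And>x. norm (A x) \<le> K * norm x"
    using linear_bounded[OF assms(1)] by auto
  have "norm (A x) \<le> max m K * norm x" for x
    by (rule order_trans[OF K]) (intro mult_right_mono; simp)
  then show ?thesis using that[of m "max m K"] m by simp
qed

text \<open>Sliding \<open>A u\<close> along its ray to radius \<open>k\<close> stays in the annulus
  and leaves \<open>g\<close> on a round sphere composed with \<open>sgn (A u)\<close>, a self-map
  of degree 1 or -1. The sign is not tracked, hence the statement about parities.\<close>

lemma sphere_degree_annulus_linear: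
  fixes g A :: "real^'n \<Rightarrow> real^'n"
  assumes g: "continuous_on {z. m \<le> norm z \<and> norm z \<le> M} g"
    and nz: "\<And>z. m \<le> norm z \<Longrightarrow> norm z \<le> M \<Longrightarrow> g z \<noteq> 0"
    and A: "linear A" "inj A" and m: "m > 0"
    and bd: "\<And>u. norm u = 1 \<Longrightarrow> m \<le> norm (A u)" "\<And>u. norm u = 1 \<Longrightarrow> norm (A u) \<le> M"
    and k: "m \<le> k" "k \<le> M"
  shows "even (sgn_degree (\<lambda>u. g (A u))) \<longleftrightarrow> even (sgn_degree (\<lambda>u. g (k *\<^sub>R u)))"
proof -
  have A0: "A u \<noteq> 0" if "norm u = 1" for u using bd(1)[OF that] m by auto
  have cA: "continuous_on S A" for S
    using A(1) by (simp add: linear_continuous_on linear_conv_bounded_linear)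
  define s where "s t u = (1 - t) * norm (A u) + t * k" for t u
  have s: "m \<le> s t u \<and> s t u \<le> M" if "0 \<le> t" "t \<le> 1" "norm u = 1" for t u
    using bd[OF that(3)] k that convex_bound_le[of "norm (A u)" M k "1 - t" t]
      convex_bound_le[of "- norm (A u)" "- m" "- k" "1 - t" t]
    unfolding s_def by (auto simp: algebra_simps)
  have ns: "norm (s t u *\<^sub>R sgn (A u)) = s t u" if "0 \<le> t" "t \<le> 1" "norm u = 1" for t u
    using s[OF that] m A0[OF that(3)] by (simp add: norm_sgn)
  have "sgn_degree (\<lambda>u. g (s 0 u *\<^sub>R sgn (A u))) = sgn_degree (\<lambda>u. g (s 1 u *\<^sub>R sgn (A u)))"
  proof (rule sphere_degree_homotopy[of "\<lambda>t u. g (s t u *\<^sub>R sgn (A u))"])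
    have "continuous_on ({0..1} \<times> sphere 0 1) (\<lambda>x. g (s (fst x) (snd x) *\<^sub>R sgn (A (snd x))))"
      unfolding s_def sgn_div_norm
    proof (rule continuous_on_compose2[OF g])
      show "continuous_on ({0..1} \<times> sphere 0 1) (\<lambda>x. ((1 - fst x) * norm (A (snd x)) + fst x * k) *\<^sub>R (A (snd x) /\<^sub>R norm (A (snd x))))"
        using A0 by (intro continuous_intros continuous_on_compose2[OF cA]) auto
    qed (use ns s in \<open>auto simp: s_def sgn_div_norm\<close>)
    then show "continuous_on ({0..1} \<times> sphere 0 1) (\<lambda>(t, u). g (s t u *\<^sub>R sgn (A u)))"
      by (simp add: case_prod_unfold)
  qed (use ns s nz in auto)
  moreover have "sgn_degree (\<lambda>u. g (s 0 u *\<^sub>R sgn (A u))) = sgn_degree (\<lambda>u. g (A u))"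
    by (rule sphere_degree_cong) (use A0 in \<open>auto simp: s_def sgn_div_norm\<close>)
  moreover have "sgn_degree (\<lambda>u. g (s 1 u *\<^sub>R sgn (A u)))
     = sgn_degree (\<lambda>u. g (k *\<^sub>R u)) * sgn_degree A"
    unfolding s_def
  proof (simp, rule sphere_degree_compose[of "\<lambda>u. sgn (g (k *\<^sub>R u))"])
    have "continuous_on (sphere 0 1) (\<lambda>u. g (k *\<^sub>R u))"
      by (rule continuous_on_compose2[OF g]) (use m k in \<open>auto intro: continuous_intros\<close>)
    then show "continuous_on (sphere 0 1) (\<lambda>u. sgn (g (k *\<^sub>R u)))"
      unfolding sgn_div_norm using nz m k by (intro continuous_intros) auto
    show "continuous_on (sphere 0 1) (\<lambda>u. sgn (A u))"
      unfolding sgn_div_norm using A0 by (intro continuous_intros cA) auto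
  qed (use nz m k A0 in \<open>auto simp: norm_sgn\<close>)
  moreover have "odd (sgn_degree A)"
    using abs_sphere_degree_linear[OF A] by (metis dvd_abs_iff odd_one)
  ultimately show ?thesis by simp
qed

lemma sphere_degree_radius:
  fixes g :: "real^'n \<Rightarrow> real^'n"
  assumes g: "continuous_on {z. m \<le> dist p z \<and> dist p z \<le> M} g"
    and nz: "\<And>z. m \<le> dist p z \<Longrightarrow> dist p z \<le> M \<Longrightarrow> g z \<noteq> 0"
    and ab: "0 < m" "m \<le> a" "a \<le> M" "m \<le> b" "b \<le> M"
  shows "sgn_degree (\<lambda>u. g (p + a *\<^sub>R u)) = sgn_degree (\<lambda>u. g (p + b *\<^sub>R u))"
proof -
  define s where "s t = (1 - t) * a + t * b" for t
  have s: "m \<le> s t \<and> s t \<le> M" if "0 \<le> t" "t \<le> 1" for t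
    using ab that convex_bound_le[of a M b "1 - t" t] convex_bound_le[of "- a" "- m" "- b" "1 - t" t]
    unfolding s_def by (auto simp: algebra_simps)
  then have d: "dist p (p + s t *\<^sub>R u) = s t" if "0 \<le> t" "t \<le> 1" "norm u = 1" for t u
    using that ab(1) by (force simp: dist_norm abs_of_pos)
  have "sgn_degree (\<lambda>u. g (p + s 0 *\<^sub>R u)) = sgn_degree (\<lambda>u. g (p + s 1 *\<^sub>R u))"
  proof (rule sphere_degree_homotopy[of "\<lambda>t u. g (p + s t *\<^sub>R u)"])
    show "continuous_on ({0..1} \<times> sphere 0 1) (\<lambda>(t, u). g (p + s t *\<^sub>R u))"
      unfolding case_prod_unfold
    proof (rule continuous_on_compose2[OF g])
      show "continuous_on ({0..1} \<times> sphere 0 1) (\<lambda>x. p + s (fst x) *\<^sub>R snd x)"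
        unfolding s_def by (intro continuous_intros)
    qed (use s d in auto)
  qed (use s d nz in auto)
  then show ?thesis by (simp add: s_def)
qed

definition nonzero_outside :: "real \<Rightarrow> ('a::real_normed_vector \<Rightarrow> 'b::zero) \<Rightarrow> bool" where
  "nonzero_outside R F \<longleftrightarrow> R > 0 \<and> (\<forall>z. norm z \<ge> R \<longrightarrow> F z \<noteq> 0)"

lemma nonzero_outside_mono: "nonzero_outside R F \<Longrightarrow> R \<le> R' \<Longrightarrow> nonzero_outside R' F"
  by (auto simp: nonzero_outside_def)

text \<open>The choice of the radius is harmless: by \<open>degree_inf_eq\<close> every admissible
  \<open>R\<close> gives the same value for continuous \<open>F\<close>.\<close>

definition degree_inf :: "(real^'n \<Rightarrow> real^'n) \<Rightarrow> int" where
  "degree_inf F = sgn_degree (\<lambda>u. F ((SOME R. nonzero_outside R F) *\<^sub>R u))"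

lemma degree_inf_eq:
  fixes F :: "real^'n \<Rightarrow> real^'n"
  assumes F: "continuous_on UNIV F" and R: "nonzero_outside R F"
  shows "degree_inf F = sgn_degree (\<lambda>u. F (R *\<^sub>R u))"
proof -
  define S where "S = (SOME R. nonzero_outside R F)"
  have S: "nonzero_outside S F" unfolding S_def using R by (rule someI)
  have "sgn_degree (\<lambda>u. F (0 + S *\<^sub>R u)) = sgn_degree (\<lambda>u. F (0 + R *\<^sub>R u))"
    by (rule sphere_degree_radius[of "min R S" 0 "max R S"])
      (use F R S in \<open>auto simp: nonzero_outside_def min_le_iff_disj intro: continuous_on_subset\<close>)
  then show ?thesis by (simp add: degree_inf_def S_def)
qed

text \<open>One \<open>R\<close> has to serve for all \<open>t\<close>, since a zero escaping to
  infinity during the deformation could change the degree. Producing such an \<open>R\<close> is the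
  real content of the later applications.\<close>

lemma degree_inf_homotopy:
  fixes H :: "real \<Rightarrow> real^'n \<Rightarrow> real^'n"
  assumes H: "continuous_on ({0..1} \<times> UNIV) (\<lambda>(t,z). H t z)"
    and R: "\<And>t. 0 \<le> t \<Longrightarrow> t \<le> 1 \<Longrightarrow> nonzero_outside R (H t)"
  shows "degree_inf (H 0) = degree_inf (H 1)"
proof -
  have R0: "R > 0" using R[of 0] by (simp add: nonzero_outside_def)
  have c: "continuous_on UNIV (H t)" if "0 \<le> t" "t \<le> 1" for t
  proof -
    have "continuous_on UNIV (\<lambda>z. (\<lambda>(t,z). H t z) (t, z))"
      by (rule continuous_on_compose2[OF H]) (use that in \<open>auto intro!: continuous_intros\<close>)
    then show ?thesis by simp
  qed
  have "sgn_degree (\<lambda>u. H 0 (R *\<^sub>R u)) = sgn_degree (\<lambda>u. H 1 (R *\<^sub>R u))"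
  proof (rule sphere_degree_homotopy[of "\<lambda>t u. H t (R *\<^sub>R u)"])
    have "continuous_on ({0..1} \<times> sphere 0 1) (\<lambda>x. (\<lambda>(t,z). H t z) (fst x, R *\<^sub>R snd x))"
      by (intro continuous_on_compose2[OF H] continuous_intros) auto
    then show "continuous_on ({0..1} \<times> sphere 0 1) (\<lambda>(t, u). H t (R *\<^sub>R u))"
      by (simp add: case_prod_unfold)
  qed (use R R0 in \<open>auto simp: nonzero_outside_def\<close>)
  then show ?thesis using degree_inf_eq[OF c R, of 0] degree_inf_eq[OF c R, of 1] by simp
qed

text \<open>The sphere can be shrunk to its centre, where the map is constant.\<close>

lemma degree_inf_zero_free:
  fixes F :: "real^'n \<Rightarrow> real^'n"
  assumes F: "continuous_on UNIV F" and nz: "\<And>z. F z \<noteq> 0"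
  shows "degree_inf F = 0"
proof -
  have "sgn_degree (\<lambda>u. F (0 *\<^sub>R u)) = sgn_degree (\<lambda>u. F (1 *\<^sub>R u))"
    by (rule sphere_degree_homotopy[of "\<lambda>t u. F (t *\<^sub>R u)"])
      (use nz in \<open>auto simp: case_prod_unfold intro!: continuous_on_compose2[OF F] continuous_intros\<close>)
  moreover have "degree_inf F = sgn_degree (\<lambda>u. F (1 *\<^sub>R u))"
    by (rule degree_inf_eq[OF F]) (use nz in \<open>simp add: nonzero_outside_def\<close>)
  ultimately show ?thesis by (simp add: sphere_degree_const)
qed

lemma nonzero_outside_translate:
  fixes F :: "'a::real_normed_vector \<Rightarrow> 'b::zero"
  assumes "nonzero_outside R F"
  shows "nonzero_outside (R + norm p) (\<lambda>z. F (z + p))"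
proof -
  have "R \<le> norm (z + p)" if "R + norm p \<le> norm z" for z
    using norm_triangle_ineq4[of "z + p" p] that by simp
  then show ?thesis using assms by (auto simp: nonzero_outside_def add_pos_nonneg)
qed

lemma degree_inf_translate:
  fixes F :: "real^'n \<Rightarrow> real^'n"
  assumes F: "continuous_on UNIV F" and R: "nonzero_outside R F"
  shows "degree_inf (\<lambda>z. F (z + p)) = degree_inf F"
proof -
  have "degree_inf (\<lambda>z. F (z + 0 *\<^sub>R p)) = degree_inf (\<lambda>z. F (z + 1 *\<^sub>R p))"
  proof (rule degree_inf_homotopy[of "\<lambda>t z. F (z + t *\<^sub>R p)" "R + norm p"])
    show "continuous_on ({0..1} \<times> UNIV) (\<lambda>(t, z). F (z + t *\<^sub>R p))"
      unfolding case_prod_unfold by (intro continuous_on_compose2[OF F] continuous_intros) auto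
    fix t :: real assume t: "0 \<le> t" "t \<le> 1"
    then have "norm (t *\<^sub>R p) \<le> norm p" by (simp add: mult_left_le_one_le)
    then show "nonzero_outside (R + norm p) (\<lambda>z. F (z + t *\<^sub>R p))"
      using nonzero_outside_translate[OF R, of "t *\<^sub>R p"] nonzero_outside_mono by fastforce
  qed
  then show ?thesis by simp
qed

lemma clamp_cases:
  assumes "norm a = 1"
  shows "clamp_above a c z = z \<and> a \<bullet> z \<ge> c \<or> a \<bullet> clamp_above a c z = c \<and> a \<bullet> z < c"
    and "clamp_below a c z = z \<and> a \<bullet> z \<le> c \<or> a \<bullet> clamp_below a c z = c \<and> a \<bullet> z > c"
  using assms
  by (auto simp: clamp_above_def clamp_below_def inner_add_right inner_diff_right dot_square_norm max_def)

lemma nonzero_outside_clamp: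
  assumes "norm a = 1" "nonzero_outside R F" "\<And>z. a \<bullet> z = c \<Longrightarrow> F z \<noteq> 0"
  shows "nonzero_outside R (\<lambda>z. F (clamp_above a c z))" "nonzero_outside R (\<lambda>z. F (clamp_below a c z))"
  using assms clamp_cases[OF assms(1)] unfolding nonzero_outside_def by metis+

text \<open>A translation moves the cutting hyperplane through the origin; at level 0 the clamps
  commute with positive scaling, so the large sphere can be traded for the unit sphere.\<close>

lemma degree_inf_cut:
  fixes F :: "real^'n \<Rightarrow> real^'n"
  assumes card: "CARD('n) > 1" and F: "continuous_on UNIV F" and R: "nonzero_outside R F"
    and a: "norm a = 1" and nz: "\<And>z. a \<bullet> z = c \<Longrightarrow> F z \<noteq> 0"
  shows "degree_inf F = degree_inf (\<lambda>z. F (clamp_below a c z)) + degree_inf (\<lambda>z. F (clamp_above a c z))"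
proof -
  define p where "p = c *\<^sub>R a"
  define G where "G z = F (z + p)" for z
  define S where "S = R + norm p"
  have S: "nonzero_outside S G" and S0: "S > 0"
    using nonzero_outside_translate[OF R, of p] by (auto simp: S_def G_def nonzero_outside_def)
  have cG: "continuous_on UNIV G"
    unfolding G_def by (intro continuous_on_compose2[OF F] continuous_intros) auto
  have ap: "a \<bullet> p = c" by (simp add: p_def dot_square_norm a)
  have nG: "G z \<noteq> 0" if "a \<bullet> z = 0" for z
    unfolding G_def using nz[of "z + p"] that ap by (simp add: inner_add_right)
  have cc: "continuous_on UNIV (\<lambda>z. F (clamp_above a c z))" "continuous_on UNIV (\<lambda>z. F (clamp_below a c z))"
    by (intro continuous_on_compose2[OF F] continuous_intros; simp)+
  have cc': "continuous_on UNIV (\<lambda>z. G (clamp_above a 0 z))" "continuous_on UNIV (\<lambda>z. G (clamp_below a 0 z))"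
    by (intro continuous_on_compose2[OF cG] continuous_intros; simp)+
  have tr: "F (clamp_above a c (z + p)) = G (clamp_above a 0 z)" "F (clamp_below a c (z + p)) = G (clamp_below a 0 z)" for z
    by (simp_all add: G_def clamp_above_def clamp_below_def inner_add_right ap algebra_simps)
  have sc: "clamp_above a 0 (S *\<^sub>R u) = S *\<^sub>R clamp_above a 0 u" "clamp_below a 0 (S *\<^sub>R u) = S *\<^sub>R clamp_below a 0 u" for u
    using S0 by (auto simp: clamp_above_def clamp_below_def max_def algebra_simps zero_le_mult_iff mult_le_0_iff)
  have oG: "nonzero_outside S (\<lambda>z. G (clamp_above a 0 z))" "nonzero_outside S (\<lambda>z. G (clamp_below a 0 z))"
    by (rule nonzero_outside_clamp[OF a S]; fact nG)+
  have oF: "nonzero_outside R (\<lambda>z. F (clamp_above a c z))" "nonzero_outside R (\<lambda>z. F (clamp_below a c z))"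
    by (rule nonzero_outside_clamp[OF a R]; fact nz)+
  have "sgn_degree (\<lambda>u. G (S *\<^sub>R u)) =
    sgn_degree (\<lambda>u. G (S *\<^sub>R clamp_below a 0 u)) + sgn_degree (\<lambda>u. G (S *\<^sub>R clamp_above a 0 u))"
  proof (rule sphere_degree_hemispheres[OF card _ a])
    show "continuous_on UNIV (\<lambda>u. G (S *\<^sub>R u))"
      by (intro continuous_on_compose2[OF cG] continuous_intros) auto
  qed (use S S0 nG in \<open>auto simp: nonzero_outside_def\<close>)
  then have "degree_inf G = degree_inf (\<lambda>z. G (clamp_below a 0 z)) + degree_inf (\<lambda>z. G (clamp_above a 0 z))"
    by (simp add: degree_inf_eq[OF cG S] degree_inf_eq[OF cc'(1) oG(1)] degree_inf_eq[OF cc'(2) oG(2)] sc)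
  then show ?thesis
    using degree_inf_translate[OF F R, of p]
      degree_inf_translate[OF cc(1) oF(1), of p]
      degree_inf_translate[OF cc(2) oF(2), of p]
    by (simp add: tr flip: G_def)
qed

section \<open>Local degrees as contributions to the degree at infinity\<close>

lemma local_degree_eq:
  fixes g :: "real^'n \<Rightarrow> real^'n"
  assumes "\<epsilon> > 0" and g: "continuous_on (cball p \<epsilon>) g"
    and nz: "\<And>z. z \<in> cball p \<epsilon> \<Longrightarrow> z \<noteq> p \<Longrightarrow> g z \<noteq> 0"
    and \<delta>: "0 < \<delta>" "\<delta> \<le> \<epsilon>"
  shows "local_degree g p = sgn_degree (\<lambda>u. g (p + \<delta> *\<^sub>R u))"
proof -
  have const: "sgn_degree (\<lambda>u. g (p + \<delta> *\<^sub>R u)) = sgn_degree (\<lambda>u. g (p + \<delta>' *\<^sub>R u))"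
    if \<delta>': "0 < \<delta>'" "\<delta>' \<le> \<epsilon>" for \<delta>'
  proof (rule sphere_degree_radius[of "min \<delta> \<delta>'" p \<epsilon>])
    fix z assume z: "min \<delta> \<delta>' \<le> dist p z" "dist p z \<le> \<epsilon>"
    then have "z \<noteq> p" using \<delta> \<delta>' by auto
    then show "g z \<noteq> 0" using nz z by simp
  qed (use g \<delta> \<delta>' in \<open>auto intro: continuous_on_subset\<close>)
  have ev: "\<forall>\<^sub>F \<epsilon> in at_right 0. sgn_degree (\<lambda>u. g (p + \<epsilon> *\<^sub>R u)) = sgn_degree (\<lambda>u. g (p + \<delta> *\<^sub>R u))"
    unfolding eventually_at_right_field using const[symmetric] \<open>\<epsilon> > 0\<close> by (intro exI[of _ \<epsilon>]) auto
  show ?thesis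
    unfolding local_degree_def
  proof (rule the_equality)
    fix d assume "\<forall>\<^sub>F \<epsilon> in at_right 0. sgn_degree (\<lambda>u. g (p + \<epsilon> *\<^sub>R u)) = d"
    with ev have "\<forall>\<^sub>F \<epsilon> in at_right (0::real). d = sgn_degree (\<lambda>u. g (p + \<delta> *\<^sub>R u))"
      by eventually_elim simp
    then show "d = sgn_degree (\<lambda>u. g (p + \<delta> *\<^sub>R u))" by simp
  qed (rule ev)
qed

text \<open>Only directions matter, so the two maps may differ by a positive factor; this is how
  \<open>tilde a\<close> in a parametrization is later compared with its affine form.\<close>

lemma local_degree_cong:
  fixes g h :: "real^'n \<Rightarrow> real^'n"
  assumes "\<epsilon> > 0" "\<And>z. z \<in> ball p \<epsilon> \<Longrightarrow> sgn (g z) = sgn (h z)"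
  shows "local_degree g p = local_degree h p"
proof -
  have "\<forall>\<^sub>F \<delta> in at_right 0. sgn_degree (\<lambda>u. g (p + \<delta> *\<^sub>R u)) = sgn_degree (\<lambda>u. h (p + \<delta> *\<^sub>R u))"
    unfolding eventually_at_right_field
  proof (intro exI[of _ \<epsilon>] conjI allI impI)
    fix \<delta> :: real assume "0 < \<delta>" "\<delta> < \<epsilon>"
    then show "sgn_degree (\<lambda>u. g (p + \<delta> *\<^sub>R u)) = sgn_degree (\<lambda>u. h (p + \<delta> *\<^sub>R u))"
      using assms(2) by (intro sphere_degree_cong) (auto simp: dist_norm)
  qed (use assms in auto)
  then have "(\<forall>\<^sub>F \<delta> in at_right 0. sgn_degree (\<lambda>u. g (p + \<delta> *\<^sub>R u)) = d) \<longleftrightarrow>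
    (\<forall>\<^sub>F \<delta> in at_right 0. sgn_degree (\<lambda>u. h (p + \<delta> *\<^sub>R u)) = d)" for d
    by (intro eventually_subst) (elim eventually_mono, simp)
  then show ?thesis unfolding local_degree_def by simp
qed

lemma local_degree_translate: "local_degree g p = local_degree (\<lambda>x. g (p + x)) 0"
  by (simp add: local_degree_def)

lemma degree_inf_single_zero:
  fixes F :: "real^'n \<Rightarrow> real^'n"
  assumes F: "continuous_on UNIV F" and nz: "\<And>z. z \<noteq> p \<Longrightarrow> F z \<noteq> 0"
  shows "degree_inf F = local_degree F p"
proof -
  have "z \<noteq> p" if "norm p + 1 \<le> norm z" for z using that by auto
  then have "nonzero_outside (norm p + 1) F"
    using nz by (auto simp: nonzero_outside_def add_nonneg_pos)
  then have "degree_inf F = degree_inf (\<lambda>z. F (z + p))"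
    using degree_inf_translate[OF F] by metis
  also have "\<dots> = sgn_degree (\<lambda>u. F (1 *\<^sub>R u + p))"
  proof (rule degree_inf_eq)
    show "continuous_on UNIV (\<lambda>z. F (z + p))"
      by (intro continuous_on_compose2[OF F] continuous_intros) auto
    have "F (z + p) \<noteq> 0" if "norm z \<ge> 1" for z
    proof -
      have "z + p \<noteq> p" using that by auto
      then show ?thesis by (rule nz)
    qed
    then show "nonzero_outside 1 (\<lambda>z. F (z + p))"
      by (auto simp: nonzero_outside_def)
  qed
  also have "\<dots> = local_degree F p"
    using local_degree_eq[of 1 p F 1] nz continuous_on_subset[OF F] by (simp add: add.commute)
  finally show ?thesis .
qed

text \<open>Two zeros differ in some coordinate, and a hyperplane strictly between them that avoids
  the finitely many zeros cuts \<open>F\<close> into two maps with fewer zeros each. Clamping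
  changes nothing near a surviving zero, so its local degree persists.\<close>

lemma degree_inf_sum:
  fixes F :: "real^'n \<Rightarrow> real^'n"
  assumes card: "CARD('n) > 1"
  shows "continuous_on UNIV F \<Longrightarrow> finite {z. F z = 0} \<Longrightarrow> degree_inf F = (\<Sum>z | F z = 0. local_degree F z)"
proof (induction "card {z. F z = 0}" arbitrary: F rule: less_induct)
  case less
  note F = less.prems(1) and fin = less.prems(2)
  define Z where "Z = {z. F z = 0}"
  consider "Z = {}" | p where "Z = {p}" | p q where "p \<in> Z" "q \<in> Z" "p \<noteq> q" by blast
  then show ?case
  proof cases
    case 1
    then show ?thesis using degree_inf_zero_free[OF F] by (simp add: Z_def)
  next
    case 2
    then have "degree_inf F = local_degree F p"
      by (intro degree_inf_single_zero[OF F]) (auto simp: Z_def)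
    then show ?thesis using 2 by (simp add: Z_def)
  next
    case 3
    obtain j where "p $ j \<noteq> q $ j" using 3 by (auto simp: vec_eq_iff)
    then have "\<exists>p q. p \<in> Z \<and> q \<in> Z \<and> p $ j < q $ j"
      using 3 by (cases "p $ j < q $ j") (auto simp: not_less order_le_less)
    then obtain p q where pq: "p \<in> Z" "q \<in> Z" "p $ j < q $ j" by blast
    have "infinite ({p $ j <..< q $ j} - (\<lambda>z. z $ j) ` Z)"
      using fin pq(3) by (intro Diff_infinite_finite) (auto simp: Z_def)
    then obtain c where "c \<in> {p $ j <..< q $ j} - (\<lambda>z. z $ j) ` Z"
      using infinite_imp_nonempty by blast
    then have c: "p $ j < c" "c < q $ j" "c \<notin> (\<lambda>z. z $ j) ` Z" by auto
    define a where "a = (axis j 1 :: real^'n)"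
    have a: "norm a = 1" "\<And>z. a \<bullet> z = z $ j" by (auto simp: a_def norm_axis_1 inner_axis')
    obtain R where R: "nonzero_outside R F"
    proof -
      obtain B where "\<forall>z\<in>Z. norm z \<le> B" using finite_imp_bounded[OF fin] by (auto simp: bounded_iff Z_def)
      then have "nonzero_outside (\<bar>B\<bar> + 1) F" by (force simp: nonzero_outside_def Z_def)
      then show ?thesis using that by blast
    qed
    have nz: "F z \<noteq> 0" if "a \<bullet> z = c" for z using c(3) that by (auto simp: a Z_def)
    let ?B = "\<lambda>z. F (clamp_below a c z)" and ?A = "\<lambda>z. F (clamp_above a c z)"
    have cont: "continuous_on UNIV ?B" "continuous_on UNIV ?A"
      by (intro continuous_on_compose2[OF F] continuous_intros; simp)+
    have zB: "{z. ?B z = 0} = {z \<in> Z. z $ j < c}"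
      using clamp_cases(2)[OF a(1), of c] nz unfolding Z_def a(2)
      by (smt (verit, best) Collect_cong a(2) mem_Collect_eq order_le_less)
    have zA: "{z. ?A z = 0} = {z \<in> Z. z $ j > c}"
      using clamp_cases(1)[OF a(1), of c] nz unfolding Z_def a(2)
      by (smt (verit, best) Collect_cong a(2) mem_Collect_eq order_le_less)
    have finZ: "finite Z" using fin by (simp add: Z_def)
    have "q \<notin> {z \<in> Z. z $ j < c}" "p \<notin> {z \<in> Z. z $ j > c}" using c by auto
    then have "{z \<in> Z. z $ j < c} \<subset> Z" "{z \<in> Z. z $ j > c} \<subset> Z" using pq by blast+
    then have "card {z. ?B z = 0} < card Z" "card {z. ?A z = 0} < card Z"
      unfolding zB zA using finZ by (simp_all add: psubset_card_mono)
    then have IH: "degree_inf ?B = (\<Sum>z | ?B z = 0. local_degree ?B z)"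
      "degree_inf ?A = (\<Sum>z | ?A z = 0. local_degree ?A z)"
      using less.hyps[of ?B] less.hyps[of ?A] cont finZ unfolding zA zB by (auto simp: Z_def)
    have lB: "local_degree ?B z = local_degree F z" if "z $ j < c" for z
    proof (rule local_degree_cong[of "c - z $ j"])
      fix w assume "w \<in> ball z (c - z $ j)"
      then have "w $ j < c" using component_le_norm_cart[of "w - z" j]
        by (auto simp: dist_norm norm_minus_commute)
      then show "sgn (?B w) = sgn (F w)" using clamp_cases(2)[OF a(1), of c w] by (auto simp: a)
    qed (use that in auto)
    have lA: "local_degree ?A z = local_degree F z" if "z $ j > c" for z
    proof (rule local_degree_cong[of "z $ j - c"])
      fix w assume "w \<in> ball z (z $ j - c)"
      then have "w $ j > c" using component_le_norm_cart[of "w - z" j]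
        by (auto simp: dist_norm norm_minus_commute)
      then show "sgn (?A w) = sgn (F w)" using clamp_cases(1)[OF a(1), of c w] by (auto simp: a)
    qed (use that in auto)
    have "degree_inf F = degree_inf ?B + degree_inf ?A"
      by (rule degree_inf_cut[OF card F R a(1) nz])
    also have "\<dots> = (\<Sum>z\<in>{z \<in> Z. z $ j < c}. local_degree F z) + (\<Sum>z\<in>{z \<in> Z. z $ j > c}. local_degree F z)"
      unfolding IH unfolding zA zB by (intro arg_cong2[of _ _ _ _ "(+)"] sum.cong) (auto simp: lA lB)
    also have "\<dots> = (\<Sum>z\<in>{z \<in> Z. z $ j < c} \<union> {z \<in> Z. z $ j > c}. local_degree F z)"
    proof (rule sum.union_disjoint[symmetric])
      show "finite {z \<in> Z. z $ j < c}" "finite {z \<in> Z. z $ j > c}" using finZ by simp_all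
      show "{z \<in> Z. z $ j < c} \<inter> {z \<in> Z. z $ j > c} = {}" by (rule equals0I) (elim IntE CollectE conjE, linarith)
    qed
    also have "{z \<in> Z. z $ j < c} \<union> {z \<in> Z. z $ j > c} = Z"
    proof -
      have "z $ j < c \<or> z $ j > c" if "z \<in> Z" for z
        using c(3) that by (metis image_eqI linorder_neqE_linordered_idom)
      then show ?thesis by blast
    qed
    finally show ?thesis by (simp add: Z_def)
  qed
qed

section \<open>Behaviour of the degrees under changes of coordinates\<close>

lemma nonzero_outside_linear:
  fixes A :: "real^'n \<Rightarrow> real^'n"
  assumes A: "linear A" "inj A" and R: "nonzero_outside R F"
  obtains m M where "0 < m" "m \<le> M" "\<And>z. norm z \<ge> R / m \<Longrightarrow> norm (A z) \<ge> R" "\<And>x. norm (A x) \<le> M * norm x"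
    "nonzero_outside (R / m) (\<lambda>z. F (A z))"
proof -
  obtain m M where m: "0 < m" "m \<le> M" "\<And>x. m * norm x \<le> norm (A x)" "\<And>x. norm (A x) \<le> M * norm x"
    using linear_inj_norm_bounds[OF A] by metis
  have far: "norm (A z) \<ge> R" if "norm z \<ge> R / m" for z
  proof -
    have "R \<le> m * norm z" using that m(1) by (simp add: field_simps)
    then show ?thesis using m(3)[of z] by linarith
  qed
  then have "nonzero_outside (R / m) (\<lambda>z. F (A z))"
    using R m(1) by (auto simp: nonzero_outside_def)
  then show ?thesis using that m far by blast
qed

lemma degree_inf_linear:
  fixes F A :: "real^'n \<Rightarrow> real^'n"
  assumes F: "continuous_on UNIV F" and R: "nonzero_outside R F" and A: "linear A" "inj A"
  shows "even (degree_inf (\<lambda>z. F (A z))) \<longleftrightarrow> even (degree_inf F)"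
proof -
  obtain m M where m: "0 < m" "m \<le> M" "\<And>z. norm z \<ge> R / m \<Longrightarrow> norm (A z) \<ge> R" "\<And>x. norm (A x) \<le> M * norm x"
    and o: "nonzero_outside (R / m) (\<lambda>z. F (A z))"
    using nonzero_outside_linear[OF A R] by metis
  have R0: "R > 0" using R by (simp add: nonzero_outside_def)
  have cA: "continuous_on S A" for S
    using A(1) by (simp add: linear_continuous_on linear_conv_bounded_linear)
  define S where "S = R / m"
  have S: "S > 0" "m * S = R" using m(1) R0 by (auto simp: S_def)
  note far = m(3)[folded S_def]
  have "degree_inf (\<lambda>z. F (A z)) = sgn_degree (\<lambda>u. F (A (S *\<^sub>R u)))"
    by (rule degree_inf_eq[OF _ o[folded S_def]]) (intro continuous_on_compose2[OF F] cA; simp)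
  moreover have "even (sgn_degree (\<lambda>u. F (A (S *\<^sub>R u)))) \<longleftrightarrow> even (sgn_degree (\<lambda>u. F (R *\<^sub>R u)))"
  proof (rule sphere_degree_annulus_linear[of R "M * S" F "\<lambda>u. A (S *\<^sub>R u)"])
    show "continuous_on {z. R \<le> norm z \<and> norm z \<le> M * S} F" using F by (rule continuous_on_subset) auto
    show "linear (\<lambda>u. A (S *\<^sub>R u))"
      using A(1) by (auto intro!: linearI simp: linear_add linear_cmul algebra_simps)
    show "inj (\<lambda>u. A (S *\<^sub>R u))" using S(1) by (auto intro!: injI dest!: injD[OF A(2)])
    show "R \<le> M * S" using m(2) S R0 by (metis mult_right_mono order_less_imp_le)
  qed (use R R0 S far m(4) in \<open>auto simp: nonzero_outside_def abs_of_pos intro: order_trans[OF m(4)]\<close>)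
  ultimately show ?thesis using degree_inf_eq[OF F R] by simp
qed

lemma degree_inf_minus:
  fixes F :: "real^'n \<Rightarrow> real^'n"
  assumes F: "continuous_on UNIV F" and R: "nonzero_outside R F"
  shows "even (degree_inf (\<lambda>z. - F z)) \<longleftrightarrow> even (degree_inf F)"
proof -
  have "nonzero_outside R (\<lambda>z. - F z)" using R by (simp add: nonzero_outside_def)
  then have "degree_inf (\<lambda>z. - F z) = sgn_degree (\<lambda>u. - F (R *\<^sub>R u))"
    using F by (intro degree_inf_eq continuous_intros)
  then show ?thesis
    unfolding degree_inf_eq[OF F R]
    using sphere_degree_sgn_minus[of "\<lambda>u. F (R *\<^sub>R u)"] R
    by (simp add: nonzero_outside_def continuous_on_compose2[OF F] continuous_intros)
qed

text \<open>Near 0 the straight homotopy from \<open>q\<close> to its derivative \<open>A\<close>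
  vanishes only at 0, because the remainder is at most half the lower bound
  \<open>m * norm x\<close> of \<open>A\<close>. For \<open>A\<close> itself the annulus lemma
  applies.\<close>

lemma local_degree_compose:
  fixes g q :: "real^'n \<Rightarrow> real^'n"
  assumes "\<epsilon> > 0" and g: "continuous_on (cball 0 \<epsilon>) g" and nz: "\<And>z. z \<in> cball 0 \<epsilon> \<Longrightarrow> z \<noteq> 0 \<Longrightarrow> g z \<noteq> 0"
    and "\<delta> > 0" and q: "continuous_on (ball 0 \<delta>) q" "q 0 = 0"
    and der: "(q has_derivative A) (at 0)" and "inj A"
  shows "even (local_degree (\<lambda>z. g (q z)) 0) \<longleftrightarrow> even (local_degree g 0)"
    and "\<exists>\<eta>>0. \<forall>z\<in>cball 0 \<eta>. z \<noteq> 0 \<longrightarrow> q z \<noteq> 0"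
proof -
  have A: "linear A" "inj A" using der assms by (auto dest: has_derivative_linear)
  obtain m M where m: "0 < m" "m \<le> M" "\<And>x. m * norm x \<le> norm (A x)" "\<And>x. norm (A x) \<le> M * norm x"
    using linear_inj_norm_bounds[OF A] by metis
  have cA: "continuous_on S A" for S
    using A(1) by (simp add: linear_continuous_on linear_conv_bounded_linear)
  obtain \<delta>1 where \<delta>1: "\<delta>1 > 0" "\<And>x. norm x < \<delta>1 \<Longrightarrow> norm (q x - A x) \<le> (m/2) * norm x"
    using der[unfolded has_derivative_at_alt] m(1) q(2) by (metis diff_zero half_gt_zero)
  \<comment> \<open>All intermediate maps have norm at most \<open>(M + m) * norm x\<close>, so this
    \<open>\<eta>\<close> keeps the homotopy inside \<open>cball 0 \<epsilon>\<close>, where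
    \<open>g\<close> can vanish only at 0.\<close>
  define \<eta> where "\<eta> = min (min (\<delta> / 2) (\<delta>1 / 2)) (\<epsilon> / (M + m))"
  have \<eta>: "0 < \<eta>" "\<eta> < \<delta>" "\<eta> < \<delta>1" "(M + m) * \<eta> \<le> \<epsilon>"
  proof -
    have Mm: "M + m > 0" using m by simp
    show "0 < \<eta>" using Mm assms(1) assms(4) \<delta>1(1) by (simp add: \<eta>_def)
    have "\<eta> \<le> \<delta> / 2" "\<eta> \<le> \<delta>1 / 2" "\<eta> \<le> \<epsilon> / (M + m)"
      unfolding \<eta>_def by linarith+
    then show "\<eta> < \<delta>" "\<eta> < \<delta>1" "(M + m) * \<eta> \<le> \<epsilon>"
      using assms(4) \<delta>1(1) Mm by (auto simp: field_simps)
  qed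
  have est: "m / 2 * norm x \<le> norm (A x + (1 - t) *\<^sub>R (q x - A x))"
    "norm (A x + (1 - t) *\<^sub>R (q x - A x)) \<le> (M + m) * norm x"
    if "norm x \<le> \<eta>" "0 \<le> t" "t \<le> 1" for x t
  proof -
    have e: "norm ((1 - t) *\<^sub>R (q x - A x)) \<le> m / 2 * norm x"
      using \<delta>1(2)[of x] that \<eta> mult_left_le_one_le[of "norm (q x - A x)" "1 - t"] by simp
    have "norm (A x) \<le> norm (A x + (1 - t) *\<^sub>R (q x - A x)) + norm ((1 - t) *\<^sub>R (q x - A x))"
      using norm_triangle_ineq4[of "A x + (1 - t) *\<^sub>R (q x - A x)" "(1 - t) *\<^sub>R (q x - A x)"] by simp
    then show "m / 2 * norm x \<le> norm (A x + (1 - t) *\<^sub>R (q x - A x))"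
      using e m(3)[of x] by (simp add: field_simps)
    have "0 \<le> m / 2 * norm x" using m by simp
    then show "norm (A x + (1 - t) *\<^sub>R (q x - A x)) \<le> (M + m) * norm x"
      using e m(4)[of x] norm_triangle_ineq[of "A x" "(1 - t) *\<^sub>R (q x - A x)"] by (simp add: algebra_simps)
  qed
  have inb: "A x + (1 - t) *\<^sub>R (q x - A x) \<in> cball 0 \<epsilon>" if "norm x \<le> \<eta>" "0 \<le> t" "t \<le> 1" for x t
  proof -
    have "(M + m) * norm x \<le> (M + m) * \<eta>" using that(1) m by (intro mult_left_mono) auto
    then show ?thesis using est(2)[OF that] \<eta>(4) by simp
  qed
  have n0: "A x + (1 - t) *\<^sub>R (q x - A x) \<noteq> 0" if "norm x \<le> \<eta>" "0 \<le> t" "t \<le> 1" "x \<noteq> 0" for x t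
    using est(1)[OF that(1-3)] m(1) that(4) by (auto simp: mult_le_0_iff)
  have gx: "q x \<in> cball 0 \<epsilon>" "x \<noteq> 0 \<Longrightarrow> q x \<noteq> 0" if "norm x \<le> \<eta>" for x
    using inb[of x 0] n0[of x 0] that by auto
  have "\<forall>z\<in>cball 0 \<eta>. z \<noteq> 0 \<longrightarrow> q z \<noteq> 0" using gx(2) by simp
  with \<eta>(1) show "\<exists>\<eta>>0. \<forall>z\<in>cball 0 \<eta>. z \<noteq> 0 \<longrightarrow> q z \<noteq> 0" by blast
  have cq: "continuous_on (cball 0 \<eta>) q" using q(1) by (rule continuous_on_subset) (use \<eta> in auto)
  have "local_degree (\<lambda>z. g (q z)) 0 = sgn_degree (\<lambda>u. g (q (0 + \<eta> *\<^sub>R u)))"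
  proof (rule local_degree_eq[OF \<eta>(1)])
    show "continuous_on (cball 0 \<eta>) (\<lambda>z. g (q z))"
      by (rule continuous_on_compose2[OF g cq]) (use gx in auto)
  qed (use gx nz \<eta> in auto)
  also have "\<dots> = sgn_degree (\<lambda>u. g (A (\<eta> *\<^sub>R u) + (1 - 0) *\<^sub>R (q (\<eta> *\<^sub>R u) - A (\<eta> *\<^sub>R u))))"
    by simp
  also have "\<dots> = sgn_degree (\<lambda>u. g (A (\<eta> *\<^sub>R u) + (1 - 1) *\<^sub>R (q (\<eta> *\<^sub>R u) - A (\<eta> *\<^sub>R u))))"
  proof (rule sphere_degree_homotopy[of "\<lambda>t u. g (A (\<eta> *\<^sub>R u) + (1 - t) *\<^sub>R (q (\<eta> *\<^sub>R u) - A (\<eta> *\<^sub>R u)))"])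
    show "continuous_on ({0..1} \<times> sphere 0 1) (\<lambda>(t, u). g (A (\<eta> *\<^sub>R u) + (1 - t) *\<^sub>R (q (\<eta> *\<^sub>R u) - A (\<eta> *\<^sub>R u))))"
      unfolding case_prod_unfold
    proof (rule continuous_on_compose2[OF g])
      show "continuous_on ({0..1} \<times> sphere 0 1) (\<lambda>x. A (\<eta> *\<^sub>R snd x) + (1 - fst x) *\<^sub>R (q (\<eta> *\<^sub>R snd x) - A (\<eta> *\<^sub>R snd x)))"
        using \<eta> by (intro continuous_intros continuous_on_compose2[OF cA] continuous_on_compose2[OF cq]) auto
    qed (use inb \<eta> in auto)
    fix t :: real and u :: "real^'n" assume t: "0 \<le> t" "t \<le> 1" "norm u = 1"
    show "g (A (\<eta> *\<^sub>R u) + (1 - t) *\<^sub>R (q (\<eta> *\<^sub>R u) - A (\<eta> *\<^sub>R u))) \<noteq> 0"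
      by (rule nz[OF inb n0]) (use t \<eta> in auto)
  qed
  finally have 1: "local_degree (\<lambda>z. g (q z)) 0 = sgn_degree (\<lambda>u. g (A (\<eta> *\<^sub>R u)))" by simp
  have an: "m * \<eta> \<le> norm (A (\<eta> *\<^sub>R u))" "norm (A (\<eta> *\<^sub>R u)) \<le> M * \<eta>" if "norm u = 1" for u
    using m(3)[of "\<eta> *\<^sub>R u"] m(4)[of "\<eta> *\<^sub>R u"] \<eta>(1) that by auto
  have M\<epsilon>: "M * \<eta> \<le> \<epsilon>" using \<eta>(1,4) m by (smt (verit) mult_right_mono)
  have m\<eta>: "0 < m * \<eta>" "m * \<eta> \<le> M * \<eta>" using m \<eta> by auto
  have "even (sgn_degree (\<lambda>u. g (A (\<eta> *\<^sub>R u)))) \<longleftrightarrow> even (sgn_degree (\<lambda>u. g ((m * \<eta>) *\<^sub>R u)))"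
  proof (rule sphere_degree_annulus_linear[of "m * \<eta>" "M * \<eta>"])
    show "continuous_on {z. m * \<eta> \<le> norm z \<and> norm z \<le> M * \<eta>} g"
      using g by (rule continuous_on_subset) (use M\<epsilon> in auto)
    show "linear (\<lambda>u. A (\<eta> *\<^sub>R u))"
      using A(1) by (auto intro!: linearI simp: linear_add linear_cmul algebra_simps)
    show "inj (\<lambda>u. A (\<eta> *\<^sub>R u))" using \<eta>(1) by (auto intro!: injI dest!: injD[OF A(2)])
    fix z :: "real^'n" assume "m * \<eta> \<le> norm z" "norm z \<le> M * \<eta>"
    then have "z \<noteq> 0" "z \<in> cball 0 \<epsilon>" using M\<epsilon> m\<eta>(1) by auto
    then show "g z \<noteq> 0" by (intro nz)
  qed (use m\<eta> an in auto)
  also have "sgn_degree (\<lambda>u. g ((m * \<eta>) *\<^sub>R u)) = local_degree g 0"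
    using local_degree_eq[OF \<open>\<epsilon> > 0\<close> g nz m\<eta>(1)] m\<eta> M\<epsilon> by simp
  finally show "even (local_degree (\<lambda>z. g (q z)) 0) \<longleftrightarrow> even (local_degree g 0)"
    unfolding 1 .
qed

text \<open>The recentred map serves as the inner map of \<open>local_degree_compose\<close>, and
  the identity, of local degree 1, as the outer one.\<close>

lemma local_degree_nondegenerate:
  fixes g :: "real^'n \<Rightarrow> real^'n"
  assumes "\<delta> > 0" "continuous_on (ball p \<delta>) g" "g p = 0" "(g has_derivative A) (at p)" "inj A"
  shows "odd (local_degree g p)" "\<exists>\<eta>>0. \<forall>z\<in>cball p \<eta>. z \<noteq> p \<longrightarrow> g z \<noteq> 0"
proof -
  let ?c = "\<lambda>x. g (p + x)"
  have id1: "local_degree (\<lambda>x::real^'n. x) 0 = 1"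
    using local_degree_eq[of 1 0 "\<lambda>x::real^'n. x" 1] sphere_degree_cong[of "\<lambda>u::real^'n. sgn u" "\<lambda>u. u"]
    by (simp add: sphere_degree_id sgn_div_norm continuous_on_id)
  have c: "continuous_on (ball 0 \<delta>) ?c"
    by (rule continuous_on_compose2[OF assms(2)]) (auto intro!: continuous_intros simp: dist_norm)
  have d: "(?c has_derivative A) (at 0)"
  proof -
    have "((\<lambda>x. p + x) has_derivative (\<lambda>x. x)) (at 0)"
      by (rule derivative_eq_intros | simp)+
    from has_derivative_compose[OF this, of g A] show ?thesis using assms(4) by simp
  qed
  note * = local_degree_compose[OF zero_less_one continuous_on_id _ assms(1) c _ d assms(5)]
  show "odd (local_degree g p)"
    unfolding local_degree_translate[of g p] using *(1) assms(3) id1 by simp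
  obtain \<eta> where \<eta>: "\<eta> > 0" "\<forall>z\<in>cball 0 \<eta>. z \<noteq> 0 \<longrightarrow> ?c z \<noteq> 0" using *(2) assms(3) by auto
  have "g z \<noteq> 0" if "z \<in> cball p \<eta>" "z \<noteq> p" for z
    using \<eta>(2)[rule_format, of "z - p"] that by (simp add: dist_norm norm_minus_commute)
  then show "\<exists>\<eta>>0. \<forall>z\<in>cball p \<eta>. z \<noteq> p \<longrightarrow> g z \<noteq> 0" using \<eta>(1) by blast
qed

lemma local_degree_minus:
  fixes g :: "real^'n \<Rightarrow> real^'n"
  assumes "\<epsilon> > 0" and g: "continuous_on (cball p \<epsilon>) g" and nz: "\<And>z. z \<in> cball p \<epsilon> \<Longrightarrow> z \<noteq> p \<Longrightarrow> g z \<noteq> 0"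
  shows "even (local_degree (\<lambda>z. - g z) p) \<longleftrightarrow> even (local_degree g p)"
proof -
  have "local_degree g p = sgn_degree (\<lambda>u. g (p + \<epsilon> *\<^sub>R u))"
    using assms by (intro local_degree_eq) auto
  moreover have "local_degree (\<lambda>z. - g z) p = sgn_degree (\<lambda>u. - g (p + \<epsilon> *\<^sub>R u))"
    using assms by (intro local_degree_eq) (auto intro: continuous_intros)
  moreover have "continuous_on (sphere 0 1) (\<lambda>u. g (p + \<epsilon> *\<^sub>R u))"
    by (rule continuous_on_compose2[OF g]) (use assms in \<open>auto intro!: continuous_intros simp: dist_norm\<close>)
  ultimately show ?thesis
    using sphere_degree_sgn_minus[of "\<lambda>u. g (p + \<epsilon> *\<^sub>R u)"] nz \<open>\<epsilon> > 0\<close> by (force simp: dist_norm)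
qed

section \<open>Generic perturbations of matrix-valued maps\<close>

lemma bounded_bilinear_matrix_vector:
  "bounded_bilinear ((*v) :: real^'k^'n \<Rightarrow> real^'k \<Rightarrow> real^'n)"
proof -
  have "linear (\<lambda>A::real^'k^'n. A *v x)" for x
    by (rule linearI) (simp_all add: matrix_vector_mult_add_rdistrib scaleR_matrix_vector_assoc)
  then show ?thesis
    unfolding bilinear_conv_bounded_bilinear[symmetric] bilinear_def by simp
qed

lemmas continuous_on_matrix_vector [continuous_intros] =
  bounded_bilinear.continuous_on[OF bounded_bilinear_matrix_vector]

lemma bounded_bilinear_differentiable:
  assumes "bounded_bilinear p" "f differentiable (at x within S)" "g differentiable (at x within S)"
  shows "(\<lambda>x. p (f x) (g x)) differentiable (at x within S)"
  using assms unfolding differentiable_def by (blast intro: bounded_bilinear.FDERIV)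

lemma linear_surj_from_subspace:
  fixes H :: "'a::euclidean_space set" and L :: "'b::euclidean_space set"
  assumes "subspace H" "subspace L" "dim L \<le> dim H"
  obtains E where "linear E" "L \<subseteq> E ` H"
proof -
  obtain H' where H': "subspace H'" "H' \<subseteq> span H" "dim H' = dim L"
    using choose_subspace_of_subspace[OF assms(3)] by metis
  obtain f g where f: "linear f" "f ` H' = L"
    using isometries_subspaces[OF H'(1) assms(2) H'(3)] by metis
  have "H' \<subseteq> H" using H'(2) assms(1) by (metis span_eq_iff)
  then have "L \<subseteq> f ` H" using f(2) by blast
  with f(1) show ?thesis by (rule that)
qed

text \<open>A matrix annihilating \<open>y\<close> with \<open>y\<^sub>i = 1\<close> is determined by its other columns, so column \<open>i\<close> is
  free to encode \<open>(s, x, y)\<close>; as this takes fewer than \<open>n\<close> parameters, the bad matrices form a null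
  set.\<close>

lemma generic_perturbation_negligible:
  fixes c :: "real \<times> (real^'p) \<Rightarrow> real^'k^'n" and g :: "real \<times> (real^'p) \<Rightarrow> real" and W :: "(real^'k) set"
  assumes W: "subspace W" and dimW: "dim W + CARD('p) + 1 \<le> CARD('n)"
    and c: "\<And>q. q \<in> Dm \<Longrightarrow> c differentiable (at q)"
    and g: "\<And>q. q \<in> Dm \<Longrightarrow> g differentiable (at q)" "\<And>q. q \<in> Dm \<Longrightarrow> g q \<noteq> 0"
  shows "negligible {M. \<exists>q\<in>Dm. \<exists>y\<in>W. y $ i = 1 \<and> (c q + g q *\<^sub>R M) *v y = 0}"
proof (cases "\<exists>y0\<in>W. y0 $ i = 1")
  case False
  then have eq: "{M. \<exists>q\<in>Dm. \<exists>y\<in>W. y $ i = 1 \<and> (c q + g q *\<^sub>R M) *v y = 0} = {}" by auto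
  show ?thesis unfolding eq by simp
next
  case True
  then obtain y0 where y0: "y0 \<in> W" "y0 $ i = 1" by blast
  \<comment> \<open>The vectors of \<open>W\<close> with \<open>i\<close>-th coordinate 1 form the
    affine space \<open>y0 + W0\<close>, of smaller dimension than \<open>W\<close>.\<close>
  define W0 where "W0 = W \<inter> {y. axis i 1 \<bullet> y = 0}"
  have W0: "subspace W0" unfolding W0_def by (intro subspace_inter W subspace_hyperplane)
  have "y0 \<notin> W0" using y0 by (simp add: W0_def inner_axis')
  then have "W0 \<subset> W" using y0 by (auto simp: W0_def)
  then have "dim W0 < dim W"
    using W W0 by (intro dim_psubset) (metis span_eq_iff)
  define j0 :: 'n where "j0 = (SOME j. True)"
  \<comment> \<open>Restricting column \<open>i\<close> to a hyperplane makes the set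
    \<open>D\<close> of codes negligible; the \<open>n - 1\<close> dimensions left still suffice to
    encode all parameters \<open>(s, x, y - y0)\<close> through the linear map
    \<open>E\<close>.\<close>
  define H where "H = {u::real^'n. axis j0 1 \<bullet> u = 0}"
  have H: "subspace H" unfolding H_def by (rule subspace_hyperplane)
  have dimH: "dim H = CARD('n) - 1"
    unfolding H_def by (subst dim_hyperplane) (auto simp: axis_eq_0_iff)
  define L where "L = (UNIV :: real set) \<times> (UNIV :: (real^'p) set) \<times> W0"
  have L: "subspace L" unfolding L_def by (intro subspace_Times subspace_UNIV W0)
  have "dim L = 1 + (CARD('p) + dim W0)"
    unfolding L_def using W0 by (simp add: dim_Times subspace_Times)
  then have dL: "dim L \<le> dim H" unfolding dimH using dimW \<open>dim W0 < dim W\<close> by linarith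
  obtain E where E: "linear E" "L \<subseteq> E ` H"
    by (rule linear_surj_from_subspace[OF H L dL])
  define s where "s N = (fst (E (column i N)), fst (snd (E (column i N))))" for N :: "real^'k^'n"
  define y where "y N = y0 + snd (snd (E (column i N)))" for N :: "real^'k^'n"
  define out where "out w = (\<chi> a b. if b = i then w $ a else 0)" for w :: "real^'n"
  \<comment> \<open>Decoding: \<open>N\<close> agrees with the bad matrix \<open>M\<close> off
    column \<open>i\<close>. As \<open>y $ i = 1\<close>, the values at \<open>y\<close> differ
    exactly by the difference of the two columns, so adding \<open>M *v y - N *v y\<close> to column
    \<open>i\<close> recovers \<open>M\<close>; the value \<open>M *v y\<close> is known from the
    vanishing condition.\<close>
  define \<Gamma> where "\<Gamma> N = N + out (- ((1 / g (s N)) *\<^sub>R (c (s N) *v y N)) - N *v y N)" for N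
  define D where "D = {N :: real^'k^'n. column i N \<in> H \<and> s N \<in> Dm}"
  have lout: "linear (out :: real^'n \<Rightarrow> real^'k^'n)"
    by (rule linearI) (auto simp: out_def vec_eq_iff)
  have lcol: "linear (\<lambda>N::real^'k^'n. column i N)"
    by (rule linearI) (auto simp: column_def vec_eq_iff)
  have lE: "linear (\<lambda>N::real^'k^'n. E (column i N))"
    using linear_compose[OF lcol E(1)] by (simp add: o_def)
  have bl: "bounded_linear (\<lambda>N. E (column i N))" "bounded_linear (out :: real^'n \<Rightarrow> real^'k^'n)"
    using lE lout by (simp_all add: linear_conv_bounded_linear)
  have bls: "bounded_linear s"
    unfolding s_def
    by (intro bounded_linear_Pair bounded_linear_compose[OF bounded_linear_fst]
        bounded_linear_compose[OF bounded_linear_fst] bounded_linear_compose[OF bounded_linear_snd] bl)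
  have dy: "y differentiable (at N)" for N
    unfolding y_def
    by (intro differentiable_add differentiable_const bounded_linear_imp_differentiable
        bounded_linear_compose[OF bounded_linear_snd] bl)
  have d\<Gamma>: "\<Gamma> differentiable (at N)" if N: "N \<in> D" for N
  proof -
    have sDm: "s N \<in> Dm" using N by (simp add: D_def)
    have ds: "s differentiable (at N)" using bls by (rule bounded_linear_imp_differentiable)
    have dc: "(\<lambda>N. c (s N)) differentiable (at N)"
      using differentiable_chain_at[OF ds c[OF sDm]] by (simp add: o_def)
    have dg: "(\<lambda>N. g (s N)) differentiable (at N)"
      using differentiable_chain_at[OF ds g(1)[OF sDm]] by (simp add: o_def)
    have di: "(\<lambda>N. 1 / g (s N)) differentiable (at N)"
      using g(2)[OF sDm] by (intro differentiable_divide differentiable_const dg)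
    have dq: "(\<lambda>N. - ((1 / g (s N)) *\<^sub>R (c (s N) *v y N)) - N *v y N) differentiable (at N)"
      by (intro differentiable_diff differentiable_minus differentiable_scaleR di
          bounded_bilinear_differentiable[OF bounded_bilinear_matrix_vector] dc dy differentiable_ident)
    have "(\<lambda>N. out (- ((1 / g (s N)) *\<^sub>R (c (s N) *v y N)) - N *v y N)) differentiable (at N)"
      using differentiable_chain_at[OF dq bounded_linear_imp_differentiable[OF bl(2)]] by (simp add: o_def)
    then show ?thesis unfolding \<Gamma>_def by (intro differentiable_add differentiable_ident)
  qed
  have "negligible {N :: real^'k^'n. axis j0 (axis i 1) \<bullet> N = 0}"
    by (rule negligible_hyperplane) (simp add: axis_eq_0_iff)
  then have "negligible D"
    by (rule negligible_subset) (auto simp: D_def H_def inner_axis' column_def)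
  then have neg: "negligible (\<Gamma> ` D)"
    using d\<Gamma> by (intro negligible_differentiable_image_negligible)
      (auto simp: differentiable_on_def intro: differentiable_at_withinI)
  have "{M. \<exists>q\<in>Dm. \<exists>y\<in>W. y $ i = 1 \<and> (c q + g q *\<^sub>R M) *v y = 0} \<subseteq> \<Gamma> ` D"
  proof clarify
    fix M t x z assume q: "(t, x) \<in> Dm" and z: "z \<in> W" "z $ i = 1"
      and eq: "(c (t,x) + g (t,x) *\<^sub>R M) *v z = 0"
    have "z - y0 \<in> W0" using z y0 W by (auto simp: W0_def inner_diff_right inner_axis' subspace_diff)
    then have "(t, x, z - y0) \<in> E ` H" using E(2) by (auto simp: L_def)
    then obtain u where u: "u \<in> H" "E u = (t, x, z - y0)" by (metis imageE)
    define N where "N = (\<chi> a b. if b = i then u $ a else M $ a $ b)"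
    have col: "column i N = u" by (simp add: N_def column_def vec_eq_iff)
    have sN: "s N = (t, x)" and yN: "y N = z" by (simp_all add: s_def y_def col u)
    have "N \<in> D" by (simp add: D_def col u sN q)
    moreover have "\<Gamma> N = M"
    proof -
      have "g (t,x) *\<^sub>R (M *v z) = - (c (t,x) *v z)"
        using eq by (simp add: matrix_vector_mult_add_rdistrib scaleR_matrix_vector_assoc[symmetric] add_eq_0_iff2)
      then have "(1 / g (t,x)) *\<^sub>R (g (t,x) *\<^sub>R (M *v z)) = - ((1 / g (t,x)) *\<^sub>R (c (t,x) *v z))"
        by simp
      then have Mz: "- ((1 / g (t,x)) *\<^sub>R (c (t,x) *v z)) = M *v z"
        using g(2)[OF q] by simp
      have "(M *v z) $ a - (N *v z) $ a = M $ a $ i - u $ a" for a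
      proof -
        have "(M *v z) $ a - (N *v z) $ a = (\<Sum>b\<in>UNIV. if b = i then M $ a $ i - u $ a else 0)"
          unfolding matrix_vector_mult_def N_def vec_lambda_beta sum_subtractf[symmetric]
          by (rule sum.cong) (auto simp: z(2))
        then show ?thesis by simp
      qed
      then show ?thesis
        unfolding \<Gamma>_def sN yN Mz by (auto simp: vec_eq_iff out_def N_def)
    qed
    ultimately show "M \<in> \<Gamma> ` D" by force
  qed
  with neg show ?thesis by (rule negligible_subset)
qed

text \<open>A nonzero vector can be scaled to have some coordinate equal to 1, and finitely many
  null sets do not exhaust the matrices.\<close>

lemma generic_perturbation:
  fixes c :: "real \<times> (real^'p) \<Rightarrow> real^'k^'n" and g :: "real \<times> (real^'p) \<Rightarrow> real" and W :: "(real^'k) set"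
  assumes W: "subspace W" and dimW: "dim W + CARD('p) + 1 \<le> CARD('n)"
    and c: "\<And>q. q \<in> Dm \<Longrightarrow> c differentiable (at q)"
    and g: "\<And>q. q \<in> Dm \<Longrightarrow> g differentiable (at q)" "\<And>q. q \<in> Dm \<Longrightarrow> g q \<noteq> 0"
  obtains M where "\<And>q y. q \<in> Dm \<Longrightarrow> y \<in> W \<Longrightarrow> y \<noteq> 0 \<Longrightarrow> (c q + g q *\<^sub>R M) *v y \<noteq> 0"
proof -
  let ?B = "\<lambda>i. {M. \<exists>q\<in>Dm. \<exists>y\<in>W. y $ i = 1 \<and> (c q + g q *\<^sub>R M) *v y = 0}"
  have neg: "negligible (\<Union>i. ?B i)"
    by (rule negligible_Union) (auto intro!: generic_perturbation_negligible[OF W dimW] c g)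
  have "(\<Union>i. ?B i) \<noteq> UNIV"
  proof
    assume "(\<Union>i. ?B i) = UNIV"
    with neg show False by (simp only: non_negligible_UNIV)
  qed
  then obtain M where M: "M \<notin> (\<Union>i. ?B i)" by blast
  have "(c q + g q *\<^sub>R M) *v y \<noteq> 0" if "q \<in> Dm" "y \<in> W" "y \<noteq> 0" for q y
  proof
    assume eq: "(c q + g q *\<^sub>R M) *v y = 0"
    obtain i where i: "y $ i \<noteq> 0" using \<open>y \<noteq> 0\<close> by (auto simp: vec_eq_iff)
    have "(c q + g q *\<^sub>R M) *v ((1 / y $ i) *\<^sub>R y) = 0"
      by (simp add: eq matrix_vector_mult_scaleR)
    moreover have "(1 / y $ i) *\<^sub>R y \<in> W" "((1 / y $ i) *\<^sub>R y) $ i = 1"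
      using W that i by (auto simp: subspace_scale)
    ultimately show False using M that(1) by blast
  qed
  then show ?thesis by (rule that)
qed

section \<open>The degree of a family of linear maps on a hemisphere\<close>

text \<open>A ramp of length 2 is the building block of the loop in
  \<open>even_degree_inf_ends\<close>, each side of which occupies a parameter interval of length
  2.\<close>

definition cut_off :: "real \<Rightarrow> real" where "cut_off t = max 0 (min 2 t)"

lemma continuous_on_cut_off [continuous_intros]:
  "continuous_on A f \<Longrightarrow> continuous_on A (\<lambda>x. cut_off (f x))"
  unfolding cut_off_def by (intro continuous_intros)

lemma cut_off_cases:
  "t \<le> 0 \<and> cut_off t = 0 \<or> 0 < t \<and> t < 2 \<and> cut_off t = t \<or> 2 \<le> t \<and> cut_off t = 2"
  by (auto simp: cut_off_def)

text \<open>\<open>T\<close> identifies \<open>\<real>\<^sup>n\<close> with \<open>v\<^sup>\<bottom> \<times> \<real>\<^sup>p\<close>; then \<open>v + y\<close>, for \<open>y \<in> v\<^sup>\<bottom>\<close>, represents all points of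
  the open hemisphere around \<open>v\<close>. The coordinate in the direction \<open>v'\<close> is singled out because it is
  the one along which the zeros are cut and moved.\<close>

locale slice_chart =
  fixes v v' :: "real^'k" and T :: "real^'n \<Rightarrow> (real^'k) \<times> (real^'p)" and e :: "real^'n"
  assumes norm_v: "norm v = 1" and norm_v': "norm v' = 1" and v_v': "v \<bullet> v' = 0"
    and linear_T: "linear T" and norm_T: "\<And>z. norm (T z) = norm z"
    and fst_T: "\<And>z. v \<bullet> fst (T z) = 0" and range_T: "\<And>y x. v \<bullet> y = 0 \<Longrightarrow> (y, x) \<in> range T"
    and T_e: "T e = (v', 0)"
    and card_n: "CARD('n) > 1"
begin

definition crd :: "real^'n \<Rightarrow> real" where "crd z = v' \<bullet> fst (T z)"

text \<open>By \<open>sl_rest\<close> the vector fed to the matrix is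
  \<open>c v + \<theta> v' + w\<close> with \<open>w\<close> orthogonal to \<open>v\<close> and
  \<open>v'\<close>, where \<open>c\<close> and \<open>\<theta>\<close> are functions of
  \<open>t = crd z\<close>. The pair \<open>(1, t)\<close> gives the affine chart; other pairs bend
  the line \<open>v + t v'\<close>, and the matrix family may vary with the same
  \<open>t\<close>.\<close>

definition sl :: "(real \<Rightarrow> real^'p \<Rightarrow> real^'k^'n) \<Rightarrow> (real \<Rightarrow> real) \<Rightarrow> (real \<Rightarrow> real) \<Rightarrow> real^'n \<Rightarrow> real^'n" where
  "sl B c \<theta> z = B (crd z) (snd (T z)) *v (c (crd z) *\<^sub>R v + (\<theta> (crd z) - crd z) *\<^sub>R v' + fst (T z))"

definition rest :: "real^'n \<Rightarrow> real^'k" where "rest z = fst (T z) - crd z *\<^sub>R v'"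

lemma sl_rest: "sl B c \<theta> z = B (crd z) (snd (T z)) *v (c (crd z) *\<^sub>R v + \<theta> (crd z) *\<^sub>R v' + rest z)"
  by (simp add: sl_def rest_def algebra_simps)

lemma T_add: "T (x + y) = T x + T y" and T_scale: "T (k *\<^sub>R x) = k *\<^sub>R T x" and T_diff: "T (x - y) = T x - T y"
  using linear_T by (simp_all add: linear_add linear_cmul linear_diff)

lemma rest_perp: "v \<bullet> rest z = 0" "v' \<bullet> rest z = 0"
  by (simp_all add: rest_def inner_diff_right fst_T v_v' crd_def norm_v' dot_square_norm)

lemma norm_e: "norm e = 1"
  using norm_T[of e] T_e norm_v' by (simp add: norm_Pair)

lemma crd_e: "e \<bullet> z = crd z"
proof -
  have "e \<bullet> z = T e \<bullet> T z"
    unfolding dot_norm by (simp add: T_add[symmetric] norm_T)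
  then show ?thesis by (simp add: T_e inner_prod_def crd_def)
qed

lemma crd_shift: "crd (z + b *\<^sub>R e) = crd z + b" "fst (T (z + b *\<^sub>R e)) = fst (T z) + b *\<^sub>R v'" "snd (T (z + b *\<^sub>R e)) = snd (T z)"
  by (simp_all add: crd_def T_add T_scale T_e inner_add_right dot_square_norm norm_v')

lemma continuous_on_T [continuous_intros]: "continuous_on A f \<Longrightarrow> continuous_on A (\<lambda>x. T (f x))"
  using bounded_linear.continuous_on[OF linear_T[unfolded linear_conv_bounded_linear]] .

lemma continuous_on_crd [continuous_intros]: "continuous_on A f \<Longrightarrow> continuous_on A (\<lambda>x. crd (f x))"
  unfolding crd_def by (intro continuous_intros)

lemma continuous_on_sl:
  assumes "continuous_on UNIV (\<lambda>(t,x). B t x)" "continuous_on UNIV c" "continuous_on UNIV \<theta>"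
  shows "continuous_on UNIV (sl B c \<theta>)"
proof -
  have 1: "continuous_on UNIV (\<lambda>z. B (crd z) (snd (T z)))"
  proof -
    have "continuous_on UNIV (\<lambda>z. (\<lambda>(t,x). B t x) (crd z, snd (T z)))"
      by (rule continuous_on_compose2[OF assms(1)]) (auto intro!: continuous_intros)
    then show ?thesis by simp
  qed
  have 2: "continuous_on UNIV (\<lambda>z. c (crd z))" "continuous_on UNIV (\<lambda>z. \<theta> (crd z))"
    by (rule continuous_on_compose2[OF assms(2)] continuous_on_compose2[OF assms(3)]; auto intro!: continuous_intros)+
  show ?thesis unfolding sl_def by (intro continuous_intros 1 2)
qed

lemma sl_shift: "sl B c \<theta> (z + b *\<^sub>R e) = sl (\<lambda>t. B (t + b)) (\<lambda>t. c (t + b)) (\<lambda>t. \<theta> (t + b)) z"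
  by (simp add: sl_def crd_shift algebra_simps)

text \<open>Clamping along \<open>e\<close> only freezes \<open>t\<close> in the coefficients, so
  cutting a family gives families of the same form.\<close>

lemma sl_clamp_above: "sl B c \<theta> (clamp_above e b z) = sl (\<lambda>t. B (max b t)) (\<lambda>t. c (max b t)) (\<lambda>t. \<theta> (max b t)) z"
proof -
  have "clamp_above e b z = z + (max b (crd z) - crd z) *\<^sub>R e" by (simp add: clamp_above_def crd_e max_def)
  then show ?thesis by (simp only: sl_shift) (simp add: sl_def crd_shift algebra_simps)
qed

lemma sl_clamp_below: "sl B c \<theta> (clamp_below e b z) = sl (\<lambda>t. B (min b t)) (\<lambda>t. c (min b t)) (\<lambda>t. \<theta> (min b t)) z"
proof -
  have "clamp_below e b z = z + (min b (crd z) - crd z) *\<^sub>R e" by (simp add: clamp_below_def crd_e min_def max_def algebra_simps)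
  then show ?thesis by (simp only: sl_shift) (simp add: sl_def crd_shift algebra_simps)
qed

lemma nonzero_outside_sl:
  assumes "\<And>z. F z = 0 \<Longrightarrow> norm (snd (T z)) \<le> r \<and> \<bar>crd z\<bar> \<le> t0 \<and> norm (rest z) \<le> \<rho>" and "0 \<le> t0" "0 \<le> \<rho>" "0 \<le> r"
  shows "nonzero_outside (t0 + \<rho> + r + 1) F"
  unfolding nonzero_outside_def
proof (intro conjI allI impI notI)
  fix z assume z: "t0 + \<rho> + r + 1 \<le> norm z" "F z = 0"
  have "norm z = norm (T z)" by (simp add: norm_T)
  also have "\<dots> \<le> norm (fst (T z)) + norm (snd (T z))"
    using norm_Pair_le[of "fst (T z)" "snd (T z)"] by simp
  also have "fst (T z) = rest z + crd z *\<^sub>R v'" by (simp add: rest_def)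
  also have "norm \<dots> \<le> norm (rest z) + \<bar>crd z\<bar>"
    using norm_triangle_ineq[of "rest z" "crd z *\<^sub>R v'"] norm_v' by simp
  finally show False using assms(1)[OF z(2)] z(1) by linarith
qed (use assms in simp)

text \<open>\<open>T\<close> is not onto; this linear left inverse is a true inverse on pairs whose
  first component is orthogonal to \<open>v\<close>, see \<open>T_T_inv\<close>.\<close>

definition T_inv :: "(real^'k) \<times> (real^'p) \<Rightarrow> real^'n" where
  "T_inv = (SOME g. linear g \<and> (\<forall>z. g (T z) = z))"

lemma T_inv: "linear T_inv" "T_inv (T z) = z"
proof -
  have "inj T"
    using norm_T by (intro linear_injective_0[OF linear_T, THEN iffD2]) (metis norm_eq_zero)
  then obtain T' where "linear T'" "\<And>z. T' (T z) = z"
    using linear_injective_left_inverse[OF linear_T] by (metis comp_apply id_apply)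
  then have "\<exists>g. linear g \<and> (\<forall>z. g (T z) = z)" by blast
  from someI_ex[OF this] show "linear T_inv" "T_inv (T z) = z"
    unfolding T_inv_def by blast+
qed

lemma T_T_inv: "v \<bullet> y = 0 \<Longrightarrow> T (T_inv (y, x)) = (y, x)"
  using range_T[of y x] T_inv(2) by auto

lemma flip_exists:
  obtains N where "linear N" "inj N" "\<And>z. crd (N z) = - crd z" "\<And>z. fst (T (N z)) = - fst (T z)"
    "\<And>z. snd (T (N z)) = snd (T z)"
proof -
  define N where "N z = T_inv (- fst (T z), snd (T z))" for z
  have TN: "T (N z) = (- fst (T z), snd (T z))" for z
    unfolding N_def by (rule T_T_inv) (simp add: fst_T)
  have inj_T: "x = y" if "T x = T y" for x y using T_inv(2) that by metis
  show ?thesis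
  proof (rule that)
    show "linear N" by (rule linearI; rule inj_T) (simp_all add: TN T_add T_scale)
    show "inj N" by (rule injI, rule inj_T) (metis TN prod.inject neg_equal_iff_equal prod_eqI)
  qed (simp_all add: TN crd_def)
qed

text \<open>With \<open>c = 0\<close> the pole \<open>v\<close> drops out of the vector, and passing
  to the negative vector is realized by the linear isomorphism \<open>N\<close> of the domain, which
  also reverses \<open>t\<close>. Neither \<open>N\<close> nor the sign of the value affects the
  parity.\<close>

lemma even_degree_inf_flip:
  assumes "continuous_on UNIV (\<lambda>(t,x). B t x)" "continuous_on UNIV \<theta>"
    and R: "nonzero_outside R (sl B (\<lambda>_. 0) \<theta>)"
  shows "even (degree_inf (sl (\<lambda>t. B (- t)) (\<lambda>_. 0) (\<lambda>t. - \<theta> (- t)))) \<longleftrightarrow> even (degree_inf (sl B (\<lambda>_. 0) \<theta>))"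
proof -
  obtain N where N: "linear N" "inj N" "\<And>z. crd (N z) = - crd z" "\<And>z. fst (T (N z)) = - fst (T z)"
    "\<And>z. snd (T (N z)) = snd (T z)"
    using flip_exists by blast
  have c: "continuous_on UNIV (sl B (\<lambda>_. 0) \<theta>)" by (rule continuous_on_sl) (use assms in auto)
  have oN: "\<exists>S. nonzero_outside S (\<lambda>z. sl B (\<lambda>_. 0) \<theta> (N z))"
    by (rule nonzero_outside_linear[OF N(1,2) R]) blast
  have cN: "continuous_on UNIV (\<lambda>z. sl B (\<lambda>_. 0) \<theta> (N z))"
    using N(1) by (intro continuous_on_compose2[OF c]) (auto simp: linear_continuous_on linear_conv_bounded_linear)
  have eq: "sl (\<lambda>t. B (- t)) (\<lambda>_. 0) (\<lambda>t. - \<theta> (- t)) z = - sl B (\<lambda>_. 0) \<theta> (N z)" for z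
  proof -
    have "(- \<theta> (- crd z) - crd z) *\<^sub>R v' + fst (T z) = - ((\<theta> (- crd z) + crd z) *\<^sub>R v' + - fst (T z))"
      by (simp add: algebra_simps)
    then show ?thesis unfolding sl_def N
      by (simp add: bounded_bilinear.minus_right[OF bounded_bilinear_matrix_vector, symmetric])
  qed
  have "even (degree_inf (\<lambda>z. - sl B (\<lambda>_. 0) \<theta> (N z))) \<longleftrightarrow> even (degree_inf (\<lambda>z. sl B (\<lambda>_. 0) \<theta> (N z)))"
    using oN degree_inf_minus[OF cN] by blast
  then show ?thesis
    using degree_inf_linear[OF c R N(1,2)] by (simp add: eq[abs_def])
qed

text \<open>The reflection \<open>Q\<close> in the hyperplane orthogonal to \<open>e\<close>
  reverses \<open>t\<close> and keeps the other coordinates.\<close>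

lemma even_degree_inf_reverse:
  assumes "continuous_on UNIV (\<lambda>(t,x). B t x)" "continuous_on UNIV c" "continuous_on UNIV \<theta>"
    and R: "nonzero_outside R (sl B c \<theta>)"
  shows "even (degree_inf (sl (\<lambda>t. B (- t)) (\<lambda>t. c (- t)) (\<lambda>t. \<theta> (- t)))) \<longleftrightarrow> even (degree_inf (sl B c \<theta>))"
proof -
  define Q where "Q z = z + (- 2 * crd z) *\<^sub>R e" for z
  have lQ: "linear Q"
    by (rule linearI) (simp_all add: Q_def crd_e[symmetric] inner_add_right algebra_simps)
  have crdQ: "crd (Q z) = - crd z" for z by (simp add: Q_def crd_shift(1) del: scaleR_minus_left)
  have "Q (Q z) = z" for z by (simp add: Q_def[of "Q z"] crdQ) (simp add: Q_def)
  then have iQ: "inj Q" by (metis injI)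
  have eq: "sl B c \<theta> (Q z) = sl (\<lambda>t. B (- t)) (\<lambda>t. c (- t)) (\<lambda>t. \<theta> (- t)) z" for z
  proof -
    have "fst (T (Q z)) = fst (T z) - (2 * crd z) *\<^sub>R v'" "snd (T (Q z)) = snd (T z)"
      using crd_shift(2,3)[of z "- 2 * crd z"] unfolding Q_def by simp_all
    moreover have "(\<theta> (- crd z) - - crd z) *\<^sub>R v' + (fst (T z) - (2 * crd z) *\<^sub>R v') = (\<theta> (- crd z) - crd z) *\<^sub>R v' + fst (T z)"
    proof -
      have "(\<theta> (- crd z) - - crd z) *\<^sub>R v' = (\<theta> (- crd z) - crd z) *\<^sub>R v' + (2 * crd z) *\<^sub>R v'"
        unfolding scaleR_add_left[symmetric] by simp
      then show ?thesis by simp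
    qed
    ultimately show ?thesis by (simp only: sl_def crdQ add.assoc)
  qed
  show ?thesis
    using degree_inf_linear[OF continuous_on_sl[OF assms(1-3)] R lQ iQ] by (simp add: eq)
qed

end

text \<open>By compactness \<open>A s x\<close> is bounded above on unit vectors, and away from 0 on
  unit vectors of \<open>V\<close>, uniformly in \<open>s\<close> and \<open>x\<close>;
  \<open>B\<close> is the quotient of the two bounds. It is the source of the uniform radii: at a
  zero of a family \<open>sl\<close>, the component \<open>y\<close> is controlled by the bounded
  component \<open>u\<close>.\<close>

lemma kernel_bound:
  fixes A :: "real \<Rightarrow> real^'p \<Rightarrow> real^'k^'n" and V :: "(real^'k) set"
  assumes A: "continuous_on UNIV (\<lambda>(s,x). A s x)" and V: "subspace V"
    and inj: "\<And>s x y. 0 \<le> s \<Longrightarrow> s \<le> 1 \<Longrightarrow> norm x \<le> r \<Longrightarrow> y \<in> V \<Longrightarrow> y \<noteq> 0 \<Longrightarrow> A s x *v y \<noteq> 0"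
  obtains B where "B \<ge> 0"
    "\<And>s x u y. 0 \<le> s \<Longrightarrow> s \<le> 1 \<Longrightarrow> norm x \<le> r \<Longrightarrow> y \<in> V \<Longrightarrow> A s x *v (u + y) = 0 \<Longrightarrow> norm y \<le> B * norm u"
proof -
  define f where "f q = norm (A (fst q) (fst (snd q)) *v snd (snd q))" for q
  have cA: "continuous_on S (\<lambda>q. A (fst q) (fst (snd q)))" for S :: "(real \<times> (real^'p) \<times> (real^'k)) set"
  proof -
    have "continuous_on S (\<lambda>q. (\<lambda>(s,x). A s x) (fst q, fst (snd q)))"
      by (rule continuous_on_compose2[OF A]) (auto intro!: continuous_intros)
    then show ?thesis by simp
  qed
  have cf: "continuous_on S f" for S
    unfolding f_def by (intro continuous_intros cA)
  define K1 where "K1 = {0..1::real} \<times> cball (0::real^'p) r \<times> (sphere 0 1 \<inter> V)"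
  define K2 where "K2 = {0..1::real} \<times> cball (0::real^'p) r \<times> (sphere (0::real^'k) 1)"
  have comp: "compact K1" "compact K2"
    unfolding K1_def K2_def using V by (auto intro!: compact_Times compact_Int_closed closed_subspace)
  obtain m where m: "m > 0" "\<And>q. q \<in> K1 \<Longrightarrow> m \<le> f q"
  proof (cases "K1 = {}")
    case False
    then obtain q0 where q0: "q0 \<in> K1" "\<And>q. q \<in> K1 \<Longrightarrow> f q0 \<le> f q"
      using continuous_attains_inf[OF comp(1) False cf] by blast
    have "snd (snd q0) \<noteq> 0" using q0(1) by (auto simp: K1_def)
    then have "f q0 > 0" using q0(1) inj[of "fst q0" "fst (snd q0)" "snd (snd q0)"] by (auto simp: f_def K1_def)
    with q0(2) show ?thesis using that by blast
  qed (use that[of 1] in auto)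
  obtain M where M: "\<And>q. q \<in> K2 \<Longrightarrow> f q \<le> M" "M \<ge> 0"
  proof -
    obtain b where "\<forall>x\<in>f ` K2. norm x \<le> b"
      using compact_imp_bounded[OF compact_continuous_image[OF cf comp(2)]] by (auto simp: bounded_iff)
    then show ?thesis using that[of "max 0 b"] by fastforce
  qed
  have le: "norm (A s x *v u) \<le> M * norm u" if "0 \<le> s" "s \<le> 1" "norm x \<le> r" for s x u
  proof (cases "u = 0")
    case False
    have "f (s, x, (1 / norm u) *\<^sub>R u) \<le> M"
      by (rule M(1)) (use that False in \<open>auto simp: K2_def\<close>)
    then show ?thesis using False by (simp add: f_def matrix_vector_mult_scaleR field_simps)
  qed simp
  have ge: "m * norm y \<le> norm (A s x *v y)" if "0 \<le> s" "s \<le> 1" "norm x \<le> r" "y \<in> V" for s x y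
  proof (cases "y = 0")
    case False
    have "m \<le> f (s, x, (1 / norm y) *\<^sub>R y)"
      by (rule m(2)) (use that False V in \<open>auto simp: K1_def subspace_scale\<close>)
    then show ?thesis using False by (simp add: f_def matrix_vector_mult_scaleR field_simps)
  qed simp
  show ?thesis
  proof (rule that[of "M / m"])
    show "M / m \<ge> 0" using M(2) m(1) by simp
    fix s x u y assume q: "0 \<le> s" "s \<le> 1" "norm x \<le> r" "y \<in> V" and z: "A s x *v (u + y) = 0"
    have "A s x *v y = - (A s x *v u)" using z by (simp add: matrix_vector_right_distrib add_eq_0_iff2)
    then have "m * norm y \<le> M * norm u"
      using ge[OF q] le[OF q(1-3), of u] by simp
    then show "norm y \<le> M / m * norm u" using m(1) by (simp add: field_simps)
  qed
qed

section \<open>Bending the chart and closing it up to a loop\<close>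

context slice_chart
begin

text \<open>The point \<open>(hat t, ramp t)\<close> moves along two segments from
  \<open>(0, -1)\<close> over \<open>(1, 0)\<close> to \<open>(0, 1)\<close> and rests outside
  \<open>[-1, 1]\<close>. So the boundary of the hemisphere, which is at infinity in the affine
  chart, is reached at \<open>t = -1\<close> and \<open>t = 1\<close>.\<close>

abbreviation "hat \<equiv> (\<lambda>t::real. max 0 (1 - \<bar>t\<bar>))"
abbreviation "ramp \<equiv> (\<lambda>t::real. max (- 1) (min 1 t))"

lemma v'_le_norm: "\<bar>v' \<bullet> y\<bar> \<le> norm y"
  using Cauchy_Schwarz_ineq2[of v' y] norm_v' by simp

lemma comb_nonzero:
  assumes "c \<noteq> 0 \<or> \<theta> \<noteq> 0" "v \<bullet> w = 0" "v' \<bullet> w = 0"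
  shows "c *\<^sub>R v + \<theta> *\<^sub>R v' + w \<noteq> 0"
proof
  assume 0: "c *\<^sub>R v + \<theta> *\<^sub>R v' + w = 0"
  have "v \<bullet> (c *\<^sub>R v + \<theta> *\<^sub>R v' + w) = c" "v' \<bullet> (c *\<^sub>R v + \<theta> *\<^sub>R v' + w) = \<theta>"
    using assms v_v' norm_v norm_v' by (simp_all add: inner_add_right dot_square_norm inner_commute)
  then show False unfolding 0 using assms(1) by simp
qed

text \<open>Linear interpolation between the pairs \<open>(1, t)\<close> and
  \<open>(hat t, ramp t)\<close> keeps the zeros bounded: as \<open>a x\<close> is injective on the
  orthogonal complement of \<open>v\<close>, the \<open>v'\<close>-component of a kernel vector is
  at most \<open>B\<close> times its \<open>v\<close>-component.\<close>

lemma degree_inf_hat_ramp: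
  fixes a :: "real^'p \<Rightarrow> real^'k^'n"
  assumes a: "continuous_on UNIV a" and r: "0 \<le> r"
    and injr: "\<And>x \<beta>. norm x \<ge> r \<Longrightarrow> \<beta> \<noteq> 0 \<Longrightarrow> a x *v \<beta> \<noteq> 0"
    and inj: "\<And>x y. v \<bullet> y = 0 \<Longrightarrow> y \<noteq> 0 \<Longrightarrow> a x *v y \<noteq> 0"
  shows "degree_inf (\<lambda>z. a (snd (T z)) *v (v + fst (T z))) = degree_inf (sl (\<lambda>t. a) hat ramp)"
proof -
  have ca: "continuous_on UNIV (\<lambda>(s::real,x). a x)"
    unfolding case_prod_unfold by (rule continuous_on_compose2[OF a]) (auto intro!: continuous_intros)
  obtain B where B: "B \<ge> 0"
    "\<And>s x u y. 0 \<le> (s::real) \<Longrightarrow> s \<le> 1 \<Longrightarrow> norm x \<le> r \<Longrightarrow> y \<in> {y. v \<bullet> y = 0} \<Longrightarrow> a x *v (u + y) = 0 \<Longrightarrow> norm y \<le> B * norm u"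
    by (rule kernel_bound[OF ca subspace_hyperplane[of v], of r]) (use inj in auto)
  define c where "c l t = (1 - l) + l * hat t" for l t
  define \<theta> where "\<theta> l t = (1 - l) * t + l * ramp t" for l t
  have c01: "0 \<le> c l t" "c l t \<le> 1" if "0 \<le> l" "l \<le> 1" for l t
  proof -
    show "0 \<le> c l t" using that by (simp add: c_def)
    show "c l t \<le> 1" unfolding c_def using convex_bound_le[of 1 1 "hat t" "1 - l" l] that by simp
  qed
  have R: "nonzero_outside ((1 + B) + 2 * B + r + 1) (sl (\<lambda>t. a) (c l) (\<theta> l))" if l: "0 \<le> l" "l \<le> 1" for l
  proof (rule nonzero_outside_sl)
    show "norm (snd (T z)) \<le> r \<and> \<bar>crd z\<bar> \<le> 1 + B \<and> norm (rest z) \<le> 2 * B"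
      if z: "sl (\<lambda>t. a) (c l) (\<theta> l) z = 0" for z
    proof -
      let ?t = "crd z"
      \<comment> \<open>Beyond \<open>\<bar>t\<bar> = 1\<close> the hat vanishes and both summands
        of \<open>\<theta>\<close> have the sign of \<open>t\<close>, so their absolute values
        add.\<close>
      have out: "c l ?t \<ge> 1 - l \<and> (\<bar>?t\<bar> > 1 \<longrightarrow> c l ?t = 1 - l \<and> \<bar>\<theta> l ?t\<bar> = (1 - l) * \<bar>?t\<bar> + l)"
      proof -
        have "\<bar>\<theta> l ?t\<bar> = (1 - l) * \<bar>?t\<bar> + l" if "\<bar>?t\<bar> > 1"
        proof (cases "?t > 0")
          case True
          then have "\<theta> l ?t = (1 - l) * ?t + l" using that by (simp add: \<theta>_def)
          moreover have "0 \<le> (1 - l) * ?t" using l True by simp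
          ultimately show ?thesis using True l by simp
        next
          case False
          then have "\<theta> l ?t = - ((1 - l) * (- ?t) + l)" using that by (simp add: \<theta>_def)
          moreover have "0 \<le> (1 - l) * (- ?t)" using l False by (intro mult_nonneg_nonneg) auto
          ultimately show ?thesis using False l by simp
        qed
        then show ?thesis using l by (auto simp: c_def)
      qed
      have nz: "c l ?t \<noteq> 0 \<or> \<theta> l ?t \<noteq> 0"
      proof (rule ccontr)
        assume "\<not> ?thesis"
        then have 0: "c l ?t = 0" "\<theta> l ?t = 0" by auto
        then have l1: "l = 1" using out l by linarith
        then show False using 0 by (auto simp: c_def \<theta>_def max_def min_def split: if_splits)
      qed
      have sl0: "a (snd (T z)) *v (c l ?t *\<^sub>R v + \<theta> l ?t *\<^sub>R v' + rest z) = 0"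
        using z by (simp add: sl_rest)
      have x: "norm (snd (T z)) \<le> r"
      proof (rule ccontr)
        assume "\<not> ?thesis"
        then show False using injr[OF _ comb_nonzero[OF nz rest_perp], of "snd (T z)"] sl0 by auto
      qed
      let ?y = "\<theta> l ?t *\<^sub>R v' + rest z"
      have "v \<bullet> ?y = 0" by (simp add: inner_add_right rest_perp v_v')
      then have nB: "norm ?y \<le> B * c l ?t"
        using B(2)[of 0 "snd (T z)" ?y "c l ?t *\<^sub>R v"] x sl0 c01[OF l, of ?t] norm_v by (simp add: add.assoc)
      have "v' \<bullet> ?y = \<theta> l ?t" by (simp add: inner_add_right rest_perp dot_square_norm norm_v')
      then have th: "\<bar>\<theta> l ?t\<bar> \<le> B * c l ?t" using v'_le_norm[of ?y] nB by simp
      have BB: "B * c l ?t \<le> B" using B(1) c01[OF l, of ?t] by (simp add: mult_left_le)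
      have "norm (rest z) = norm (?y - \<theta> l ?t *\<^sub>R v')" by simp
      also have "\<dots> \<le> norm ?y + norm (\<theta> l ?t *\<^sub>R v')" by (rule norm_triangle_ineq4)
      finally have "norm (rest z) \<le> 2 * B" using nB th BB norm_v' by simp
      moreover have "\<bar>?t\<bar> \<le> 1 + B"
      proof (cases "\<bar>?t\<bar> > 1")
        case True
        \<comment> \<open>For \<open>l = 1\<close> this would read \<open>1 \<le> 0\<close>;
          otherwise division by \<open>1 - l\<close> gives
          \<open>\<bar>t\<bar> \<le> B\<close>.\<close>
        then have le: "(1 - l) * \<bar>?t\<bar> + l \<le> B * (1 - l)" using out th by simp
        have "l \<noteq> 1" using le by auto
        then have "0 < 1 - l" using l by simp
        moreover have "(1 - l) * \<bar>?t\<bar> \<le> (1 - l) * B" using le l by (simp add: mult.commute)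
        ultimately have "\<bar>?t\<bar> \<le> B" by (simp only: mult_le_cancel_left_pos)
        then show ?thesis by simp
      qed (use B in simp)
      ultimately show ?thesis using x by blast
    qed
  qed (use B r in auto)
  have "degree_inf (sl (\<lambda>t. a) (c 0) (\<theta> 0)) = degree_inf (sl (\<lambda>t. a) (c 1) (\<theta> 1))"
  proof (rule degree_inf_homotopy[of "\<lambda>l. sl (\<lambda>t. a) (c l) (\<theta> l)", OF _ R])
    show "continuous_on ({0..1} \<times> UNIV) (\<lambda>(l, z). sl (\<lambda>t. a) (c l) (\<theta> l) z)"
      unfolding case_prod_unfold sl_def c_def \<theta>_def
      by (intro continuous_intros continuous_on_compose2[OF a]) auto
  qed
  moreover have "sl (\<lambda>t. a) (c 0) (\<theta> 0) = (\<lambda>z. a (snd (T z)) *v (v + fst (T z)))"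
    by (simp add: fun_eq_iff sl_def c_def \<theta>_def)
  moreover have "c 1 = hat" "\<theta> 1 = ramp" by (simp_all add: c_def \<theta>_def fun_eq_iff)
  ultimately show ?thesis by simp
qed

text \<open>The pairs \<open>(s, \<theta>)\<close> run around the boundary of the square \<open>[0,1] \<times> [-1,1]\<close>. Contracting this
  loop to a corner shows that the total degree vanishes. The two sides \<open>\<theta> = 1\<close> and \<open>\<theta> = -1\<close>
  correspond to each other under the antipode, hence contribute an even number together.\<close>

lemma even_degree_inf_ends:
  fixes A :: "real \<Rightarrow> real^'p \<Rightarrow> real^'k^'n"
  assumes A: "continuous_on UNIV (\<lambda>(s,x). A s x)" and r: "0 \<le> r"
    and injr: "\<And>s x \<beta>. 0 \<le> s \<Longrightarrow> s \<le> 1 \<Longrightarrow> norm x \<ge> r \<Longrightarrow> \<beta> \<noteq> 0 \<Longrightarrow> A s x *v \<beta> \<noteq> 0"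
    and injW: "\<And>s x y. s = 0 \<or> s = 1 \<Longrightarrow> v \<bullet> y = 0 \<Longrightarrow> y \<noteq> 0 \<Longrightarrow> A s x *v y \<noteq> 0"
    and injW': "\<And>s x y. 0 \<le> s \<Longrightarrow> s \<le> 1 \<Longrightarrow> v \<bullet> y = 0 \<Longrightarrow> v' \<bullet> y = 0 \<Longrightarrow> y \<noteq> 0 \<Longrightarrow> A s x *v y \<noteq> 0"
  shows "even (degree_inf (sl (\<lambda>t. A 0) hat ramp)) \<longleftrightarrow> even (degree_inf (sl (\<lambda>t. A 1) hat ramp))"
proof -
  define V where "V = {y. v \<bullet> y = 0} \<inter> {y. v' \<bullet> y = 0}"
  have V: "subspace V" unfolding V_def by (intro subspace_inter subspace_hyperplane)
  obtain B where B: "B \<ge> 0"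
    "\<And>s x u y. 0 \<le> s \<Longrightarrow> s \<le> 1 \<Longrightarrow> norm x \<le> r \<Longrightarrow> y \<in> V \<Longrightarrow> A s x *v (u + y) = 0 \<Longrightarrow> norm y \<le> B * norm u"
    by (rule kernel_bound[OF A V, of r]) (use injW' in \<open>auto simp: V_def\<close>)
  \<comment> \<open>One estimate for all families below: injectivity at the end values of
    \<open>s\<close> excludes zeros with \<open>\<bar>t\<bar> > t0\<close>, and the bound 2 on the
    norm of \<open>c v + \<theta> v'\<close> makes the remaining component at most
    \<open>2 * B\<close>.\<close>
  have outside: "nonzero_outside (t0 + 2 * B + r + 1) (sl (\<lambda>t. A (s t)) c \<theta>)"
    if "t0 \<ge> 0" and s: "\<And>t. 0 \<le> s t" "\<And>t. s t \<le> 1" and c: "\<And>t. \<bar>c t\<bar> \<le> 1" and \<theta>: "\<And>t. \<bar>\<theta> t\<bar> \<le> 1"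
      and nz: "\<And>t. c t \<noteq> 0 \<or> \<theta> t \<noteq> 0" and far: "\<And>t. \<bar>t\<bar> > t0 \<Longrightarrow> (s t = 0 \<or> s t = 1) \<and> c t = 0"
    for t0 s c \<theta>
  proof (rule nonzero_outside_sl)
    show "norm (snd (T z)) \<le> r \<and> \<bar>crd z\<bar> \<le> t0 \<and> norm (rest z) \<le> 2 * B"
      if z: "sl (\<lambda>t. A (s t)) c \<theta> z = 0" for z
    proof -
      let ?t = "crd z"
      have sl0: "A (s ?t) (snd (T z)) *v (c ?t *\<^sub>R v + \<theta> ?t *\<^sub>R v' + rest z) = 0"
        using z by (simp add: sl_rest)
      note nzv = comb_nonzero[OF nz rest_perp]
      have x: "norm (snd (T z)) \<le> r"
      proof (rule ccontr)
        assume "\<not> ?thesis"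
        then show False using injr[OF s _ nzv, of "snd (T z)" ?t] sl0 by auto
      qed
      have "\<bar>?t\<bar> \<le> t0"
      proof (rule ccontr)
        assume "\<not> ?thesis"
        then have f: "s ?t = 0 \<or> s ?t = 1" "c ?t = 0" using far by auto
        have "v \<bullet> (c ?t *\<^sub>R v + \<theta> ?t *\<^sub>R v' + rest z) = 0"
          by (simp add: f(2) inner_add_right rest_perp v_v')
        then show False using injW[OF f(1) _ nzv] sl0 by blast
      qed
      moreover have "norm (c ?t *\<^sub>R v + \<theta> ?t *\<^sub>R v') \<le> 2"
        using norm_triangle_ineq[of "c ?t *\<^sub>R v" "\<theta> ?t *\<^sub>R v'"] c[of ?t] \<theta>[of ?t] norm_v norm_v' by simp
      then have "B * norm (c ?t *\<^sub>R v + \<theta> ?t *\<^sub>R v') \<le> B * 2" by (intro mult_left_mono B)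
      then have "norm (rest z) \<le> 2 * B"
        using B(2)[OF s x _ sl0] rest_perp by (force simp: V_def)
      ultimately show ?thesis using x by blast
    qed
  qed (use that B r in auto)
  have cB: "continuous_on UNIV (\<lambda>(t,x). A (s t) x)" if "continuous_on UNIV s" for s :: "real \<Rightarrow> real"
  proof -
    have "continuous_on UNIV (\<lambda>q. (\<lambda>(s,x). A s x) (s (fst q), snd q))"
      by (rule continuous_on_compose2[OF A])
        (auto intro!: continuous_intros continuous_on_compose2[OF that])
    then show ?thesis by (simp add: case_prod_unfold)
  qed
  \<comment> \<open>The loop in \<open>(s, \<theta>)\<close>: on \<open>[0, 2]\<close>
    \<open>\<theta>\<close> rises with \<open>s = 0\<close>, on \<open>[2, 4]\<close>
    \<open>s\<close> rises with \<open>\<theta> = 1\<close>, on \<open>[4, 6]\<close>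
    \<open>\<theta>\<close> falls with \<open>s = 1\<close>, on \<open>[6, 8]\<close>
    \<open>s\<close> falls with \<open>\<theta> = -1\<close>. Outside \<open>[0, 8]\<close> it rests
    at \<open>(0, -1)\<close>.\<close>
  define st where "st t = (cut_off (t - 2) - cut_off (t - 6)) / 2" for t
  define th where "th t = - 1 + cut_off t - cut_off (t - 4)" for t
  \<comment> \<open>\<open>l\<close> scales the loop towards the corner \<open>(0, -1)\<close>. The
    coefficient \<open>1 - \<bar>\<theta>\<bar>\<close> of \<open>v\<close> never vanishes together
    with \<open>\<theta>\<close>, and on a full sweep of \<open>\<theta>\<close> the two form the
    pair \<open>(hat, ramp)\<close> up to a shift and reversal of \<open>t\<close>.\<close>
  define H where "H l = sl (\<lambda>t. A (l * st t)) (\<lambda>t. 1 - \<bar>- 1 + l * (th t + 1)\<bar>) (\<lambda>t. - 1 + l * (th t + 1))" for l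
  have st01: "0 \<le> st t" "st t \<le> 1" for t
    using cut_off_cases[of "t - 2"] cut_off_cases[of "t - 6"] by (auto simp: st_def)
  have th1: "- 1 \<le> th t" "th t \<le> 1" for t
    using cut_off_cases[of t] cut_off_cases[of "t - 4"] by (auto simp: th_def)
  have far: "st t = 0 \<and> th t = - 1" if "t < 0 \<or> 8 < t" for t
    using that by (auto simp: st_def th_def cut_off_def)
  have R: "nonzero_outside (8 + 2 * B + r + 1) (H l)" if l: "0 \<le> l" "l \<le> 1" for l
    unfolding H_def
  proof (rule outside)
    have lt: "0 \<le> l * (th t + 1) \<and> l * (th t + 1) \<le> 2" for t
    proof -
      have "l * (th t + 1) \<le> 1 * 2" using l th1[of t] by (intro mult_mono) auto
      then show ?thesis using l th1[of t] by simp
    qed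
    show "0 \<le> l * st t" "l * st t \<le> 1" for t using l st01[of t] by (auto intro: mult_le_one)
    show "\<bar>1 - \<bar>- 1 + l * (th t + 1)\<bar>\<bar> \<le> 1" "\<bar>- 1 + l * (th t + 1)\<bar> \<le> 1" for t using lt[of t] by auto
    show "1 - \<bar>- 1 + l * (th t + 1)\<bar> \<noteq> 0 \<or> - 1 + l * (th t + 1) \<noteq> 0" for t by auto
    show "(l * st t = 0 \<or> l * st t = 1) \<and> 1 - \<bar>- 1 + l * (th t + 1)\<bar> = 0" if "8 < \<bar>t\<bar>" for t
    proof -
      have "t < 0 \<or> 8 < t" using that by auto
      from far[OF this] show ?thesis by simp
    qed
  qed simp
  have cst: "continuous_on S (\<lambda>x. st (f x))" "continuous_on S (\<lambda>x. th (f x))"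
    if "continuous_on S f" for f and S :: "'b::topological_space set"
    unfolding st_def th_def using that by (intro continuous_intros; assumption?; simp?)+
  have "degree_inf (H 0) = degree_inf (H 1)"
  proof (rule degree_inf_homotopy[of H, OF _ R])
    have "continuous_on ({0..1} \<times> UNIV) (\<lambda>q. (\<lambda>(s,x). A s x) (fst q * st (crd (snd q)), snd (T (snd q))))"
      by (rule continuous_on_compose2[OF A]) (auto intro!: continuous_intros cst)
    then have "continuous_on ({0..1} \<times> UNIV) (\<lambda>q. A (fst q * st (crd (snd q))) (snd (T (snd q))))" by simp
    then show "continuous_on ({0..1} \<times> UNIV) (\<lambda>(l, z). H l z)"
      unfolding case_prod_unfold H_def sl_def by (intro continuous_intros cst)
  qed
  \<comment> \<open>At \<open>l = 0\<close> the vector is \<open>- v' + w\<close>, nonzero and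
    orthogonal to \<open>v\<close>, where \<open>A 0\<close> is injective.\<close>
  moreover have "degree_inf (H 0) = 0"
  proof (rule degree_inf_zero_free)
    show "continuous_on UNIV (H 0)"
      unfolding H_def by (intro continuous_on_sl cB continuous_intros cst)
    fix z
    have "v \<bullet> (0 *\<^sub>R v + (- 1) *\<^sub>R v' + rest z) = 0" by (simp add: inner_diff_right rest_perp v_v')
    moreover have "0 *\<^sub>R v + (- 1) *\<^sub>R v' + rest z \<noteq> 0" by (rule comb_nonzero) (simp_all add: rest_perp)
    ultimately have "A 0 (snd (T z)) *v (0 *\<^sub>R v + (- 1) *\<^sub>R v' + rest z) \<noteq> 0" by (intro injW) auto
    then show "H 0 z \<noteq> 0" unfolding H_def sl_rest by simp
  qed
  moreover define F where "F = sl (\<lambda>t. A (st t)) (\<lambda>t. 1 - \<bar>th t\<bar>) th"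
  have "H 1 = F" by (simp add: H_def F_def)
  ultimately have F0: "degree_inf F = 0" by simp
  have cF: "continuous_on UNIV F"
    unfolding F_def by (intro continuous_on_sl cB continuous_intros cst)
  define S where "S = 8 + 2 * B + r + 1"
  have oF: "nonzero_outside S F" using R[of 1] \<open>H 1 = F\<close> by (simp add: S_def)
  \<comment> \<open>At these corners \<open>c = 0\<close> and \<open>s\<close> is an end value, so
    injectivity on the orthogonal complement of \<open>v\<close> keeps the hyperplanes
    \<open>t = 2\<close>, \<open>t = 4\<close> and \<open>t = 6\<close> free of zeros: the loop can
    be cut into its sides.\<close>
  have corner: "F z \<noteq> 0" if "crd z = 2 \<or> crd z = 4 \<or> crd z = 6" for z
  proof -
    have q: "st (crd z) = 0 \<or> st (crd z) = 1" "\<bar>th (crd z)\<bar> = 1"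
      using that by (auto simp: st_def th_def cut_off_def)
    have "v \<bullet> (0 *\<^sub>R v + th (crd z) *\<^sub>R v' + rest z) = 0" by (simp add: inner_add_right rest_perp v_v')
    moreover have "0 *\<^sub>R v + th (crd z) *\<^sub>R v' + rest z \<noteq> 0"
      by (rule comb_nonzero) (use q in \<open>auto simp: rest_perp\<close>)
    ultimately have "A (st (crd z)) (snd (T z)) *v (0 *\<^sub>R v + th (crd z) *\<^sub>R v' + rest z) \<noteq> 0"
      by (intro injW q)
    then show ?thesis unfolding F_def sl_rest by (simp add: q)
  qed
  let ?lo = "clamp_below e" and ?hi = "clamp_above e"
  have cl: "continuous_on UNIV (\<lambda>z. F (f (g z)))"
    if "f = id \<or> (\<exists>b. f = ?lo b \<or> f = ?hi b)" "g = id \<or> (\<exists>b. g = ?lo b \<or> g = ?hi b)" for f g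
  proof -
    have f: "continuous_on UNIV f" using that(1) by (auto intro: continuous_on_clamp continuous_on_id)
    have g: "continuous_on UNIV g" using that(2) by (auto intro: continuous_on_clamp continuous_on_id)
    show ?thesis by (rule continuous_on_compose2[OF cF continuous_on_compose2[OF f g]]) auto
  qed
  have id': "?lo b z = z" if "crd z \<le> b" for b z using that by (simp add: clamp_below_def crd_e)
  have id'': "?hi b z = z" if "crd z \<ge> b" for b z using that by (simp add: clamp_above_def crd_e)
  have o4: "nonzero_outside S (\<lambda>z. F (?hi 4 z))" "nonzero_outside S (\<lambda>z. F (?lo 4 z))"
    by (rule nonzero_outside_clamp[OF norm_e oF]; use corner crd_e in auto)+
  have n2: "F (?lo 4 z) \<noteq> 0" if "e \<bullet> z = 2" for z using that corner[of z] by (simp add: crd_e id')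
  have n6: "F (?hi 4 z) \<noteq> 0" if "e \<bullet> z = 6" for z using that corner[of z] by (simp add: crd_e id'')
  have o2: "nonzero_outside S (\<lambda>z. F (?lo 4 (?hi 2 z)))" "nonzero_outside S (\<lambda>z. F (?lo 4 (?lo 2 z)))"
    by (rule nonzero_outside_clamp[OF norm_e o4(2)]; fact n2)+
  have o6: "nonzero_outside S (\<lambda>z. F (?hi 4 (?hi 6 z)))" "nonzero_outside S (\<lambda>z. F (?hi 4 (?lo 6 z)))"
    by (rule nonzero_outside_clamp[OF norm_e o4(1)]; fact n6)+
  have c4: "continuous_on UNIV (\<lambda>z. F (?lo 4 z))" "continuous_on UNIV (\<lambda>z. F (?hi 4 z))"
    using cl[of "?lo 4" id] cl[of "?hi 4" id] by auto
  have "degree_inf F = degree_inf (\<lambda>z. F (?lo 4 z)) + degree_inf (\<lambda>z. F (?hi 4 z))"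
    by (rule degree_inf_cut[OF card_n cF oF norm_e]) (use corner crd_e in auto)
  also have "degree_inf (\<lambda>z. F (?lo 4 z)) = degree_inf (\<lambda>z. F (?lo 4 (?lo 2 z))) + degree_inf (\<lambda>z. F (?lo 4 (?hi 2 z)))"
    by (rule degree_inf_cut[OF card_n c4(1) o4(2) norm_e n2])
  also have "degree_inf (\<lambda>z. F (?hi 4 z)) = degree_inf (\<lambda>z. F (?hi 4 (?lo 6 z))) + degree_inf (\<lambda>z. F (?hi 4 (?hi 6 z)))"
    by (rule degree_inf_cut[OF card_n c4(2) o4(1) norm_e n6])
  finally have sum: "0 = degree_inf (\<lambda>z. F (?lo 4 (?lo 2 z))) + degree_inf (\<lambda>z. F (?lo 4 (?hi 2 z)))
      + (degree_inf (\<lambda>z. F (?hi 4 (?lo 6 z))) + degree_inf (\<lambda>z. F (?hi 4 (?hi 6 z))))"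
    unfolding F0 .
  have cc: "continuous_on UNIV (\<lambda>z. F (?lo 4 (?lo 2 z)))" "continuous_on UNIV (\<lambda>z. F (?lo 4 (?hi 2 z)))"
    "continuous_on UNIV (\<lambda>z. F (?hi 4 (?lo 6 z)))" "continuous_on UNIV (\<lambda>z. F (?hi 4 (?hi 6 z)))"
    using cl[of "?lo 4" "?lo 2"] cl[of "?lo 4" "?hi 2"] cl[of "?hi 4" "?lo 6"] cl[of "?hi 4" "?hi 6"] by blast+
  have slc: "sl B1 c1 \<theta>1 = sl B2 c2 \<theta>2" if "\<And>t. B1 t = B2 t" "\<And>t. c1 t = c2 t" "\<And>t. \<theta>1 t = \<theta>2 t" for B1 c1 \<theta>1 B2 c2 \<theta>2
    using that by (simp add: sl_def fun_eq_iff)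
  \<comment> \<open>The shifts 1, 3, 5 and 7 used for the four pieces are the midpoints of the
    sides, so that each is recentred at \<open>t = 0\<close>.\<close>
  have p1: "degree_inf (\<lambda>z. F (?lo 4 (?lo 2 z))) = degree_inf (sl (\<lambda>t. A 0) hat ramp)"
  proof -
    have "(\<lambda>z. F (?lo 4 (?lo 2 (z + 1 *\<^sub>R e)))) = sl (\<lambda>t. A 0) hat ramp"
      unfolding F_def sl_clamp_above sl_clamp_below sl_shift
    proof (rule slc)
      show "A (st (min 4 (min 2 (t + 1)))) = A 0" for t
        by (auto simp: st_def cut_off_def min_def max_def)
      show 2: "th (min 4 (min 2 (t + 1))) = ramp t" for t
        by (auto simp: th_def cut_off_def min_def max_def)
      show "1 - \<bar>th (min 4 (min 2 (t + 1)))\<bar> = hat t" for t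
        unfolding 2 by (auto simp: min_def max_def)
    qed
    then show ?thesis using degree_inf_translate[OF cc(1) o2(2), of "1 *\<^sub>R e"] by auto
  qed
  have p3: "even (degree_inf (\<lambda>z. F (?hi 4 (?lo 6 z)))) \<longleftrightarrow> even (degree_inf (sl (\<lambda>t. A 1) hat ramp))"
  proof -
    have "(\<lambda>z. F (?hi 4 (?lo 6 (z + 5 *\<^sub>R e)))) = sl (\<lambda>t. A 1) (\<lambda>t. hat (- t)) (\<lambda>t. ramp (- t))"
      unfolding F_def sl_clamp_above sl_clamp_below sl_shift
    proof (rule slc)
      show "A (st (max 4 (min 6 (t + 5)))) = A 1" for t
        by (auto simp: st_def cut_off_def min_def max_def)
      show 2: "th (max 4 (min 6 (t + 5))) = ramp (- t)" for t
        by (auto simp: th_def cut_off_def min_def max_def)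
      show "1 - \<bar>th (max 4 (min 6 (t + 5)))\<bar> = hat (- t)" for t
        unfolding 2 by (auto simp: min_def max_def)
    qed
    moreover have "even (degree_inf (sl (\<lambda>t. A 1) (\<lambda>t. hat (- t)) (\<lambda>t. ramp (- t))))
       \<longleftrightarrow> even (degree_inf (sl (\<lambda>t. A 1) hat ramp))"
    proof (rule even_degree_inf_reverse[of "\<lambda>t. A 1"])
      show "nonzero_outside (1 + 2 * B + r + 1) (sl (\<lambda>t. A 1) hat ramp)"
        by (rule outside[of 1 "\<lambda>_. 1"]) (auto simp: max_def min_def)
    qed (use cB[of "\<lambda>_. 1"] in \<open>auto intro!: continuous_intros\<close>)
    ultimately show ?thesis using degree_inf_translate[OF cc(3) o6(2), of "5 *\<^sub>R e"] by auto
  qed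
  \<comment> \<open>On the sides \<open>\<theta> = 1\<close> and \<open>\<theta> = -1\<close> the
    coefficient of \<open>v\<close> is 0, so \<open>even_degree_inf_flip\<close> identifies the
    second, which runs backwards, with the first up to parity.\<close>
  let ?E = "sl (\<lambda>t. A (cut_off (t + 1) / 2)) (\<lambda>_. 0) (\<lambda>_. 1)"
  have p2: "degree_inf (\<lambda>z. F (?lo 4 (?hi 2 z))) = degree_inf ?E"
  proof -
    have "(\<lambda>z. F (?lo 4 (?hi 2 (z + 3 *\<^sub>R e)))) = ?E"
      unfolding F_def sl_clamp_above sl_clamp_below sl_shift
    proof (rule slc)
      show "A (st (min 4 (max 2 (t + 3)))) = A (cut_off (t + 1) / 2)" for t
        by (rule arg_cong[of _ _ A]) (auto simp: st_def cut_off_def min_def max_def)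
      show 2: "th (min 4 (max 2 (t + 3))) = 1" for t
        by (auto simp: th_def cut_off_def min_def max_def)
      show "1 - \<bar>th (min 4 (max 2 (t + 3)))\<bar> = 0" for t
        unfolding 2 by simp
    qed
    then show ?thesis using degree_inf_translate[OF cc(2) o2(1), of "3 *\<^sub>R e"] by auto
  qed
  have p4: "even (degree_inf (\<lambda>z. F (?hi 4 (?hi 6 z)))) \<longleftrightarrow> even (degree_inf ?E)"
  proof -
    have "(\<lambda>z. F (?hi 4 (?hi 6 (z + 7 *\<^sub>R e)))) = sl (\<lambda>t. A (cut_off (- t + 1) / 2)) (\<lambda>_. 0) (\<lambda>t. - 1)"
      unfolding F_def sl_clamp_above sl_clamp_below sl_shift
    proof (rule slc)
      show "A (st (max 4 (max 6 (t + 7)))) = A (cut_off (- t + 1) / 2)" for t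
        by (rule arg_cong[of _ _ A]) (auto simp: st_def cut_off_def min_def max_def)
      show 2: "th (max 4 (max 6 (t + 7))) = - 1" for t
        by (auto simp: th_def cut_off_def min_def max_def)
      show "1 - \<bar>th (max 4 (max 6 (t + 7)))\<bar> = 0" for t
        unfolding 2 by simp
    qed
    moreover have "even (degree_inf (sl (\<lambda>t. A (cut_off (- t + 1) / 2)) (\<lambda>_. 0) (\<lambda>t. - 1))) \<longleftrightarrow> even (degree_inf ?E)"
    proof (rule even_degree_inf_flip[of "\<lambda>t. A (cut_off (t + 1) / 2)" "\<lambda>_. 1"])
      show "nonzero_outside (1 + 2 * B + r + 1) ?E"
        by (rule outside[of 1 "\<lambda>t. cut_off (t + 1) / 2"]) (auto simp: cut_off_def)
      show "continuous_on UNIV (\<lambda>(t, x). A (cut_off (t + 1) / 2) x)"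
        by (intro cB continuous_intros) auto
    qed (rule continuous_on_const)
    ultimately show ?thesis using degree_inf_translate[OF cc(4) o6(1), of "7 *\<^sub>R e"] by auto
  qed
  have "even (degree_inf (sl (\<lambda>t. A 0) hat ramp) + degree_inf ?E
      + (degree_inf (\<lambda>z. F (?hi 4 (?lo 6 z))) + degree_inf (\<lambda>z. F (?hi 4 (?hi 6 z)))))"
    using sum unfolding p1 p2 by (metis even_zero)
  then show ?thesis using p3 p4 by auto
qed

end

text \<open>The orthogonal complement of \<open>v\<close> times the \<open>p\<close>-space has
  dimension \<open>(k - 1) + p = n\<close>, so it is isometric to the
  \<open>n\<close>-space.\<close>

lemma exists_slice_chart:
  fixes v :: "real^'k"
  assumes v: "norm v = 1" and card: "CARD('k) \<ge> 2" "CARD('k) + CARD('p) = CARD('n) + 1"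
  obtains v' and T :: "real^'n \<Rightarrow> (real^'k) \<times> (real^'p)" and e where "slice_chart v v' T e"
proof -
  obtain y where y: "y \<noteq> 0" "orthogonal v y"
    using orthogonal_to_vector_exists[of v] card(1) by auto
  define v' where "v' = (1 / norm y) *\<^sub>R y"
  have v': "norm v' = 1" "v \<bullet> v' = 0" using y by (auto simp: v'_def orthogonal_def)
  define L where "L = {y. v \<bullet> y = 0} \<times> (UNIV :: (real^'p) set)"
  have L: "subspace L" unfolding L_def by (intro subspace_Times subspace_hyperplane subspace_UNIV)
  have "dim {y. v \<bullet> y = 0} = CARD('k) - 1"
    using v by (subst dim_hyperplane) auto
  then have "dim L = (CARD('k) - 1) + CARD('p)"
    unfolding L_def by (subst dim_Times) (simp_all only: subspace_hyperplane subspace_UNIV dim_UNIV DIM_cart DIM_real mult_1_right)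
  then have "dim (UNIV :: (real^'n) set) = dim L" using card by simp
  then obtain T g where T: "linear T" "T ` (UNIV :: (real^'n) set) = L" "\<And>x. norm (T x) = norm x"
    using isometries_subspaces[OF subspace_UNIV L] by (metis UNIV_I)
  have "(v', 0) \<in> L" using v' by (simp add: L_def)
  then obtain e where e: "T e = (v', 0)" using T(2) by (metis imageE)
  have "slice_chart v v' T e"
  proof
    show "v \<bullet> fst (T z) = 0" for z
    proof -
      have "T z \<in> L" using T(2) by blast
      then show ?thesis by (auto simp: L_def mem_Times_iff)
    qed
    show "(y, x) \<in> range T" if "v \<bullet> y = 0" for y x using T(2) that by (auto simp: L_def)
    show "CARD('n) > 1" using card zero_less_card_finite[where 'a='p] by linarith
  qed (use v v' T e in \<open>auto simp: linear_add linear_cmul\<close>)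
  then show ?thesis by (rule that)
qed

context slice_chart
begin

text \<open>The path is the segment from \<open>a0\<close> to \<open>a1\<close> plus a weighted
  generic matrix \<open>M\<close>. The weight vanishes at both ends of the path and off the open
  ball, where injectivity is given; elsewhere it is nonzero, and \<open>generic_perturbation\<close>
  supplies injectivity.\<close>

lemma even_degree_inf_slice:
  fixes a0 a1 :: "real^'p \<Rightarrow> real^'k^'n"
  assumes card: "CARD('k) + CARD('p) = CARD('n) + 1" and r: "r > 0"
    and c: "continuous_on UNIV a0" "continuous_on UNIV a1"
    and d: "\<And>x. norm x < r \<Longrightarrow> a0 differentiable (at x)" "\<And>x. norm x < r \<Longrightarrow> a1 differentiable (at x)"
    and agree: "\<And>x. norm x \<ge> r \<Longrightarrow> a0 x = a1 x"
    and injr: "\<And>x \<beta>. norm x \<ge> r \<Longrightarrow> \<beta> \<noteq> 0 \<Longrightarrow> a0 x *v \<beta> \<noteq> 0"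
    and inj: "\<And>x y. v \<bullet> y = 0 \<Longrightarrow> y \<noteq> 0 \<Longrightarrow> a0 x *v y \<noteq> 0" "\<And>x y. v \<bullet> y = 0 \<Longrightarrow> y \<noteq> 0 \<Longrightarrow> a1 x *v y \<noteq> 0"
  shows "even (degree_inf (\<lambda>z. a0 (snd (T z)) *v (v + fst (T z)))) \<longleftrightarrow>
    even (degree_inf (\<lambda>z. a1 (snd (T z)) *v (v + fst (T z))))"
proof -
  define V where "V = {y. v \<bullet> y = 0} \<inter> {y. v' \<bullet> y = 0}"
  have V: "subspace V" unfolding V_def by (intro subspace_inter subspace_hyperplane)
  have "v' \<in> {y. v \<bullet> y = 0} - V" using v_v' norm_v' by (auto simp: V_def dot_square_norm)
  then have "V \<noteq> {y. v \<bullet> y = 0}" by blast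
  then have "V \<subset> {y. v \<bullet> y = 0}" by (auto simp only: V_def)
  then have "dim V < dim {y. v \<bullet> y = 0}"
    by (intro dim_psubset) (metis span_eq_iff V subspace_hyperplane)
  also have "dim {y. v \<bullet> y = 0} = CARD('k) - 1"
    using norm_v by (subst dim_hyperplane) auto
  \<comment> \<open>Codimension two is exactly what the count allows:
    \<open>(k - 2) + p + 1 = n\<close>.\<close>
  finally have dV: "dim V + CARD('p) + 1 \<le> CARD('n)" using card by linarith
  define Dm where "Dm = {0<..<1::real} \<times> ball (0::real^'p) r"
  define b where "b q = (1 - fst q) *\<^sub>R a0 (snd q) + fst q *\<^sub>R a1 (snd q)" for q
  define g where "g q = fst q * (1 - fst q) * (r\<^sup>2 - snd q \<bullet> snd q)" for q :: "real \<times> (real^'p)"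
  have sq: "x \<bullet> x < r\<^sup>2" if "norm x < r" for x :: "real^'p"
    using that r by (simp add: dot_square_norm power_strict_mono)
  have dfst: "fst differentiable (at q)" and dsnd: "snd differentiable (at q)" for q :: "real \<times> (real^'p)"
    by (intro bounded_linear_imp_differentiable bounded_linear_fst bounded_linear_snd)+
  obtain M where M: "\<And>q y. q \<in> Dm \<Longrightarrow> y \<in> V \<Longrightarrow> y \<noteq> 0 \<Longrightarrow> (b q + g q *\<^sub>R M) *v y \<noteq> 0"
  proof (rule generic_perturbation[OF V dV, of Dm b g])
    fix q assume q: "q \<in> Dm"
    have n: "norm (snd q) < r" using q by (auto simp: Dm_def)
    have "(\<lambda>q. a0 (snd q)) differentiable (at q)" "(\<lambda>q. a1 (snd q)) differentiable (at q)"
      using differentiable_chain_at[OF dsnd d(1)[OF n]] differentiable_chain_at[OF dsnd d(2)[OF n]]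
      by (simp_all add: o_def)
    then show "b differentiable (at q)" unfolding b_def
      by (intro differentiable_add differentiable_scaleR differentiable_diff differentiable_const dfst)
    show "g differentiable (at q)" unfolding g_def
      by (intro differentiable_mult differentiable_diff differentiable_const dfst dsnd
          bounded_bilinear_differentiable[OF bounded_bilinear_inner])
    show "g q \<noteq> 0" using q sq[OF n] by (auto simp: g_def Dm_def)
  qed blast
  define A where "A s x = (1 - s) *\<^sub>R a0 x + s *\<^sub>R a1 x + (s * (1 - s) * max 0 (r\<^sup>2 - x \<bullet> x)) *\<^sub>R M" for s x
  have Aout: "A s x = a0 x" if "norm x \<ge> r" for s x
  proof -
    have "r\<^sup>2 \<le> x \<bullet> x" using that r by (simp add: dot_square_norm power_mono)
    then show ?thesis using agree[OF that] by (simp add: A_def flip: scaleR_add_left)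
  qed
  have A01: "A 0 = a0" "A 1 = a1" by (auto simp: A_def)
  have Ain: "A s x = b (s, x) + g (s, x) *\<^sub>R M" if "norm x < r" for s x
    using sq[OF that] by (simp add: A_def b_def g_def)
  have "even (degree_inf (sl (\<lambda>t. A 0) hat ramp)) \<longleftrightarrow> even (degree_inf (sl (\<lambda>t. A 1) hat ramp))"
  proof (rule even_degree_inf_ends[of A r])
    show "continuous_on UNIV (\<lambda>(s, x). A s x)"
      unfolding A_def case_prod_unfold
      by (intro continuous_intros continuous_on_compose2[OF c(1)] continuous_on_compose2[OF c(2)]) auto
    fix s :: real and x y assume s: "0 \<le> s" "s \<le> 1" and y: "v \<bullet> y = 0" "v' \<bullet> y = 0" "y \<noteq> 0"
    show "A s x *v y \<noteq> 0"
    proof (cases "norm x < r \<and> 0 < s \<and> s < 1")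
      case True
      then show ?thesis using M[of "(s, x)" y] y Ain[of x s] by (auto simp: Dm_def V_def)
    next
      case False
      then consider "norm x \<ge> r" | "s = 0" | "s = 1" using s by linarith
      then show ?thesis using Aout[of x s] injr[of x y] A01 inj y by cases auto
    qed
  next
    show "0 \<le> r" using r by simp
    show "A s x *v \<beta> \<noteq> 0" if "r \<le> norm x" "\<beta> \<noteq> 0" for s x \<beta>
      using Aout[OF that(1)] injr[OF that] by simp
    show "A s x *v y \<noteq> 0" if "s = 0 \<or> s = 1" "v \<bullet> y = 0" "y \<noteq> 0" for s x y
      using that(1) A01 inj[OF that(2,3), of x] by auto
  qed
  moreover have "degree_inf (\<lambda>z. a0 (snd (T z)) *v (v + fst (T z))) = degree_inf (sl (\<lambda>t. a0) hat ramp)"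
    using r injr inj by (intro degree_inf_hat_ramp[OF c(1), of r]) auto
  moreover have "degree_inf (\<lambda>z. a1 (snd (T z)) *v (v + fst (T z))) = degree_inf (sl (\<lambda>t. a1) hat ramp)"
  proof (rule degree_inf_hat_ramp[OF c(2), of r])
    show "a1 x *v \<beta> \<noteq> 0" if "norm x \<ge> r" "\<beta> \<noteq> 0" for x \<beta>
      using injr[OF that] agree[OF that(1)] by simp
  qed (use r inj in auto)
  ultimately show ?thesis unfolding A01 by simp
qed

end

section \<open>Calculus of \<open>C\<^sup>k\<close> mappings\<close>

lemma has_derivative_cong_open:
  assumes "open U" "x \<in> U" "\<And>y. y \<in> U \<Longrightarrow> f y = g y"
  shows "(f has_derivative D) (at x) \<longleftrightarrow> (g has_derivative D) (at x)"
  using has_derivative_transform_within_open[OF _ assms(1,2), of f D UNIV g]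
    has_derivative_transform_within_open[OF _ assms(1,2), of g D UNIV f] assms(3) by metis

lemma frechet_derivative_cong_open:
  assumes "open U" "x \<in> U" "\<And>y. y \<in> U \<Longrightarrow> f y = g y"
  shows "f differentiable (at x) \<longleftrightarrow> g differentiable (at x)"
    and "frechet_derivative f (at x) = frechet_derivative g (at x)"
  using has_derivative_cong_open[OF assms]
  by (simp_all add: differentiable_def frechet_derivative_def)

text \<open>A derivative at a point depends on a full neighbourhood, so it is openness of
  \<open>U\<close> that lets the equality pass through the recursion.\<close>

lemma Ck_on_cong:
  assumes "open U" "\<And>y. y \<in> U \<Longrightarrow> f y = g y"
  shows "Ck_on k U f \<longleftrightarrow> Ck_on k U g"
  using assms(2)
proof (induction k arbitrary: f g)
  case 0
  then show ?case by (auto intro: continuous_on_cong)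
next
  case (Suc k)
  have "Ck_on k U (\<lambda>x. frechet_derivative f (at x) v) \<longleftrightarrow> Ck_on k U (\<lambda>x. frechet_derivative g (at x) v)" for v
    by (rule Suc.IH) (use frechet_derivative_cong_open(2)[OF assms(1) _ Suc.prems] in simp)
  moreover have "f differentiable (at x) \<longleftrightarrow> g differentiable (at x)" if "x \<in> U" for x
    by (rule frechet_derivative_cong_open(1)[OF assms(1) that Suc.prems])
  ultimately show ?case by simp
qed

lemma Ck_on_subset: "Ck_on k U f \<Longrightarrow> S \<subseteq> U \<Longrightarrow> Ck_on k S f"
  by (induction k arbitrary: f) (auto intro: continuous_on_subset)

lemma Ck_on_local:
  assumes "\<And>x. x \<in> S \<Longrightarrow> \<exists>U. open U \<and> x \<in> U \<and> Ck_on k U f"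
  shows "Ck_on k S f"
  using assms
proof (induction k arbitrary: f)
  case 0
  show ?case
    unfolding Ck_on.simps
  proof (rule continuous_at_imp_continuous_on, rule ballI)
    fix x assume "x \<in> S"
    from 0[OF this] show "isCont f x" by (auto simp: continuous_on_eq_continuous_at)
  qed
next
  case (Suc k)
  have "Ck_on k S (\<lambda>x. frechet_derivative f (at x) v)" for v
    by (rule Suc.IH) (use Suc.prems in force)
  then show ?case using Suc.prems by force
qed

lemma Ck_on_Suc_D: "Ck_on (Suc k) U f \<Longrightarrow> Ck_on k U f"
proof (induction k arbitrary: f)
  case 0
  then show ?case
    by (auto intro!: continuous_at_imp_continuous_on differentiable_imp_continuous_within)
next
  case (Suc k)
  then show ?case by (metis Ck_on.simps(2))
qed

lemma Ck_on_Suc_I: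
  assumes "open U" "\<And>x. x \<in> U \<Longrightarrow> (f has_derivative D x) (at x)" "\<And>v. Ck_on k U (\<lambda>x. D x v)"
  shows "Ck_on (Suc k) U f"
proof -
  have "frechet_derivative f (at x) = D x" if "x \<in> U" for x
    using frechet_derivative_at[OF assms(2)[OF that]] by simp
  then have "Ck_on k U (\<lambda>x. frechet_derivative f (at x) v)" for v
    using Ck_on_cong[OF assms(1), of "\<lambda>x. frechet_derivative f (at x) v" "\<lambda>x. D x v" k] assms(3) by simp
  then show ?thesis using assms(2) by (auto simp: differentiable_def)
qed

lemma Ck_on_Suc_deriv:
  assumes "Ck_on (Suc k) U f" "x \<in> U"
  shows "(f has_derivative frechet_derivative f (at x)) (at x)"
  using assms by (auto simp: frechet_derivative_works[symmetric])

lemma Ck_on_const: "Ck_on k U (\<lambda>x. c)"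
  by (induction k arbitrary: c) auto

lemma Ck_on_bounded_linear: "bounded_linear f \<Longrightarrow> Ck_on k U f"
proof (cases k)
  case (Suc j)
  assume f: "bounded_linear f"
  have "frechet_derivative f (at x) = f" for x
    using frechet_derivative_at[OF bounded_linear_imp_has_derivative[OF f]] by simp
  then show ?thesis
    using f by (simp add: Suc Ck_on_const bounded_linear_imp_differentiable)
qed (simp add: linear_continuous_on)

lemma Ck_on_compose_linear:
  assumes "open U" "bounded_linear L"
  shows "Ck_on k U f \<Longrightarrow> Ck_on k U (\<lambda>x. L (f x))"
proof (induction k arbitrary: f)
  case 0
  then show ?case using bounded_linear.continuous_on[OF assms(2)] by simp
next
  case (Suc k)
  show ?case
  proof (rule Ck_on_Suc_I[OF assms(1)])
    show "((\<lambda>x. L (f x)) has_derivative (\<lambda>v. L (frechet_derivative f (at x) v))) (at x)" if "x \<in> U" for x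
      using bounded_linear.has_derivative[OF assms(2) Ck_on_Suc_deriv[OF Suc.prems that]] .
  qed (use Suc in simp)
qed

lemma Ck_on_add:
  assumes "open U"
  shows "Ck_on k U f \<Longrightarrow> Ck_on k U g \<Longrightarrow> Ck_on k U (\<lambda>x. f x + g x)"
proof (induction k arbitrary: f g)
  case 0
  then show ?case by (simp add: continuous_on_add)
next
  case (Suc k)
  show ?case
  proof (rule Ck_on_Suc_I[OF assms])
    show "((\<lambda>x. f x + g x) has_derivative (\<lambda>v. frechet_derivative f (at x) v + frechet_derivative g (at x) v)) (at x)" if "x \<in> U" for x
      using Suc.prems that by (intro has_derivative_add Ck_on_Suc_deriv)
  qed (use Suc in simp)
qed

lemma Ck_on_sum:
  assumes "open U" "\<And>i. i \<in> I \<Longrightarrow> Ck_on k U (f i)"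
  shows "Ck_on k U (\<lambda>x. \<Sum>i\<in>I. f i x)"
  using assms(2)
  by (induction I rule: infinite_finite_induct) (auto intro: Ck_on_add[OF assms(1)] Ck_on_const)

lemma Ck_on_bilinear:
  assumes "open U" "bounded_bilinear p"
  shows "Ck_on k U f \<Longrightarrow> Ck_on k U g \<Longrightarrow> Ck_on k U (\<lambda>x. p (f x) (g x))"
proof (induction k arbitrary: f g)
  case 0
  then show ?case using bounded_bilinear.continuous_on[OF assms(2)] by simp
next
  case (Suc k)
  show ?case
  proof (rule Ck_on_Suc_I[OF assms(1)])
    show "((\<lambda>x. p (f x) (g x)) has_derivative
       (\<lambda>v. p (f x) (frechet_derivative g (at x) v) + p (frechet_derivative f (at x) v) (g x))) (at x)" if "x \<in> U" for x
      using Suc.prems that by (intro bounded_bilinear.FDERIV[OF assms(2)] Ck_on_Suc_deriv)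
    show "Ck_on k U (\<lambda>x. p (f x) (frechet_derivative g (at x) v) + p (frechet_derivative f (at x) v) (g x))" for v
    proof -
      have "Ck_on k U (\<lambda>x. frechet_derivative f (at x) v)" "Ck_on k U (\<lambda>x. frechet_derivative g (at x) v)"
        using Suc.prems by simp_all
      with Ck_on_Suc_D[OF Suc.prems(1)] Ck_on_Suc_D[OF Suc.prems(2)] show ?thesis
        by (intro Ck_on_add[OF assms(1)] Suc.IH)
    qed
  qed
qed

text \<open>The derivative is built from that of \<open>f\<close> and from the same inverse, needed
  one order lower, so the induction closes.\<close>

lemma Ck_on_inverse:
  fixes f :: "'a::euclidean_space \<Rightarrow> real"
  assumes "open U" "\<And>x. x \<in> U \<Longrightarrow> f x \<noteq> 0"
  shows "Ck_on k U f \<Longrightarrow> Ck_on k U (\<lambda>x. inverse (f x))"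
proof (induction k)
  case 0
  then show ?case using assms by (auto intro: continuous_on_inverse)
next
  case (Suc k)
  note mult = Ck_on_bilinear[OF assms(1) bounded_bilinear_mult]
  show ?case
  proof (rule Ck_on_Suc_I[OF assms(1)])
    show "((\<lambda>x. inverse (f x)) has_derivative (\<lambda>v. - (inverse (f x) * frechet_derivative f (at x) v * inverse (f x)))) (at x)"
      if "x \<in> U" for x
      using Suc.prems that assms(2) by (intro Deriv.has_derivative_inverse Ck_on_Suc_deriv)
    show "Ck_on k U (\<lambda>x. - (inverse (f x) * frechet_derivative f (at x) v * inverse (f x)))" for v
    proof -
      have "Ck_on k U (\<lambda>x. frechet_derivative f (at x) v)" using Suc.prems by simp
      with Suc.IH[OF Ck_on_Suc_D[OF Suc.prems]] show ?thesis
        by (intro Ck_on_compose_linear[OF assms(1) bounded_linear_minus[OF bounded_linear_ident]] mult)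
    qed
  qed
qed

text \<open>The derivative involves the inverse of the same root, again one order lower.\<close>

lemma Ck_on_sqrt:
  fixes f :: "'a::euclidean_space \<Rightarrow> real"
  assumes "open U" "\<And>x. x \<in> U \<Longrightarrow> f x > 0"
  shows "Ck_on k U f \<Longrightarrow> Ck_on k U (\<lambda>x. sqrt (f x))"
proof (induction k)
  case 0
  then show ?case by (auto intro: continuous_intros)
next
  case (Suc k)
  note mult = Ck_on_bilinear[OF assms(1) bounded_bilinear_mult]
  show ?case
  proof (rule Ck_on_Suc_I[OF assms(1)])
    show "((\<lambda>x. sqrt (f x)) has_derivative (\<lambda>v. (1/2) * (frechet_derivative f (at x) v * inverse (sqrt (f x))))) (at x)"
      if "x \<in> U" for x
      using has_derivative_real_sqrt[OF assms(2)[OF that] Ck_on_Suc_deriv[OF Suc.prems that]]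
      by (simp add: field_simps)
    show "Ck_on k U (\<lambda>x. (1/2) * (frechet_derivative f (at x) v * inverse (sqrt (f x))))" for v
    proof -
      have "Ck_on k U (\<lambda>x. frechet_derivative f (at x) v)" using Suc.prems by simp
      moreover have "Ck_on k U (\<lambda>x. inverse (sqrt (f x)))"
        using assms(2) by (intro Ck_on_inverse[OF assms(1)] Suc.IH[OF Ck_on_Suc_D[OF Suc.prems]]) force
      ultimately show ?thesis by (intro mult Ck_on_const)
    qed
  qed
qed

lemma Ck_on_Pair:
  assumes "open U" "Ck_on k U f" "Ck_on k U g"
  shows "Ck_on k U (\<lambda>x. (f x, g x))"
proof -
  have "bounded_linear (\<lambda>y::'b. (y, 0::'c))" "bounded_linear (\<lambda>y::'c. (0::'b, y))"
    by (intro bounded_linear_Pair bounded_linear_ident bounded_linear_zero)+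
  then have "Ck_on k U (\<lambda>x. (f x, 0) + (0, g x))"
    using assms by (intro Ck_on_add Ck_on_compose_linear[where L="\<lambda>y. (y, 0)"] Ck_on_compose_linear[where L="\<lambda>y. (0, y)"])
  then show ?thesis by simp
qed

section \<open>Smooth mappings on arbitrary sets\<close>

lemma smooth_on_open_Ck:
  assumes "open U" "smooth_on U f"
  shows "Ck_on k U f"
proof (rule Ck_on_local)
  fix x assume "x \<in> U"
  then obtain V g where V: "open V" "x \<in> V" "Ck_on k V g" "\<And>y. y \<in> U \<inter> V \<Longrightarrow> g y = f y"
    using assms(2) unfolding smooth_on_def by metis
  have "Ck_on k (U \<inter> V) g" using V(3) by (rule Ck_on_subset) auto
  then have "Ck_on k (U \<inter> V) f"
    using Ck_on_cong[of "U \<inter> V" g f k] V assms(1) by auto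
  then show "\<exists>W. open W \<and> x \<in> W \<and> Ck_on k W f"
    using V assms(1) \<open>x \<in> U\<close> by (intro exI[of _ "U \<inter> V"]) auto
qed

lemma Ck_smooth_on:
  assumes "open U" "S \<subseteq> U" "\<And>k. Ck_on k U f"
  shows "smooth_on S f"
  using assms unfolding smooth_on_def by blast

lemma smooth_on_cong: "smooth_on S f \<Longrightarrow> (\<And>x. x \<in> S \<Longrightarrow> f x = g x) \<Longrightarrow> smooth_on S g"
  unfolding smooth_on_def by (metis IntD1)

lemma smooth_on_imp_local_extension:
  assumes "smooth_on S f" "x \<in> S"
  obtains U g where "open U" "x \<in> U" "\<And>y. y \<in> U \<Longrightarrow> g differentiable (at y)" "continuous_on U g" "\<And>y. y \<in> S \<inter> U \<Longrightarrow> g y = f y"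
proof -
  obtain U g where U: "open U" "x \<in> U" "\<And>k. Ck_on k U g" "\<And>y. y \<in> S \<inter> U \<Longrightarrow> g y = f y"
    using assms unfolding smooth_on_def by metis
  show ?thesis
    by (rule that[OF U(1,2) _ _ U(4)]) (use U(3)[of "Suc 0"] U(3)[of 0] in auto)
qed

lemma smooth_on_continuous_on:
  assumes "smooth_on S f"
  shows "continuous_on S f"
  unfolding continuous_on_eq_continuous_within
proof
  fix x assume x: "x \<in> S"
  obtain U g where U: "open U" "x \<in> U" "continuous_on U g" "\<And>y. y \<in> S \<inter> U \<Longrightarrow> g y = f y"
    using smooth_on_imp_local_extension[OF assms x] by metis
  have "continuous_on (S \<inter> U) g" using U(3) by (rule continuous_on_subset) auto
  then have "continuous_on (S \<inter> U) f" using U(4) by (rule continuous_on_eq)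
  then have "continuous (at x within S \<inter> U) f" using x U by (simp add: continuous_on_eq_continuous_within)
  moreover have "at x within S \<inter> U = at x within S"
    by (rule at_within_nhd[OF U(2,1)]) auto
  ultimately show "continuous (at x within S) f" by simp
qed

lemma smooth_on_differentiable:
  assumes "smooth_on S f" "x \<in> interior S"
  shows "f differentiable (at x)"
proof -
  obtain U g where U: "open U" "x \<in> U" "\<And>y. y \<in> U \<Longrightarrow> g differentiable (at y)" "\<And>y. y \<in> S \<inter> U \<Longrightarrow> g y = f y"
    using smooth_on_imp_local_extension[OF assms(1) subsetD[OF interior_subset assms(2)]] by metis
  have "open (U \<inter> interior S)" "x \<in> U \<inter> interior S" using U assms(2) by auto
  moreover have "g y = f y" if "y \<in> U \<inter> interior S" for y using that U(4) interior_subset by blast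
  ultimately show ?thesis using frechet_derivative_cong_open(1)[of "U \<inter> interior S" x g f] U(2,3) by blast
qed

section \<open>Local degrees on \<open>S\<^sup>k\<^sup>-\<^sup>1 \<times> \<real>\<^sup>p\<close>\<close>

lemma tilde_eq: "tilde a q = a (snd q) *v fst q"
  by (simp add: tilde_def case_prod_unfold matrix_mult_sum scalar_mult_eq_scaleR)

lemma has_derivative_eq_on_nhd:
  assumes "(f has_derivative D) (at x)" "(g has_derivative E) (at x)" "open U" "x \<in> U" "\<And>y. y \<in> U \<Longrightarrow> f y = g y"
  shows "D = E"
proof -
  have "(f has_derivative E) (at x)"
    using has_derivative_cong_open[OF assms(3,4), of f g E] assms(2,5) by blast
  with assms(1) show ?thesis by (rule has_derivative_unique)
qed

text \<open>The image may have empty interior, so the inverse is smooth only through local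
  extensions \<open>G\<close>. The chain rule for \<open>G (\<phi> u) = u\<close> still exhibits a
  left inverse of the derivative.\<close>

lemma diffeo_onto_image_derivative:
  fixes \<phi> :: "'a::euclidean_space \<Rightarrow> 'b::euclidean_space"
  assumes U: "open U" "p \<in> U" "diffeo_onto_image U \<phi>"
  shows "\<And>k. Ck_on k U \<phi>" "linear (frechet_derivative \<phi> (at p))" "inj (frechet_derivative \<phi> (at p))"
proof -
  show C: "Ck_on k U \<phi>" for k
    using U by (auto simp: diffeo_onto_image_def intro: smooth_on_open_Ck)
  have D: "(\<phi> has_derivative frechet_derivative \<phi> (at p)) (at p)"
    using Ck_on_Suc_deriv[OF C U(2)] .
  then show "linear (frechet_derivative \<phi> (at p))" by (rule has_derivative_linear)
  have "smooth_on (\<phi> ` U) (inv_into U \<phi>)" using U(3) by (simp add: diffeo_onto_image_def)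
  then obtain W G where W: "open W" "\<phi> p \<in> W" "\<And>y. y \<in> W \<Longrightarrow> G differentiable (at y)"
    "\<And>y. y \<in> \<phi> ` U \<inter> W \<Longrightarrow> G y = inv_into U \<phi> y"
    using smooth_on_imp_local_extension[of "\<phi> ` U" "inv_into U \<phi>" "\<phi> p"] U(2) by (metis imageI)
  obtain G' where G': "(G has_derivative G') (at (\<phi> p))"
    using W(3)[OF W(2)] unfolding differentiable_def by blast
  have "continuous_on U \<phi>" using C[of 0] by simp
  then have "open (\<phi> -` W \<inter> U)" using continuous_on_open_vimage[OF U(1)] W(1) by blast
  moreover have "G (\<phi> u) = u" if "u \<in> \<phi> -` W \<inter> U" for u
    using W(4)[of "\<phi> u"] that U(3) by (auto simp: diffeo_onto_image_def)
  ultimately have "(\<lambda>u. G' (frechet_derivative \<phi> (at p) u)) = (\<lambda>u. u)"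
    using W(2) U(2)
    by (intro has_derivative_eq_on_nhd[OF has_derivative_compose[OF D G'] has_derivative_ident, of "\<phi> -` W \<inter> U"]) auto
  then show "inj (frechet_derivative \<phi> (at p))" by (metis injI)
qed

section \<open>Central projection charts of the two hemispheres\<close>

context slice_chart
begin

text \<open>This inverts the central projection of a hemisphere to the tangent space at
  \<open>v\<close>; \<open>\<sigma> = -1\<close> adds the antipode and covers the opposite
  hemisphere. The norm is spelled out as a root of an inner product so that the \<open>Ck_on\<close>
  rules apply.\<close>

definition hemi :: "real \<Rightarrow> real^'n \<Rightarrow> (real^'k) \<times> (real^'p)" where
  "hemi \<sigma> z = ((\<sigma> * inverse (sqrt ((v + fst (T z)) \<bullet> (v + fst (T z))))) *\<^sub>R (v + fst (T z)), snd (T z))"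

text \<open>Dividing by \<open>v \<bullet> \<beta>\<close> cancels a sign of \<open>\<beta>\<close>,
  so one formula, meaningful off the equator, inverts both \<open>hemi 1\<close> and
  \<open>hemi (- 1)\<close>.\<close>

definition hemi_inv :: "(real^'k) \<times> (real^'p) \<Rightarrow> real^'n" where
  "hemi_inv q = T_inv (inverse (v \<bullet> fst q) *\<^sub>R fst q - v, snd q)"

lemma pole_plus: "v \<bullet> (v + fst (T z)) = 1" "v + fst (T z) \<noteq> 0"
proof -
  show 1: "v \<bullet> (v + fst (T z)) = 1" by (simp add: inner_add_right fst_T dot_square_norm norm_v)
  then show "v + fst (T z) \<noteq> 0" by force
qed

lemma hemi_eq: "hemi \<sigma> z = ((\<sigma> / norm (v + fst (T z))) *\<^sub>R (v + fst (T z)), snd (T z))"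
  by (simp add: hemi_def norm_eq_sqrt_inner divide_inverse)

lemma v_hemi: "v \<bullet> fst (hemi \<sigma> z) = \<sigma> / norm (v + fst (T z))"
  by (simp add: hemi_eq pole_plus)

lemma hemi_sphere:
  assumes "\<bar>\<sigma>\<bar> = 1"
  shows "norm (fst (hemi \<sigma> z)) = 1" "\<sigma> * (v \<bullet> fst (hemi \<sigma> z)) > 0" "v \<bullet> fst (hemi \<sigma> z) \<noteq> 0"
proof -
  have n: "norm (v + fst (T z)) > 0" using pole_plus by simp
  have "\<sigma> * \<sigma> = 1" using assms by (metis abs_mult_self_eq mult.right_neutral)
  then show "\<sigma> * (v \<bullet> fst (hemi \<sigma> z)) > 0" using n by (simp add: v_hemi)
  then show "v \<bullet> fst (hemi \<sigma> z) \<noteq> 0" by auto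
  show "norm (fst (hemi \<sigma> z)) = 1" using n assms by (simp add: hemi_eq)
qed

lemma hemi_inv_hemi: "\<bar>\<sigma>\<bar> = 1 \<Longrightarrow> hemi_inv (hemi \<sigma> z) = z"
proof -
  assume s: "\<bar>\<sigma>\<bar> = 1"
  have "norm (v + fst (T z)) > 0" using pole_plus by simp
  then have "inverse (v \<bullet> fst (hemi \<sigma> z)) *\<^sub>R fst (hemi \<sigma> z) = v + fst (T z)"
    unfolding v_hemi using s by (auto simp: hemi_eq)
  then show "hemi_inv (hemi \<sigma> z) = z" by (simp add: hemi_inv_def T_inv(2)) (simp add: hemi_eq T_inv(2))
qed

lemma hemi_hemi_inv:
  assumes "\<bar>\<sigma>\<bar> = 1" "norm (fst q) = 1" "\<sigma> * (v \<bullet> fst q) > 0"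
  shows "hemi \<sigma> (hemi_inv q) = q"
proof -
  let ?c = "v \<bullet> fst q"
  have c: "?c \<noteq> 0" using assms(3) by auto
  have "v \<bullet> (inverse ?c *\<^sub>R fst q - v) = 0"
    using c by (simp add: inner_diff_right dot_square_norm norm_v)
  then have T: "T (hemi_inv q) = (inverse ?c *\<^sub>R fst q - v, snd q)"
    unfolding hemi_inv_def by (rule T_T_inv)
  have "\<sigma> / norm (inverse ?c *\<^sub>R fst q) = ?c"
    using assms by (auto simp: abs_if zero_less_mult_iff field_simps split: if_splits)
  then show ?thesis
    using c by (simp add: hemi_eq T prod_eq_iff)
qed

lemma Ck_on_T: "Ck_on k U (\<lambda>z. T (z0 + z))" if "open U"
proof -
  have "Ck_on k U (\<lambda>z. T z0 + T z)"
    by (intro Ck_on_add[OF that] Ck_on_const Ck_on_bounded_linear) (use linear_T in \<open>simp add: linear_conv_bounded_linear\<close>)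
  then show ?thesis by (simp add: T_add)
qed

lemma Ck_on_hemi: "Ck_on k UNIV (\<lambda>z. hemi \<sigma> (z0 + z))"
proof -
  have w: "Ck_on k UNIV (\<lambda>z. v + fst (T (z0 + z)))"
    by (intro Ck_on_add Ck_on_const Ck_on_compose_linear[OF _ bounded_linear_fst] Ck_on_T open_UNIV)
  have i: "Ck_on k UNIV (\<lambda>z. inverse (sqrt ((v + fst (T (z0 + z))) \<bullet> (v + fst (T (z0 + z))))))"
    using pole_plus(2)
    by (intro Ck_on_inverse Ck_on_sqrt Ck_on_bilinear[OF open_UNIV bounded_bilinear_inner] w open_UNIV) auto
  show ?thesis unfolding hemi_def
    by (intro Ck_on_Pair open_UNIV Ck_on_bilinear[OF open_UNIV bounded_bilinear_scaleR]
        Ck_on_bilinear[OF open_UNIV bounded_bilinear_mult] Ck_on_const i w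
        Ck_on_compose_linear[OF _ bounded_linear_snd] Ck_on_T)
qed

lemma open_off_equator: "open {q::(real^'k) \<times> (real^'p). v \<bullet> fst q \<noteq> 0}"
  by (intro open_Collect_neq continuous_intros)

lemma Ck_on_hemi_inv: "Ck_on k {q. v \<bullet> fst q \<noteq> 0} (\<lambda>q. hemi_inv q - z0)"
proof -
  let ?U = "{q::(real^'k) \<times> (real^'p). v \<bullet> fst q \<noteq> 0}"
  note U = open_off_equator
  have f: "Ck_on k ?U fst" and s: "Ck_on k ?U snd"
    by (intro Ck_on_bounded_linear bounded_linear_fst bounded_linear_snd)+
  have vf: "Ck_on k ?U (\<lambda>q. v \<bullet> fst q)"
    by (intro Ck_on_bilinear[OF U bounded_bilinear_inner] Ck_on_const f)
  have "Ck_on k ?U (\<lambda>q. (inverse (v \<bullet> fst q) *\<^sub>R fst q + (- v), snd q))"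
    by (intro Ck_on_Pair U Ck_on_add Ck_on_const Ck_on_bilinear[OF U bounded_bilinear_scaleR] f s Ck_on_inverse[OF U _ vf]) auto
  then have "Ck_on k ?U (\<lambda>q. T_inv (inverse (v \<bullet> fst q) *\<^sub>R fst q + (- v), snd q) + (- z0))"
    using T_inv(1) by (intro Ck_on_add U Ck_on_const Ck_on_compose_linear[where L=T_inv])
      (simp_all add: linear_conv_bounded_linear)
  then show ?thesis by (simp add: hemi_inv_def)
qed

lemma local_param_hemi:
  assumes \<sigma>: "\<bar>\<sigma>\<bar> = 1"
  shows "local_param (\<lambda>z. hemi \<sigma> (z0 + z)) (hemi \<sigma> z0)"
  unfolding local_param_def
proof (intro exI[of _ UNIV] conjI)
  let ?\<phi> = "\<lambda>z. hemi \<sigma> (z0 + z)"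
  have inj: "inj ?\<phi>"
    by (rule inj_on_inverseI[where g="\<lambda>q. hemi_inv q - z0"]) (simp add: hemi_inv_hemi[OF \<sigma>])
  show "diffeo_onto_image UNIV ?\<phi>"
    unfolding diffeo_onto_image_def
  proof (intro conjI inj)
    show "smooth_on UNIV ?\<phi>" by (rule Ck_smooth_on[OF open_UNIV]) (auto intro: Ck_on_hemi)
    have "smooth_on (range ?\<phi>) (\<lambda>q. hemi_inv q - z0)"
      by (rule Ck_smooth_on[OF open_off_equator]) (use hemi_sphere(3)[OF \<sigma>] Ck_on_hemi_inv in auto)
    then show "smooth_on (range ?\<phi>) (inv_into UNIV ?\<phi>)"
    proof (rule smooth_on_cong)
      fix q assume "q \<in> range ?\<phi>"
      then obtain z where "q = ?\<phi> z" by blast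
      then show "hemi_inv q - z0 = inv_into UNIV ?\<phi> q"
        using inv_f_f[OF inj, of z] by (simp add: hemi_inv_hemi[OF \<sigma>])
    qed
  qed
  have "range ?\<phi> = (sphere 0 1 \<times> UNIV) \<inter> {q. \<sigma> * (v \<bullet> fst q) > 0}"
  proof (intro equalityI subsetI)
    fix q :: "(real^'k) \<times> (real^'p)" assume q: "q \<in> (sphere 0 1 \<times> UNIV) \<inter> {q. \<sigma> * (v \<bullet> fst q) > 0}"
    then have "hemi \<sigma> (hemi_inv q) = q" by (intro hemi_hemi_inv[OF \<sigma>]) auto
    then have "q = ?\<phi> (hemi_inv q - z0)" by simp
    then show "q \<in> range ?\<phi>" by blast
  qed (use hemi_sphere[OF \<sigma>] in \<open>auto simp: mem_Times_iff\<close>)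
  moreover have "open {q::(real^'k) \<times> (real^'p). \<sigma> * (v \<bullet> fst q) > 0}"
    by (intro open_Collect_less continuous_intros)
  ultimately show "openin (top_of_set (sphere 0 1 \<times> UNIV)) (range ?\<phi>)"
    by (auto simp: openin_open)
qed auto

lemma even_manifold_degree:
  fixes a :: "real^'p \<Rightarrow> real^'k^'n"
  assumes \<sigma>: "\<bar>\<sigma>\<bar> = 1" and "\<epsilon> > 0" and F: "continuous_on (cball z0 \<epsilon>) F"
    and nz: "\<And>z. z \<in> cball z0 \<epsilon> \<Longrightarrow> z \<noteq> z0 \<Longrightarrow> F z \<noteq> 0"
    and Fa: "\<And>z. z \<in> cball z0 \<epsilon> \<Longrightarrow> F z = a (snd (T z)) *v (v + fst (T z))"
  shows "even (manifold_degree (tilde a) (hemi \<sigma> z0)) \<longleftrightarrow> even (local_degree F z0)"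
proof -
  have main: "even (local_degree (tilde a \<circ> \<phi>) 0) \<longleftrightarrow> even (local_degree F z0)"
    if lp: "local_param \<phi> (hemi \<sigma> z0)" for \<phi> :: "real^'n \<Rightarrow> (real^'k) \<times> (real^'p)"
  proof -
    obtain U where U: "open U" "0 \<in> U" "\<phi> 0 = hemi \<sigma> z0" "diffeo_onto_image U \<phi>"
      "openin (top_of_set (sphere 0 1 \<times> UNIV)) (\<phi> ` U)"
      using lp unfolding local_param_def by blast
    note \<phi> = diffeo_onto_image_derivative[OF U(1,2,4)]
    have \<phi>c: "continuous_on U \<phi>" using \<phi>(1)[of 0] by simp
    have \<phi>d: "\<phi> differentiable (at 0)" using \<phi>(1)[of "Suc 0"] U(2) by simp
    have sph: "norm (fst (\<phi> u)) = 1" if "u \<in> U" for u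
      using openin_imp_subset[OF U(5)] that by (auto simp: mem_Times_iff dest!: subsetD[where c="\<phi> u"])
    define D where "D = {q::(real^'k) \<times> (real^'p). \<sigma> * (v \<bullet> fst q) > 0}"
    have oD: "open D" unfolding D_def by (intro open_Collect_less continuous_intros)
    have "open (\<phi> -` D \<inter> U)" using continuous_on_open_vimage[OF U(1)] \<phi>c oD by blast
    moreover have "0 \<in> \<phi> -` D \<inter> U" using U(2,3) hemi_sphere(2)[OF \<sigma>] by (simp add: D_def)
    ultimately obtain \<delta> where \<delta>: "\<delta> > 0" "ball 0 \<delta> \<subseteq> \<phi> -` D \<inter> U"
      by (meson open_contains_ball)
    define q where "q u = hemi_inv (\<phi> u) - z0" for u
    have hq: "hemi \<sigma> (z0 + q u) = \<phi> u" if "u \<in> ball 0 \<delta>" for u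
    proof -
      have "u \<in> \<phi> -` D \<inter> U" using \<delta>(2) that by blast
      then show ?thesis using hemi_hemi_inv[OF \<sigma> sph, of u] by (simp add: q_def D_def)
    qed
    have q0: "q 0 = 0" by (simp add: q_def U(3) hemi_inv_hemi[OF \<sigma>])
    have DO: "D \<subseteq> {q. v \<bullet> fst q \<noteq> 0}" by (auto simp: D_def)
    have hi: "continuous_on D (\<lambda>q. hemi_inv q - z0)"
      using Ck_on_hemi_inv[of 0 z0] continuous_on_subset[OF _ DO] by simp
    have qc: "continuous_on (ball 0 \<delta>) q" unfolding q_def
      by (rule continuous_on_compose2[OF hi continuous_on_subset[OF \<phi>c]]) (use \<delta> in auto)
    have "\<phi> 0 \<in> {q. v \<bullet> fst q \<noteq> 0}" using hemi_sphere(3)[OF \<sigma>] by (simp add: U(3))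
    then have "(\<lambda>q. hemi_inv q - z0) differentiable (at (\<phi> 0))"
      using Ck_on_hemi_inv[of "Suc 0" z0] unfolding Ck_on.simps by blast
    then have "q differentiable (at 0)"
      using differentiable_chain_at[OF \<phi>d] by (simp add: q_def[abs_def] o_def)
    then obtain A where A: "(q has_derivative A) (at 0)" by (auto simp: differentiable_def)
    \<comment> \<open>Near 0 the map \<open>\<phi>\<close> factors through \<open>q\<close>, so a
      kernel vector of \<open>A\<close> would be one of the derivative of
      \<open>\<phi>\<close>.\<close>
    have injA: "inj A"
    proof -
      have "(\<lambda>z. hemi \<sigma> (z0 + z)) differentiable (at (q 0))"
        using Ck_on_hemi[of "Suc 0" \<sigma> z0] by simp
      then obtain P where P: "((\<lambda>z. hemi \<sigma> (z0 + z)) has_derivative P) (at (q 0))"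
        by (auto simp: differentiable_def)
      have "frechet_derivative \<phi> (at 0) = (\<lambda>u. P (A u))"
        by (rule has_derivative_eq_on_nhd[OF Ck_on_Suc_deriv[OF \<phi>(1) U(2)] has_derivative_compose[OF A P], of "ball 0 \<delta>"])
          (use \<delta> hq in auto)
      then show ?thesis using \<phi>(3) by (auto simp: inj_def)
    qed
    define g where "g y = F (z0 + y)" for y
    have gc: "continuous_on (cball 0 \<epsilon>) g"
      unfolding g_def by (rule continuous_on_compose2[OF F]) (auto intro!: continuous_intros simp: dist_norm)
    have gnz: "g y \<noteq> 0" if "y \<in> cball 0 \<epsilon>" "y \<noteq> 0" for y
      unfolding g_def by (rule nz) (use that in \<open>auto simp: dist_norm\<close>)
    note lc = local_degree_compose[OF \<open>\<epsilon> > 0\<close> gc gnz \<delta>(1) qc q0 A injA]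
    obtain \<eta> where \<eta>: "\<eta> > 0" "\<And>u. u \<in> cball 0 \<eta> \<Longrightarrow> u \<noteq> 0 \<Longrightarrow> q u \<noteq> 0" using lc(2) by blast
    have "isCont q 0" using qc \<delta>(1) by (simp add: continuous_on_eq_continuous_at)
    then obtain \<kappa> where \<kappa>: "\<kappa> > 0" "\<And>u. norm u < \<kappa> \<Longrightarrow> norm (q u) < \<epsilon>"
      using \<open>\<epsilon> > 0\<close> q0 unfolding continuous_at_eps_delta by (metis dist_norm diff_zero)
    define \<mu> where "\<mu> = min (min (\<eta> / 2) (\<kappa> / 2)) (\<delta> / 2)"
    have \<mu>: "\<mu> > 0" "\<mu> < \<eta>" "\<mu> < \<kappa>" "\<mu> < \<delta>" using \<eta>(1) \<kappa>(1) \<delta>(1) by (auto simp: \<mu>_def min_def)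
    have in\<epsilon>: "q u \<in> cball 0 \<epsilon>" if "u \<in> cball 0 \<mu>" for u using \<kappa>(2)[of u] that \<mu> by simp
    have gqc: "continuous_on (cball 0 \<mu>) (\<lambda>u. g (q u))"
      by (rule continuous_on_compose2[OF gc continuous_on_subset[OF qc]]) (use \<mu> in\<epsilon> in auto)
    have gqnz: "g (q u) \<noteq> 0" if "u \<in> cball 0 \<mu>" "u \<noteq> 0" for u
      by (rule gnz[OF in\<epsilon>[OF that(1)] \<eta>(2)]) (use that \<mu> in auto)
    have til: "sgn ((tilde a \<circ> \<phi>) u) = \<sigma> *\<^sub>R sgn (g (q u))" if "u \<in> ball 0 \<mu>" for u
    proof -
      let ?z = "z0 + q u"
      have z: "?z \<in> cball z0 \<epsilon>" using in\<epsilon>[of u] that by (simp add: dist_norm)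
      have "(tilde a \<circ> \<phi>) u = tilde a (hemi \<sigma> ?z)" using hq[of u] that \<mu> by simp
      also have "\<dots> = (\<sigma> / norm (v + fst (T ?z))) *\<^sub>R F ?z"
        by (simp add: tilde_eq hemi_eq matrix_vector_mult_scaleR Fa[OF z])
      also have "\<dots> = \<sigma> *\<^sub>R ((1 / norm (v + fst (T ?z))) *\<^sub>R F ?z)" by simp
      finally show ?thesis
        using pole_plus(2)[of ?z] \<sigma> by (auto simp: g_def sgn_scaleR sgn_if abs_if sgn_minus split: if_splits)
    qed
    have "even (local_degree (tilde a \<circ> \<phi>) 0) \<longleftrightarrow> even (local_degree (\<lambda>u. g (q u)) 0)"
    proof (cases "\<sigma> = 1")
      case True
      then show ?thesis using local_degree_cong[OF \<mu>(1), of 0 "tilde a \<circ> \<phi>" "\<lambda>u. g (q u)"] til by simp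
    next
      case False
      then have "\<sigma> = - 1" using \<sigma> by auto
      then have "local_degree (tilde a \<circ> \<phi>) 0 = local_degree (\<lambda>u. - g (q u)) 0"
        using til by (intro local_degree_cong[OF \<mu>(1)]) (simp add: sgn_minus)
      then show ?thesis using local_degree_minus[OF \<mu>(1) gqc] gqnz by simp
    qed
    also have "\<dots> \<longleftrightarrow> even (local_degree g 0)" by (rule lc(1))
    also have "local_degree g 0 = local_degree F z0"
      unfolding local_degree_translate[of F z0] g_def ..
    finally show ?thesis .
  qed
  \<comment> \<open>The chart itself is a parametrization, so the choice operator returns a value of
    the kind just treated.\<close>
  have "\<exists>d. \<exists>\<phi> :: real^'n \<Rightarrow> (real^'k) \<times> (real^'p). local_param \<phi> (hemi \<sigma> z0) \<and> d = local_degree (tilde a \<circ> \<phi>) 0"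
    using local_param_hemi[OF \<sigma>] by blast
  from someI_ex[OF this] show ?thesis
    unfolding manifold_degree_def using main by metis
qed

end

section \<open>Half of the zeros and the degree at infinity\<close>

lemma even_sum_cong:
  fixes f g :: "'a \<Rightarrow> int"
  assumes "\<And>x. x \<in> A \<Longrightarrow> even (f x) \<longleftrightarrow> even (g x)"
  shows "even (sum f A) \<longleftrightarrow> even (sum g A)"
  using assms by (induction A rule: infinite_finite_induct) auto

lemma closest_point_cball:
  fixes x :: "'a::euclidean_space"
  assumes "r > 0"
  shows "continuous_on A (closest_point (cball (0::'a) r))"
    and "norm x \<le> r \<Longrightarrow> closest_point (cball 0 r) x = x"
    and "norm x \<ge> r \<Longrightarrow> norm (closest_point (cball 0 r) x) = r"
    and "norm (closest_point (cball 0 r) x) \<le> r"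
proof -
  show "continuous_on A (closest_point (cball (0::'a) r))"
    using assms by (intro continuous_on_closest_point) auto
  show "closest_point (cball 0 r) x = x" if "norm x \<le> r"
    using that by (intro closest_point_self) simp
  show "norm (closest_point (cball 0 r) x) = r" if "norm x \<ge> r"
  proof -
    have ne: "interior (cball (0::'a) r) \<noteq> {}" using assms by simp
    have "closest_point (cball 0 r) x \<in> rel_frontier (cball 0 r)"
      by (rule closest_point_in_rel_frontier)
        (use assms that in \<open>auto simp: affine_hull_nonempty_interior[OF ne] rel_interior_nonempty_interior[OF ne]\<close>)
    then show ?thesis using assms by (simp add: rel_frontier_nonempty_interior[OF ne] frontier_cball)
  qed
  show "norm (closest_point (cball 0 r) x) \<le> r"
    using closest_point_in_set[of "cball 0 r" x] assms by simp
qed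

lemma exists_unit_nonorthogonal:
  fixes S :: "(real^'k) set"
  assumes "finite S" "0 \<notin> S"
  obtains v where "norm v = 1" "\<And>s. s \<in> S \<Longrightarrow> v \<bullet> s \<noteq> 0"
proof -
  \<comment> \<open>The added vector forces \<open>x \<noteq> 0\<close> even when \<open>S\<close>
    is empty.\<close>
  define S' where "S' = insert (axis undefined 1) S"
  have S': "finite S'" "0 \<notin> S'" using assms by (auto simp: S'_def axis_eq_0_iff)
  have neg: "negligible (\<Union>s\<in>S'. {x. s \<bullet> x = 0})"
    using S' by (intro negligible_Union) (auto intro!: negligible_hyperplane)
  have "(\<Union>s\<in>S'. {x. s \<bullet> x = 0}) \<noteq> UNIV"
  proof
    assume "(\<Union>s\<in>S'. {x. s \<bullet> x = 0}) = UNIV"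
    with neg show False by (simp only: non_negligible_UNIV)
  qed
  then obtain x where x: "\<And>s. s \<in> S' \<Longrightarrow> s \<bullet> x \<noteq> 0" by blast
  have "x \<noteq> 0" using x[of "axis undefined 1"] by (auto simp: S'_def)
  show ?thesis
  proof (rule that[of "(1 / norm x) *\<^sub>R x"])
    show "(1 / norm x) *\<^sub>R x \<bullet> s \<noteq> 0" if "s \<in> S" for s
      using x[of s] that \<open>x \<noteq> 0\<close> by (simp add: S'_def inner_commute)
  qed (use \<open>x \<noteq> 0\<close> in simp)
qed

context slice_chart
begin

lemma tilde_hemi: "tilde a (hemi \<sigma> z) = (\<sigma> / norm (v + fst (T z))) *\<^sub>R (a (snd (T z)) *v (v + fst (T z)))"
  by (simp add: tilde_eq hemi_eq matrix_vector_mult_scaleR)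

lemma tilde_hemi_eq_0: "\<bar>\<sigma>\<bar> = 1 \<Longrightarrow> tilde a (hemi \<sigma> z) = 0 \<longleftrightarrow> a (snd (T z)) *v (v + fst (T z)) = 0"
  using pole_plus(2)[of z] by (auto simp: tilde_hemi)

lemma snd_hemi: "snd (hemi \<sigma> z) = snd (T z)"
  by (simp add: hemi_eq)

lemma hemi_minus: "hemi (- \<sigma>) z = (- fst (hemi \<sigma> z), snd (hemi \<sigma> z))"
  by (simp add: hemi_eq)

text \<open>Nearest-point projection to the ball extends \<open>a\<close> to all of the
  \<open>p\<close>-space; outside the open ball the extended matrices are injective, so no zeros are
  added. The affine chart then carries one point for each antipodal pair of zeros, just as
  \<open>H\<close> does, and \<open>degree_inf_sum\<close> applies.\<close>

lemma even_sum_manifold_degree: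
  fixes a :: "real^'p \<Rightarrow> real^'k^'n"
  assumes r: "r > 0" and a: "continuous_on (cball 0 r) a"
    and injr: "\<And>x \<beta>. norm x = r \<Longrightarrow> \<beta> \<noteq> 0 \<Longrightarrow> a x *v \<beta> \<noteq> 0"
    and fin: "finite (tilde_zeros r a)" and half: "half_of_zeros (tilde_zeros r a) H"
    and v: "\<And>q. q \<in> tilde_zeros r a \<Longrightarrow> v \<bullet> fst q \<noteq> 0"
  shows "even (\<Sum>q\<in>H. manifold_degree (tilde a) q) \<longleftrightarrow>
    even (degree_inf (\<lambda>z. a (closest_point (cball 0 r) (snd (T z))) *v (v + fst (T z))))"
proof -
  let ?pr = "closest_point (cball (0::real^'p) r)"
  note pr = closest_point_cball[OF r]
  define F where "F z = a (?pr (snd (T z))) *v (v + fst (T z))" for z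
  have "continuous_on UNIV (\<lambda>z. a (?pr (snd (T z))))"
    by (intro continuous_on_compose2[OF a] continuous_on_compose2[OF pr(1)[of UNIV]] continuous_intros) (use pr(4) in auto)
  then have cF: "continuous_on UNIV F" unfolding F_def by (intro continuous_intros)
  have inner: "norm (snd (T z)) < r" if "F z = 0" for z
  proof (rule ccontr)
    assume "\<not> ?thesis"
    then show False using injr[OF pr(3) pole_plus(2), of "snd (T z)" z] that by (auto simp: F_def)
  qed
  have Fa: "F z = a (snd (T z)) *v (v + fst (T z))" if "norm (snd (T z)) \<le> r" for z
    using pr(2)[OF that] by (simp add: F_def)
  have hemiZ: "hemi \<sigma> z \<in> tilde_zeros r a" if "F z = 0" "\<bar>\<sigma>\<bar> = 1" for z \<sigma>
  proof -
    have "tilde a (hemi \<sigma> z) = 0" using Fa[of z] inner[OF that(1)] that tilde_hemi_eq_0[OF that(2), of a z] by simp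
    then show ?thesis
      using inner[OF that(1)] hemi_sphere(1)[OF that(2), of z] by (simp add: tilde_zeros_def mem_Times_iff snd_hemi)
  qed
  have HZ: "H \<subseteq> tilde_zeros r a" using half by (simp add: half_of_zeros_def)
  have halfD: "(\<beta>, x) \<in> H \<longleftrightarrow> (- \<beta>, x) \<notin> H" if "(\<beta>, x) \<in> tilde_zeros r a" for \<beta> x
    using half that by (auto simp: half_of_zeros_def)
  have alt: "hemi 1 z \<in> H \<longleftrightarrow> hemi (- 1) z \<notin> H" if "F z = 0" for z
    using halfD[of "fst (hemi 1 z)" "snd (hemi 1 z)"] hemiZ[OF that, of 1] hemi_minus[of 1 z] by simp
  \<comment> \<open>\<open>H\<close> may use both hemispheres: \<open>sg z\<close> tells on which of
    them it meets the antipodal pair over \<open>z\<close>. The parity is the same on both.\<close>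
  define sg where "sg z = (if hemi 1 z \<in> H then 1 else - 1 :: real)" for z
  have sg: "\<bar>sg z\<bar> = 1" for z by (simp add: sg_def)
  have bij: "bij_betw (\<lambda>z. hemi (sg z) z) {z. F z = 0} H"
  proof (rule bij_betwI[where g=hemi_inv])
    show "(\<lambda>z. hemi (sg z) z) \<in> {z. F z = 0} \<rightarrow> H"
      using alt by (auto simp: sg_def)
    show "hemi_inv (hemi (sg z) z) = z" for z by (rule hemi_inv_hemi[OF sg])
    have *: "F (hemi_inv q) = 0 \<and> hemi (sg (hemi_inv q)) (hemi_inv q) = q" if q: "q \<in> H" for q
    proof -
      have qZ: "q \<in> tilde_zeros r a" using HZ q by blast
      then have qs: "norm (fst q) = 1" "norm (snd q) \<le> r" "tilde a q = 0"
        by (auto simp: tilde_zeros_def mem_Times_iff)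
      define \<sigma> where "\<sigma> = sgn (v \<bullet> fst q)"
      have \<sigma>: "\<bar>\<sigma>\<bar> = 1" "\<sigma> * (v \<bullet> fst q) > 0"
        using v[OF qZ] by (auto simp: \<sigma>_def sgn_if)
      have h: "hemi \<sigma> (hemi_inv q) = q" by (rule hemi_hemi_inv[OF \<sigma>(1) qs(1) \<sigma>(2)])
      have "F (hemi_inv q) = a (snd (T (hemi_inv q))) *v (v + fst (T (hemi_inv q)))"
        using qs(2) snd_hemi[of \<sigma> "hemi_inv q"] by (intro Fa) (simp add: h)
      then have F0: "F (hemi_inv q) = 0"
        using tilde_hemi_eq_0[OF \<sigma>(1), of a "hemi_inv q"] qs(3) by (simp add: h)
      have "\<sigma> = 1 \<or> \<sigma> = - 1" using \<sigma>(1) by auto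
      then have "sg (hemi_inv q) = \<sigma>" using alt[OF F0] h q by (auto simp: sg_def)
      with F0 h show ?thesis by simp
    qed
    show "hemi_inv \<in> H \<rightarrow> {z. F z = 0}" using * by auto
    show "hemi (sg (hemi_inv q)) (hemi_inv q) = q" if "q \<in> H" for q using * that by blast
  qed
  have finF: "finite {z. F z = 0}"
    using bij_betw_finite[OF bij] finite_subset[OF HZ fin] by simp
  have "even (manifold_degree (tilde a) (hemi (sg z) z)) \<longleftrightarrow> even (local_degree F z)" if z: "F z = 0" for z
  proof -
    obtain d where d: "d > 0" "\<And>w. F w = 0 \<Longrightarrow> w \<noteq> z \<Longrightarrow> d \<le> dist z w"
      using finite_set_avoid[OF finF, of z] by auto
    \<comment> \<open>Within this radius no other zero occurs, and \<open>snd (T w)\<close> stays in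
      the ball, where the extension is \<open>a\<close> itself.\<close>
    define \<epsilon> where "\<epsilon> = min (d / 2) (r - norm (snd (T z)))"
    have \<epsilon>: "\<epsilon> > 0" "\<epsilon> < d" "\<epsilon> \<le> r - norm (snd (T z))"
      using d(1) inner[OF z] by (auto simp: \<epsilon>_def min_def)
    have near: "norm (snd (T w)) \<le> r" if "w \<in> cball z \<epsilon>" for w
    proof -
      have "norm (snd (T w)) \<le> norm (snd (T z)) + norm (snd (T (w - z)))"
        using norm_triangle_ineq[of "snd (T z)" "snd (T w) - snd (T z)"] by (simp add: T_diff)
      also have "norm (snd (T (w - z))) \<le> norm (w - z)" 
        using norm_snd_le[of "snd (T (w - z))" "fst (T (w - z))"] norm_T[of "w - z"] by simp
      finally show ?thesis using that \<epsilon>(3) by (simp add: dist_norm norm_minus_commute)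
    qed
    show ?thesis
    proof (rule even_manifold_degree[OF sg \<epsilon>(1)])
      show "continuous_on (cball z \<epsilon>) F" using cF by (rule continuous_on_subset) simp
      show "F w \<noteq> 0" if "w \<in> cball z \<epsilon>" "w \<noteq> z" for w
        using d(2)[of w] that \<epsilon>(2) by auto
    qed (use Fa near in auto)
  qed
  then have "even (\<Sum>z | F z = 0. manifold_degree (tilde a) (hemi (sg z) z)) \<longleftrightarrow> even (\<Sum>z | F z = 0. local_degree F z)"
    by (intro even_sum_cong) auto
  also have "(\<Sum>z | F z = 0. local_degree F z) = degree_inf F"
    by (rule degree_inf_sum[OF card_n cF finF, symmetric])
  finally show ?thesis
    unfolding sum.reindex_bij_betw[OF bij] by (simp add: F_def[abs_def])
qed

end

text \<open>A single \<open>v\<close> is chosen for both mappings, not orthogonal to any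
  \<open>\<beta>\<close> occurring in a zero of either. Then no matrix of either family kills a
  nonzero vector orthogonal to \<open>v\<close>, since its normalization would be such a
  \<open>\<beta>\<close>; this is the injectivity that \<open>even_degree_inf_slice\<close> asks
  for.\<close>

lemma even_sum_manifold_degree_independent:
  fixes a0 a1 :: "real^'p \<Rightarrow> real^'k^'n"
  assumes card: "CARD('k) \<ge> 2" "CARD('k) + CARD('p) = CARD('n) + 1" and r: "r > 0"
    and sm: "smooth_on (cball 0 r) a0" "smooth_on (cball 0 r) a1"
    and agree: "\<And>x. norm x = r \<Longrightarrow> a0 x = a1 x"
    and injr: "\<And>x \<beta>. norm x = r \<Longrightarrow> \<beta> \<noteq> 0 \<Longrightarrow> a0 x *v \<beta> \<noteq> 0"
    and fin: "finite (tilde_zeros r a0)" "finite (tilde_zeros r a1)"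
    and half: "half_of_zeros (tilde_zeros r a0) H0" "half_of_zeros (tilde_zeros r a1) H1"
  shows "even (\<Sum>q\<in>H0. manifold_degree (tilde a0) q) \<longleftrightarrow> even (\<Sum>q\<in>H1. manifold_degree (tilde a1) q)"
proof -
  define S where "S = fst ` (tilde_zeros r a0 \<union> tilde_zeros r a1)"
  have "finite S" "0 \<notin> S" using fin by (auto simp: S_def tilde_zeros_def)
  then obtain v where v: "norm v = 1" "\<And>s. s \<in> S \<Longrightarrow> v \<bullet> s \<noteq> 0"
    using exists_unit_nonorthogonal by metis
  obtain v' and T :: "real^'n \<Rightarrow> (real^'k) \<times> (real^'p)" and e where "slice_chart v v' T e"
    by (rule exists_slice_chart[OF v(1) card])
  then interpret slice_chart v v' T e .
  let ?pr = "closest_point (cball (0::real^'p) r)"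
  note pr = closest_point_cball[OF r]
  have ca: "continuous_on (cball 0 r) a0" "continuous_on (cball 0 r) a1"
    using sm by (auto intro: smooth_on_continuous_on)
  have cpr: "continuous_on UNIV (\<lambda>x. a (?pr x))" if "continuous_on (cball 0 r) a" for a :: "real^'p \<Rightarrow> real^'k^'n"
    by (rule continuous_on_compose2[OF that pr(1)]) (use pr(4) in auto)
  have dpr: "(\<lambda>x. a (?pr x)) differentiable (at x)" if "smooth_on (cball 0 r) a" "norm x < r" for a :: "real^'p \<Rightarrow> real^'k^'n" and x
  proof -
    have "a differentiable (at x)" using that by (intro smooth_on_differentiable) auto
    moreover have "a (?pr y) = a y" if "y \<in> ball 0 r" for y using pr(2)[of y] that by simp
    ultimately show ?thesis
      using frechet_derivative_cong_open(1)[of "ball 0 r" x "\<lambda>x. a (?pr x)" a] that(2) by simp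
  qed
  have inj: "a (?pr x) *v y \<noteq> 0" if "v \<bullet> y = 0" "y \<noteq> 0" "a = a0 \<or> a = a1" for a x y
  proof
    assume 0: "a (?pr x) *v y = 0"
    have "((1 / norm y) *\<^sub>R y, ?pr x) \<in> tilde_zeros r a"
      using that(2) pr(4)[of x] 0 by (auto simp: tilde_zeros_def tilde_eq matrix_vector_mult_scaleR)
    then have "(1 / norm y) *\<^sub>R y \<in> S" using that(3) unfolding S_def by force
    then show False using v(2) that(1) by fastforce
  qed
  have "even (degree_inf (\<lambda>z. a0 (?pr (snd (T z))) *v (v + fst (T z)))) \<longleftrightarrow>
    even (degree_inf (\<lambda>z. a1 (?pr (snd (T z))) *v (v + fst (T z))))"
    by (rule even_degree_inf_slice[OF card(2) r cpr[OF ca(1)] cpr[OF ca(2)] dpr[OF sm(1)] dpr[OF sm(2)]])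
      (use agree[OF pr(3)] injr[OF pr(3)] inj in auto)
  moreover have "even (\<Sum>q\<in>H0. manifold_degree (tilde a0) q) \<longleftrightarrow>
    even (degree_inf (\<lambda>z. a0 (?pr (snd (T z))) *v (v + fst (T z))))"
    by (rule even_sum_manifold_degree[OF r ca(1) injr fin(1) half(1)]) (use v(2) in \<open>auto simp: S_def\<close>)
  moreover have "even (\<Sum>q\<in>H1. manifold_degree (tilde a1) q) \<longleftrightarrow>
    even (degree_inf (\<lambda>z. a1 (?pr (snd (T z))) *v (v + fst (T z))))"
    by (rule even_sum_manifold_degree[OF r ca(2) _ fin(2) half(2)]) (use v(2) injr agree in \<open>auto simp: S_def\<close>)
  ultimately show ?thesis by simp
qed

section \<open>Cross-caps\<close>

lemma has_derivative_jacobian: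
  fixes f :: "real^'m \<Rightarrow> real^'n"
  assumes "f differentiable (at x)"
  shows "(f has_derivative (\<lambda>w. jacobian f (at x) *v w)) (at x)"
  using assms unfolding jacobian_works .

lemma Ck_on_jacobian:
  fixes f :: "real^'m \<Rightarrow> real^'n"
  assumes "Ck_on (Suc k) UNIV f"
  shows "Ck_on k UNIV (\<lambda>x. jacobian f (at x))"
proof -
  define out where "out i w = (\<chi> a b. if b = i then w $ a else 0)" for i :: 'm and w :: "real^'n"
  have bl: "bounded_linear (out i)" for i
    unfolding linear_conv_bounded_linear[symmetric]
    by (rule linearI) (auto simp: out_def vec_eq_iff)
  have eq: "jacobian f (at x) = (\<Sum>i\<in>UNIV. out i (frechet_derivative f (at x) (axis i 1)))" for x
    by (simp add: vec_eq_iff out_def jacobian_def matrix_def)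
  show ?thesis
    unfolding eq using assms by (intro Ck_on_sum Ck_on_compose_linear[OF open_UNIV bl] open_UNIV) simp
qed

lemma singular_point_iff:
  fixes f :: "real^'m \<Rightarrow> real^'n"
  shows "singular_point f p \<longleftrightarrow> (\<exists>\<beta>. \<beta> \<noteq> 0 \<and> jacobian f (at p) *v \<beta> = 0)"
proof -
  have "rank (jacobian f (at p)) \<le> CARD('m)"
    using rank_bound[of "jacobian f (at p)"] by simp
  then show ?thesis
    unfolding singular_point_def matrix_nonfull_linear_equations_eq by linarith
qed

lemma has_derivative_vec_nth:
  "(f has_derivative D) F \<Longrightarrow> ((\<lambda>x. f x $ i) has_derivative (\<lambda>h. D h $ i)) F"
  by (rule bounded_linear.has_derivative[OF bounded_linear_vec_nth])

definition cross_cap_deriv :: "'m \<Rightarrow> ('n \<Rightarrow> 'm + 'm) \<Rightarrow> real^'m \<Rightarrow> real^'m \<Rightarrow> real^'n" where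
  "cross_cap_deriv o1 \<sigma> x h = (\<chi> j. case \<sigma> j of Inl i \<Rightarrow> if i = o1 then 2 * x $ o1 * h $ o1 else h $ i
     | Inr i \<Rightarrow> x $ o1 * h $ i + h $ o1 * x $ i)"

lemma has_derivative_cross_cap_form:
  "(cross_cap_form o1 \<sigma> has_derivative cross_cap_deriv o1 \<sigma> x) (at x)"
proof (rule has_derivative_componentwise_within[THEN iffD2], rule ballI)
  fix b :: "real^'b" assume "b \<in> Basis"
  then obtain j where b: "b = axis j 1" by (auto simp: Basis_vec_def)
  have "((\<lambda>x. cross_cap_form o1 \<sigma> x $ j) has_derivative (\<lambda>h. cross_cap_deriv o1 \<sigma> x h $ j)) (at x)"
  proof (cases "\<sigma> j")
    case (Inl i)
    show ?thesis
      by (cases "i = o1")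
        (auto simp: cross_cap_form_def cross_cap_deriv_def Inl power2_eq_square algebra_simps
          intro!: derivative_eq_intros has_derivative_vec_nth)
  next
    case (Inr i)
    show ?thesis
      by (auto simp: cross_cap_form_def cross_cap_deriv_def Inr algebra_simps
          intro!: derivative_eq_intros has_derivative_vec_nth)
  qed
  then show "((\<lambda>x. cross_cap_form o1 \<sigma> x \<bullet> b) has_derivative (\<lambda>h. cross_cap_deriv o1 \<sigma> x h \<bullet> b)) (at x)"
    by (simp add: b inner_axis)
qed

text \<open>The kernel of \<open>df\<close> at a cross-cap is a line, and the second derivative maps the tangent space
  injectively into the cokernel; both facts are read off in the normal form.\<close>

lemma cross_cap_nondegenerate:
  fixes f :: "real^'m \<Rightarrow> real^'n"
  assumes f: "\<And>k. Ck_on k UNIV f" and p: "cross_cap f p"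
  obtains \<beta>0 where "\<beta>0 \<noteq> 0" "jacobian f (at p) *v \<beta>0 = 0"
    "\<forall>\<beta>. jacobian f (at p) *v \<beta> = 0 \<longrightarrow> (\<exists>c. \<beta> = c *\<^sub>R \<beta>0)"
    "\<forall>D u w. ((\<lambda>x. jacobian f (at x) *v \<beta>0) has_derivative D) (at p) \<longrightarrow> D u = jacobian f (at p) *v w \<longrightarrow> u = 0"
proof -
  obtain o1 \<sigma> U V and \<phi> :: "real^'m \<Rightarrow> real^'m" and \<psi> :: "real^'n \<Rightarrow> real^'n"
    where \<sigma>: "bij_betw \<sigma> UNIV (Inl ` UNIV \<union> Inr ` (UNIV - {o1}))"
      and U: "open U" "p \<in> U" "diffeo_onto_image U \<phi>" and \<phi>p: "\<phi> p = 0"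
      and V: "open V" "f ` U \<subseteq> V" "diffeo_onto_image V \<psi>"
      and eq: "\<And>x. x \<in> U \<Longrightarrow> \<psi> (f x) = cross_cap_form o1 \<sigma> (\<phi> x)"
    using p unfolding cross_cap_def by blast
  let ?J = "\<lambda>x. jacobian f (at x)" and ?q = "cross_cap_deriv o1 \<sigma>"
  let ?d\<phi> = "\<lambda>x. frechet_derivative \<phi> (at x)" and ?d\<psi> = "\<lambda>x. frechet_derivative \<psi> (at (f x))"
  have fd: "f differentiable (at x)" for x using f[of "Suc 0"] by simp
  have fpV: "f x \<in> V" if "x \<in> U" for x using V(2) that by blast
  note \<Phi> = diffeo_onto_image_derivative[OF U] and \<Psi> = diffeo_onto_image_derivative[OF V(1) fpV[OF U(2)] V(3)]
  \<comment> \<open>The normal form identity is differentiated at every point of \<open>U\<close>,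
    not only at \<open>p\<close>, because the result is differentiated once more below.\<close>
  have D1: "?d\<psi> x (?J x *v w) = ?q (\<phi> x) (?d\<phi> x w)" if x: "x \<in> U" for x w
  proof -
    have "((\<lambda>x. \<psi> (f x)) has_derivative (\<lambda>w. ?d\<psi> x (?J x *v w))) (at x)"
      by (rule has_derivative_compose[OF has_derivative_jacobian[OF fd] Ck_on_Suc_deriv[OF \<Psi>(1) fpV[OF x]]])
    moreover have "((\<lambda>x. cross_cap_form o1 \<sigma> (\<phi> x)) has_derivative (\<lambda>w. ?q (\<phi> x) (?d\<phi> x w))) (at x)"
      by (rule has_derivative_compose[OF Ck_on_Suc_deriv[OF \<Phi>(1) x] has_derivative_cross_cap_form])
    ultimately have "(\<lambda>w. ?d\<psi> x (?J x *v w)) = (\<lambda>w. ?q (\<phi> x) (?d\<phi> x w))"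
      by (rule has_derivative_eq_on_nhd[OF _ _ U(1) x]) (use eq in auto)
    then show ?thesis by (rule fun_cong)
  qed
  have label: "\<exists>j. \<sigma> j = Inl i" "i \<noteq> o1 \<Longrightarrow> \<exists>j. \<sigma> j = Inr i" for i
    using \<sigma> unfolding bij_betw_def by (metis UnI1 rangeI imageE, metis (no_types, lifting) Diff_iff UNIV_I UnI2 image_iff singletonD)
  have qker: "?q 0 h = 0 \<longleftrightarrow> (\<forall>i. i \<noteq> o1 \<longrightarrow> h $ i = 0)" for h
  proof
    assume h0: "?q 0 h = 0"
    show "\<forall>i. i \<noteq> o1 \<longrightarrow> h $ i = 0"
    proof (intro allI impI)
      fix i assume i: "i \<noteq> o1"
      obtain j where j: "\<sigma> j = Inl i" using label(1) by blast
      have "?q 0 h $ j = h $ i" using i by (simp add: cross_cap_deriv_def j)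
      then show "h $ i = 0" by (simp add: h0)
    qed
  next
    assume "\<forall>i. i \<noteq> o1 \<longrightarrow> h $ i = 0"
    then show "?q 0 h = 0" by (auto simp: cross_cap_deriv_def vec_eq_iff split: sum.split)
  qed
  let ?P = "?d\<phi> p" and ?Q = "?d\<psi> p"
  have J0: "?J p *v w = 0 \<longleftrightarrow> (\<forall>i. i \<noteq> o1 \<longrightarrow> ?P w $ i = 0)" for w
  proof -
    have "?J p *v w = 0 \<longleftrightarrow> ?Q (?J p *v w) = 0"
      using \<Psi>(3) linear_0[OF \<Psi>(2)] by (metis injD)
    then show ?thesis using D1[OF U(2), of w] by (simp add: \<phi>p qker)
  qed
  have "surj ?P" using \<Phi>(2,3) by (rule linear_inj_imp_surj)
  \<comment> \<open>In the normal form the kernel at 0 is the \<open>o1\<close> axis.\<close>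
  then obtain \<beta>0 where \<beta>0: "?P \<beta>0 = axis o1 1" by (metis surjD)
  show ?thesis
  proof (rule that[of \<beta>0])
    show "\<beta>0 \<noteq> 0" using \<beta>0 linear_0[OF \<Phi>(2)] by (auto simp: axis_eq_0_iff)
    show J\<beta>0: "?J p *v \<beta>0 = 0" by (simp add: J0 \<beta>0 axis_def)
    show "\<forall>\<beta>. ?J p *v \<beta> = 0 \<longrightarrow> (\<exists>c. \<beta> = c *\<^sub>R \<beta>0)"
    proof (intro allI impI exI)
      fix \<beta> assume that: "?J p *v \<beta> = 0"
      have "?P \<beta> = (?P \<beta> $ o1) *\<^sub>R axis o1 1"
        using iffD1[OF J0 that] by (simp add: vec_eq_iff axis_def)
      also have "\<dots> = ?P ((?P \<beta> $ o1) *\<^sub>R \<beta>0)" by (simp add: linear_cmul[OF \<Phi>(2)] \<beta>0)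
      finally show "\<beta> = (?P \<beta> $ o1) *\<^sub>R \<beta>0" using \<Phi>(3) by (simp add: inj_eq)
    qed
    show "\<forall>D u w. ((\<lambda>x. ?J x *v \<beta>0) has_derivative D) (at p) \<longrightarrow> D u = ?J p *v w \<longrightarrow> u = 0"
    proof (intro allI impI)
    fix D u w assume D: "((\<lambda>x. ?J x *v \<beta>0) has_derivative D) (at p)" and Du: "D u = ?J p *v w"
    \<comment> \<open>Expanding in coordinates separates the varying linear map
      \<open>?d\<psi> x\<close> from its argument and opens the way for the product rule. At
      \<open>p\<close> the terms with derivatives of \<open>?d\<psi>\<close> drop out because the
      argument \<open>?J p *v \<beta>0\<close> is 0.\<close>
    have basis: "?d\<psi> x y = (\<Sum>i\<in>UNIV. y $ i *\<^sub>R ?d\<psi> x (axis i 1))" if x: "x \<in> U" for x y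
    proof -
      have lin: "linear (?d\<psi> x)"
        using diffeo_onto_image_derivative(2)[OF V(1) fpV[OF x] V(3)] .
      have "y = (\<Sum>i\<in>UNIV. y $ i *\<^sub>R axis i 1)"
        by (simp add: vec_eq_iff axis_def if_distrib cong: if_cong)
      then have "?d\<psi> x y = ?d\<psi> x (\<Sum>i\<in>UNIV. y $ i *\<^sub>R axis i 1)" by simp
      also have "\<dots> = (\<Sum>i\<in>UNIV. y $ i *\<^sub>R ?d\<psi> x (axis i 1))"
        by (simp add: linear_sum[OF lin] linear_cmul[OF lin])
      finally show ?thesis .
    qed
    have "\<exists>E. ((\<lambda>x. ?d\<psi> x (axis i 1)) has_derivative E) (at p)" for i
    proof -
      have "(\<lambda>y. frechet_derivative \<psi> (at y) (axis i 1)) differentiable (at (f p))"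
        using \<Psi>(1)[of "Suc (Suc 0)"] fpV[OF U(2)] by simp
      then have "(\<lambda>x. ?d\<psi> x (axis i 1)) differentiable (at p)"
        using differentiable_chain_at[OF fd] by (simp add: o_def)
      then show ?thesis by (simp add: differentiable_def)
    qed
    then obtain E where E: "\<And>i. ((\<lambda>x. ?d\<psi> x (axis i 1)) has_derivative E i) (at p)" by metis
    have "((\<lambda>x. \<Sum>i\<in>UNIV. (?J x *v \<beta>0) $ i *\<^sub>R ?d\<psi> x (axis i 1)) has_derivative
       (\<lambda>h. \<Sum>i\<in>UNIV. (?J p *v \<beta>0) $ i *\<^sub>R E i h + D h $ i *\<^sub>R ?Q (axis i 1))) (at p)"
      by (intro has_derivative_sum has_derivative_scaleR has_derivative_vec_nth[OF D] E)
    moreover have "(\<Sum>i\<in>UNIV. (?J p *v \<beta>0) $ i *\<^sub>R E i h + D h $ i *\<^sub>R ?Q (axis i 1)) = ?Q (D h)" for h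
      unfolding basis[OF U(2), of "D h"] by (simp add: J\<beta>0)
    ultimately have L: "((\<lambda>x. \<Sum>i\<in>UNIV. (?J x *v \<beta>0) $ i *\<^sub>R ?d\<psi> x (axis i 1)) has_derivative (\<lambda>h. ?Q (D h))) (at p)"
      by simp
    have "(\<lambda>x. ?d\<phi> x \<beta>0) differentiable (at p)"
      using \<Phi>(1)[of "Suc (Suc 0)"] U(2) by simp
    then obtain E' where E': "((\<lambda>x. ?d\<phi> x \<beta>0) has_derivative E') (at p)" by (auto simp: differentiable_def)
    have \<phi>d: "(\<phi> has_derivative ?P) (at p)" by (rule Ck_on_Suc_deriv[OF \<Phi>(1) U(2)])
    have R: "((\<lambda>x. ?q (\<phi> x) (?d\<phi> x \<beta>0) $ j) has_derivative
        (\<lambda>h. case \<sigma> j of Inl i \<Rightarrow> if i = o1 then 2 * ?P h $ o1 else E' h $ i | Inr i \<Rightarrow> ?P h $ o1 * axis o1 1 $ i + ?P h $ i)) (at p)" for j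
    proof (cases "\<sigma> j")
      case (Inl i)
      show ?thesis
      proof (cases "i = o1")
        case True
        have "((\<lambda>x. 2 * (\<phi> x $ o1 * ?d\<phi> x \<beta>0 $ o1)) has_derivative (\<lambda>h. 2 * (\<phi> p $ o1 * E' h $ o1 + ?P h $ o1 * ?P \<beta>0 $ o1))) (at p)"
          by (intro has_derivative_mult_right has_derivative_mult has_derivative_vec_nth \<phi>d E')
        then show ?thesis by (simp add: cross_cap_deriv_def Inl True \<phi>p \<beta>0 mult.assoc)
      next
        case False
        then show ?thesis by (simp add: cross_cap_deriv_def Inl has_derivative_vec_nth[OF E'])
      qed
    next
      case (Inr i)
      have "((\<lambda>x. \<phi> x $ o1 * ?d\<phi> x \<beta>0 $ i + ?d\<phi> x \<beta>0 $ o1 * \<phi> x $ i) has_derivative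
        (\<lambda>h. (\<phi> p $ o1 * E' h $ i + ?P h $ o1 * ?P \<beta>0 $ i) + (?P \<beta>0 $ o1 * ?P h $ i + E' h $ o1 * \<phi> p $ i))) (at p)"
        by (intro has_derivative_add has_derivative_mult has_derivative_vec_nth \<phi>d E')
      then show ?thesis by (simp add: cross_cap_deriv_def Inr \<phi>p \<beta>0)
    qed
    have comp: "?Q (D h) $ j = (case \<sigma> j of Inl i \<Rightarrow> if i = o1 then 2 * ?P h $ o1 else E' h $ i | Inr i \<Rightarrow> ?P h $ o1 * axis o1 1 $ i + ?P h $ i)" for h j
    proof (rule fun_cong[OF has_derivative_eq_on_nhd[OF has_derivative_vec_nth[OF L, of j] R U(1,2)]])
      fix x assume x: "x \<in> U"
      show "(\<Sum>i\<in>UNIV. (?J x *v \<beta>0) $ i *\<^sub>R ?d\<psi> x (axis i 1)) $ j = ?q (\<phi> x) (?d\<phi> x \<beta>0) $ j"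
        unfolding basis[OF x, of "?J x *v \<beta>0", symmetric] D1[OF x] ..
    qed
    have QD: "?Q (D u) = ?q 0 (?P w)" using D1[OF U(2), of w] by (simp add: Du \<phi>p)
    \<comment> \<open>The coordinates labelled \<open>Inl o1\<close> and \<open>Inr i\<close> vanish
      on the image of the normal form's differential at 0, whereas in \<open>?Q (D u)\<close> they
      are \<open>2 * ?P u $ o1\<close> and \<open>?P u $ i\<close>.\<close>
    have "?P u $ i = 0" for i
    proof (cases "i = o1")
      case True
      obtain j where "\<sigma> j = Inl o1" using label(1) by blast
      then show ?thesis using comp[of u j] QD True by (simp add: cross_cap_deriv_def)
    next
      case False
      obtain j where "\<sigma> j = Inr i" using label(2)[OF False] by blast
      then show ?thesis using comp[of u j] QD False by (simp add: cross_cap_deriv_def axis_def)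
    qed
    then have "?P u = ?P 0" by (simp add: vec_eq_iff linear_0[OF \<Phi>(2)])
    then show "u = 0" using \<Phi>(3) by (simp add: inj_eq)
    qed
  qed
qed

text \<open>In the chart with pole \<open>\<beta>\<close> the zero lies over \<open>(0, p)\<close>,
  and the derivative there sends \<open>(y, x)\<close>, with \<open>y\<close> orthogonal to
  \<open>\<beta>\<close>, to \<open>?J p *v y + J' x *v \<beta>\<close>. If this vanishes, the
  second-derivative property of the cross-cap gives \<open>x = 0\<close>; then \<open>y\<close> lies
  on the kernel line spanned by \<open>\<beta>\<close>, so \<open>y = 0\<close>. The isolation of
  the zero serves to prove finiteness.\<close>

lemma tilde_jacobian_at_cross_cap:
  fixes f :: "real^'m \<Rightarrow> real^'n"
  assumes card: "CARD('m) \<ge> 2" "CARD('m) + CARD('m) = CARD('n) + 1"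
    and f: "\<And>k. Ck_on k UNIV f" and p: "cross_cap f p"
    and \<beta>: "norm \<beta> = 1" "jacobian f (at p) *v \<beta> = 0"
  shows "odd (manifold_degree (tilde (\<lambda>x. jacobian f (at x))) (\<beta>, p))"
    and "\<not> (\<beta>, p) islimpt {q. norm (fst q) = 1 \<and> tilde (\<lambda>x. jacobian f (at x)) q = 0}"
proof -
  let ?J = "\<lambda>x. jacobian f (at x)"
  obtain v' and T :: "real^'n \<Rightarrow> (real^'m) \<times> (real^'m)" and e where "slice_chart \<beta> v' T e"
    by (rule exists_slice_chart[OF \<beta>(1) card])
  then interpret slice_chart \<beta> v' T e .
  define z0 where "z0 = T_inv (0, p)"
  have Tz0: "T z0 = (0, p)" unfolding z0_def by (rule T_T_inv) simp
  have hz0: "hemi 1 z0 = (\<beta>, p)" by (simp add: hemi_eq Tz0 \<beta>(1))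
  define F where "F z = ?J (snd (T z)) *v (\<beta> + fst (T z))" for z
  have JC: "Ck_on k UNIV ?J" for k by (rule Ck_on_jacobian[OF f])
  have Jc: "continuous_on UNIV ?J" using JC[of 0] by simp
  have cF: "continuous_on UNIV F"
    unfolding F_def by (intro continuous_intros continuous_on_compose2[OF Jc]) auto
  obtain J' where J': "(?J has_derivative J') (at p)"
    using JC[of "Suc 0"] by (auto simp: differentiable_def)
  have blT: "bounded_linear T" using linear_T by (simp add: linear_conv_bounded_linear)
  have dT: "((\<lambda>z. snd (T z)) has_derivative (\<lambda>h. snd (T h))) (at z0)"
    "((\<lambda>z. fst (T z)) has_derivative (\<lambda>h. fst (T h))) (at z0)"
    by (intro bounded_linear_imp_has_derivative bounded_linear_compose[OF bounded_linear_snd blT]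
        bounded_linear_compose[OF bounded_linear_fst blT])+
  define A where "A h = ?J p *v fst (T h) + J' (snd (T h)) *v \<beta>" for h
  have dF: "(F has_derivative A) (at z0)"
  proof -
    have "((\<lambda>z. ?J (snd (T z))) has_derivative (\<lambda>h. J' (snd (T h)))) (at z0)"
      by (rule has_derivative_compose[OF dT(1)]) (use J' in \<open>simp add: Tz0\<close>)
    moreover have "((\<lambda>z. \<beta> + fst (T z)) has_derivative (\<lambda>h. 0 + fst (T h))) (at z0)"
      by (intro has_derivative_add has_derivative_const dT)
    ultimately show ?thesis
      using bounded_bilinear.FDERIV[OF bounded_bilinear_matrix_vector,
          of "\<lambda>z. ?J (snd (T z))" "\<lambda>h. J' (snd (T h))" z0 UNIV "\<lambda>z. \<beta> + fst (T z)" "\<lambda>h. 0 + fst (T h)"]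
      by (simp add: F_def[abs_def] A_def[abs_def] Tz0)
  qed
  have injA: "inj A"
    unfolding linear_injective_0[OF has_derivative_linear[OF dF]]
  proof (intro allI impI)
    fix h assume h: "A h = 0"
    obtain \<beta>0 where \<beta>0: "\<beta>0 \<noteq> 0" "?J p *v \<beta>0 = 0"
      "\<forall>\<beta>. ?J p *v \<beta> = 0 \<longrightarrow> (\<exists>c. \<beta> = c *\<^sub>R \<beta>0)"
      "\<forall>D u w. ((\<lambda>x. ?J x *v \<beta>0) has_derivative D) (at p) \<longrightarrow> D u = ?J p *v w \<longrightarrow> u = 0"
      by (rule cross_cap_nondegenerate[OF f p])
    obtain c where c: "\<beta> = c *\<^sub>R \<beta>0" using \<beta>0(3) \<beta>(2) by blast
    have c0: "c \<noteq> 0" using c \<beta>(1) by auto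
    have "((\<lambda>x. ?J x *v \<beta>0) has_derivative (\<lambda>u. J' u *v \<beta>0)) (at p)"
      using bounded_linear.has_derivative[OF bounded_bilinear.bounded_linear_left[OF bounded_bilinear_matrix_vector] J'] .
    \<comment> \<open>The second-derivative property concerns \<open>\<beta>0\<close>; the factor
      \<open>1 / c\<close> converts from \<open>\<beta> = c *\<^sub>R \<beta>0\<close>.\<close>
    moreover have "J' (snd (T h)) *v \<beta>0 = ?J p *v ((- 1 / c) *\<^sub>R fst (T h))"
    proof -
      have "c *\<^sub>R (J' (snd (T h)) *v \<beta>0) = - (?J p *v fst (T h))"
        using h by (simp add: A_def c matrix_vector_mult_scaleR add_eq_0_iff)
      then have "(1 / c) *\<^sub>R (c *\<^sub>R (J' (snd (T h)) *v \<beta>0)) = (1 / c) *\<^sub>R (- (?J p *v fst (T h)))" by simp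
      then show ?thesis
        using c0 by (simp add: matrix_vector_mult_scaleR bounded_bilinear.minus_right[OF bounded_bilinear_matrix_vector])
    qed
    ultimately have sh: "snd (T h) = 0" using \<beta>0(4) by blast
    then have "?J p *v fst (T h) = 0"
      using h linear_0[OF has_derivative_linear[OF J']] by (simp add: A_def)
    then obtain d where d: "fst (T h) = d *\<^sub>R \<beta>0" using \<beta>0(3) by blast
    then have "fst (T h) = (d / c) *\<^sub>R \<beta>" using c c0 by simp
    moreover have "\<beta> \<bullet> fst (T h) = 0" by (rule fst_T)
    ultimately have "fst (T h) = 0" using \<beta>(1) by (simp add: dot_square_norm)
    with sh have "T h = 0" by (simp add: prod_eq_iff)
    then show "h = 0" using norm_T[of h] by simp
  qed
  have F0: "F z0 = 0" by (simp add: F_def Tz0 \<beta>(2))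
  note nd = local_degree_nondegenerate[OF zero_less_one continuous_on_subset[OF cF subset_UNIV] F0 dF injA]
  obtain \<eta> where \<eta>: "\<eta> > 0" "\<And>z. z \<in> cball z0 \<eta> \<Longrightarrow> z \<noteq> z0 \<Longrightarrow> F z \<noteq> 0" using nd(2) by blast
  have "even (manifold_degree (tilde ?J) (hemi 1 z0)) \<longleftrightarrow> even (local_degree F z0)"
    by (rule even_manifold_degree[OF _ \<eta>(1) continuous_on_subset[OF cF subset_UNIV] \<eta>(2)]) (auto simp: F_def)
  then show "odd (manifold_degree (tilde ?J) (\<beta>, p))" using nd(1) by (simp add: hz0)
  let ?Z = "{q. norm (fst q) = 1 \<and> tilde ?J q = 0}"
  define D where "D = {q::(real^'m) \<times> (real^'m). 0 < \<beta> \<bullet> fst q}"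
  have oD: "open D" unfolding D_def by (intro open_Collect_less continuous_intros)
  have cD: "continuous_on D (\<lambda>q. hemi_inv q - z0)"
    using Ck_on_hemi_inv[of 0 z0] by (auto simp: D_def intro: continuous_on_subset)
  \<comment> \<open>Isolation in the chart is pulled back along \<open>hemi_inv\<close> to an open
    set of the ambient product space.\<close>
  define N where "N = (\<lambda>q. hemi_inv q - z0) -` ball 0 \<eta> \<inter> D"
  have oN: "open N" unfolding N_def
    using continuous_on_open_vimage[OF oD] cD by blast
  have pN: "(\<beta>, p) \<in> N"
    using hemi_inv_hemi[of 1 z0] \<beta>(1) \<eta>(1) by (simp add: hz0 N_def D_def dot_square_norm)
  have uN: "q = (\<beta>, p)" if q: "q \<in> ?Z" "q \<in> N" for q
  proof -
    have h: "hemi 1 (hemi_inv q) = q" by (rule hemi_hemi_inv) (use q in \<open>auto simp: N_def D_def\<close>)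
    have "F (hemi_inv q) = 0"
      using tilde_hemi_eq_0[of 1 ?J "hemi_inv q"] q(1) by (simp add: h F_def)
    moreover have "hemi_inv q \<in> cball z0 \<eta>" using q(2) by (simp add: N_def dist_norm norm_minus_commute)
    ultimately have "hemi_inv q = z0" using \<eta>(2) by blast
    then show ?thesis using h hz0 by simp
  qed
  show "\<not> (\<beta>, p) islimpt ?Z"
  proof
    assume "(\<beta>, p) islimpt ?Z"
    then obtain y where "y \<in> ?Z" "y \<in> N" "y \<noteq> (\<beta>, p)" by (rule islimptE[OF _ pN oN])
    then show False using uN by blast
  qed
qed

theorem corollary5p3:
  fixes f :: "real^'m \<Rightarrow> real^'n" and r :: real
  assumes "even CARD('m)"
    and "CARD('n) = 2 * CARD('m) - 1"
    and "smooth_on UNIV f"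
    and "r > 0"
    and "\<forall>p\<in>sphere 0 r. \<not> singular_point f p"
    and "\<forall>p. singular_point f p \<longrightarrow> cross_cap f p"
  shows "Lambda r (\<lambda>x. jacobian f (at x)) = int (card {p \<in> cball 0 r. cross_cap f p}) mod 2"
proof -
  let ?J = "\<lambda>x. jacobian f (at x)"
  \<comment> \<open>A positive even number is at least 2, which leaves room for a direction
    \<open>v'\<close> orthogonal to \<open>v\<close>.\<close>
  have m2: "CARD('m) \<ge> 2"
    using assms(1) zero_less_card_finite[where 'a='m] by (metis One_nat_def Suc_1 Suc_leI le_neq_implies_less odd_one)
  have card: "CARD('m) + CARD('m) = CARD('n) + 1" using assms(2) m2 by simp
  have fC: "Ck_on k UNIV f" for k by (rule smooth_on_open_Ck[OF open_UNIV assms(3)])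
  have JC: "Ck_on k UNIV ?J" for k by (rule Ck_on_jacobian[OF fC])
  have Jc: "continuous_on UNIV ?J" using JC[of 0] by simp
  have Js: "smooth_on (cball 0 r) ?J" by (rule Ck_smooth_on[OF open_UNIV subset_UNIV JC])
  define Z where "Z = tilde_zeros r ?J"
  have Zd: "q \<in> Z \<longleftrightarrow> norm (fst q) = 1 \<and> norm (snd q) \<le> r \<and> ?J (snd q) *v fst q = 0" for q
    by (auto simp: Z_def tilde_zeros_def mem_Times_iff tilde_eq)
  have Zcc: "cross_cap f (snd q)" if "q \<in> Z" for q
  proof -
    have "fst q \<noteq> 0" "?J (snd q) *v fst q = 0" using that by (auto simp: Zd)
    then show ?thesis using assms(6) by (auto simp: singular_point_iff)
  qed
  note at_cc = tilde_jacobian_at_cross_cap[OF m2 card fC]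
  \<comment> \<open>Infinitely many zeros would accumulate at a point of the compact set
    \<open>Z\<close>, against their isolation over cross-caps.\<close>
  have "finite Z"
  proof (rule ccontr)
    assume inf: "infinite Z"
    have "continuous_on UNIV (\<lambda>q. tilde ?J q)"
      unfolding tilde_eq by (intro continuous_intros continuous_on_compose2[OF Jc]) auto
    then have "closed {q. tilde ?J q = 0}" by (intro closed_Collect_eq continuous_on_const)
    then have "compact ((sphere 0 1 \<times> cball 0 r) \<inter> {q. tilde ?J q = 0})"
      by (intro compact_Int_closed compact_Times) auto
    moreover have "(sphere 0 1 \<times> cball 0 r) \<inter> {q. tilde ?J q = 0} = Z"
      by (auto simp: Z_def tilde_zeros_def)
    ultimately obtain q where q: "q \<in> Z" "q islimpt Z"
      using inf unfolding compact_eq_Bolzano_Weierstrass by blast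
    have "q islimpt {q. norm (fst q) = 1 \<and> tilde ?J q = 0}"
      by (rule islimpt_subset[OF q(2)]) (auto simp: Zd tilde_eq)
    then show False
      using at_cc(2)[OF Zcc[OF q(1)], of "fst q"] q(1) by (simp add: Zd)
  qed
  have "0 \<notin> fst ` Z" by (auto simp: Zd)
  then obtain v where v: "norm v = 1" "\<And>s. s \<in> fst ` Z \<Longrightarrow> v \<bullet> s \<noteq> 0"
    using exists_unit_nonorthogonal[of "fst ` Z"] \<open>finite Z\<close> by blast
  \<comment> \<open>A hemisphere whose equator avoids all zeros selects one from each antipodal
    pair.\<close>
  define H where "H = {q \<in> Z. v \<bullet> fst q > 0}"
  have half: "half_of_zeros Z H"
    unfolding half_of_zeros_def
  proof (intro conjI ballI)
    show "H \<subseteq> Z" by (auto simp: H_def)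
    fix q assume q: "q \<in> Z"
    have "(- fst q, snd q) \<in> Z" using q by (simp add: Zd bounded_bilinear.minus_right[OF bounded_bilinear_matrix_vector])
    moreover have "v \<bullet> fst q \<noteq> 0" using v(2) q by blast
    ultimately show "case q of (\<beta>, x) \<Rightarrow> ((\<beta>, x) \<in> H) = ((- \<beta>, x) \<notin> H)"
      using q by (auto simp: H_def case_prod_unfold)
  qed
  have odd_H: "odd (manifold_degree (tilde ?J) q)" if "q \<in> Z" for q
    using at_cc(1)[OF Zcc[OF that], of "fst q"] that by (simp add: Zd)
  \<comment> \<open>The kernel over a cross-cap is a line; of its two unit vectors exactly one lies
    on the side of \<open>v\<close>.\<close>
  have "bij_betw snd H {p \<in> cball 0 r. cross_cap f p}"
    unfolding bij_betw_def
  proof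
    show "inj_on snd H"
    proof (rule inj_onI)
      fix q q' assume q: "q \<in> H" "q' \<in> H" "snd q = snd q'"
      obtain \<beta>0 where \<beta>0: "\<forall>\<beta>. ?J (snd q) *v \<beta> = 0 \<longrightarrow> (\<exists>c. \<beta> = c *\<^sub>R \<beta>0)"
      proof -
        have "cross_cap f (snd q)" using q(1) Zcc by (simp add: H_def)
        then show thesis by (rule cross_cap_nondegenerate[OF fC]) (rule that)
      qed
      obtain c c' where c: "fst q = c *\<^sub>R \<beta>0" "fst q' = c' *\<^sub>R \<beta>0"
        using \<beta>0[rule_format, of "fst q"] \<beta>0[rule_format, of "fst q'"] q by (auto simp: H_def Zd)
      have n: "\<bar>c\<bar> * norm \<beta>0 = 1" "\<bar>c'\<bar> * norm \<beta>0 = 1" using c q by (auto simp: H_def Zd)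
      have s: "c * (v \<bullet> \<beta>0) > 0" "c' * (v \<bullet> \<beta>0) > 0" using c q by (auto simp: H_def)
      have "norm \<beta>0 \<noteq> 0" using n by auto
      then have "\<bar>c\<bar> = \<bar>c'\<bar>" using n by (metis mult_right_cancel)
      moreover have "c > 0 \<longleftrightarrow> c' > 0" using s by (auto simp: zero_less_mult_iff)
      ultimately have "c = c'" by (auto simp: abs_if split: if_splits)
      then show "q = q'" using c q(3) by (simp add: prod_eq_iff)
    qed
    show "snd ` H = {p \<in> cball 0 r. cross_cap f p}"
    proof (intro equalityI subsetI)
      fix p assume "p \<in> snd ` H"
      then obtain q where "q \<in> Z" "p = snd q" by (auto simp: H_def)
      then show "p \<in> {p \<in> cball 0 r. cross_cap f p}" using Zcc by (auto simp: Zd)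
    next
      fix p assume p: "p \<in> {p \<in> cball 0 r. cross_cap f p}"
      obtain \<beta>0 where \<beta>0: "\<beta>0 \<noteq> 0" "?J p *v \<beta>0 = 0"
      proof -
        have "cross_cap f p" using p by simp
        then show thesis by (rule cross_cap_nondegenerate[OF fC]) (rule that)
      qed
      define \<beta> where "\<beta> = (1 / norm \<beta>0) *\<^sub>R \<beta>0"
      have Zp: "(\<beta>, p) \<in> Z" "(- \<beta>, p) \<in> Z"
        using \<beta>0 p by (simp_all add: Zd \<beta>_def matrix_vector_mult_scaleR
            bounded_bilinear.minus_right[OF bounded_bilinear_matrix_vector])
      have "v \<bullet> \<beta> \<noteq> 0" using v(2) Zp(1) by force
      then have "(\<beta>, p) \<in> H \<or> (- \<beta>, p) \<in> H" using Zp by (auto simp: H_def)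
      then show "p \<in> snd ` H" by force
    qed
  qed
  then have cardH: "card H = card {p \<in> cball 0 r. cross_cap f p}" by (rule bij_betw_same_card)
  have "even (\<Sum>q\<in>H. manifold_degree (tilde ?J) q) \<longleftrightarrow> even (\<Sum>q\<in>H. 1 :: int)"
    by (rule even_sum_cong) (use odd_H in \<open>auto simp: H_def\<close>)
  then have sumH: "(\<Sum>q\<in>H. manifold_degree (tilde ?J) q) mod 2 = int (card H) mod 2"
    by (auto simp: mod_2_eq_odd)
  have injr: "?J x *v \<beta> \<noteq> 0" if "norm x = r" "\<beta> \<noteq> 0" for x \<beta>
    using assms(5) that singular_point_iff[of f x] by auto
  \<comment> \<open>The description in \<open>Lambda\<close> calls for a witness and uniqueness. The
    derivative itself with the half \<open>H\<close> is the witness; any other extension and half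
    give the same parity by \<open>even_sum_manifold_degree_independent\<close>.\<close>
  show ?thesis
    unfolding Lambda_def
  proof (rule the_equality)
    show "\<exists>a H. smooth_on (cball 0 r) a \<and> (\<forall>x\<in>sphere 0 r. a x = ?J x) \<and> finite (tilde_zeros r a) \<and>
        half_of_zeros (tilde_zeros r a) H \<and>
        int (card {p \<in> cball 0 r. cross_cap f p}) mod 2 = (\<Sum>z\<in>H. manifold_degree (tilde a) z) mod 2"
      using Js \<open>finite Z\<close> half sumH cardH by (intro exI[of _ ?J] exI[of _ H]) (simp add: Z_def)
    fix w assume "\<exists>a H. smooth_on (cball 0 r) a \<and> (\<forall>x\<in>sphere 0 r. a x = ?J x) \<and> finite (tilde_zeros r a) \<and>
        half_of_zeros (tilde_zeros r a) H \<and> w = (\<Sum>z\<in>H. manifold_degree (tilde a) z) mod 2"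
    then obtain a H' where a: "smooth_on (cball 0 r) a" "\<And>x. norm x = r \<Longrightarrow> a x = ?J x" "finite (tilde_zeros r a)"
      "half_of_zeros (tilde_zeros r a) H'" "w = (\<Sum>z\<in>H'. manifold_degree (tilde a) z) mod 2"
      by auto
    have "even (\<Sum>q\<in>H. manifold_degree (tilde ?J) q) \<longleftrightarrow> even (\<Sum>q\<in>H'. manifold_degree (tilde a) q)"
      by (rule even_sum_manifold_degree_independent[OF m2 card assms(4) Js a(1) _ injr _ a(3) _ a(4)])
        (use a(2) \<open>finite Z\<close> half in \<open>auto simp: Z_def\<close>)
    then have "(\<Sum>q\<in>H. manifold_degree (tilde ?J) q) mod 2 = (\<Sum>q\<in>H'. manifold_degree (tilde a) q) mod 2"
      by (simp add: mod_2_eq_odd)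
    then show "w = int (card {p \<in> cball 0 r. cross_cap f p}) mod 2"
      using sumH cardH a(5) by simp
  qed
qed

end
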